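(* Let $\Omega$, $\mathcal O$, $g$, $\Omega_n$, $\mathcal O_n$, $\mathbf g_n$, $\delta_n$, $\eta$, $h>0$ be as in the context, and let the kernel, domain and data assumptions stated there hold. Let $\mathbf u_n:\Omega_n\to\mathbb R$ solve the graph infinity Laplacian equation with labels $\mathbf g_n$ on $\mathcal O_n$, let $u:\overline\Omega\to\mathbb R$ be an absolutely minimizing Lipschitz extension of $g$, and let $u_n=\mathbf u_n\circ\pi_n:\overline\Omega\to\mathbb R$ be the piecewise constant extension of $\mathbf u_n$. Let $\phi(h)\lesssim h^{9/5}$ (e.g., if $\Omega$ is convex or $\partial\Omega$ is at least $C^{1,4/5}$). Let the scaling assumption stated in the context hold for $(\delta_n,h,\varepsilon)$, with $\varepsilon=h^{1/5}$ in part 1 and $\varepsilon=h^{1/3}$ in part 2. Then we have the following convergence rates: 1. For $h\gtrsim\delta_n^{5/9}$ it holds $$\sup_{\Omega_n}|u-\mathbf u_n|=\sup_{\overline\Omega}|u-u_n|\lesssim h^{1/5}.$$ 2. If $\inf_{\overline\Omega}|\nabla u|>0$, then for $h\gtrsim\delta_n^{3/5}$ it holds $$\sup_{\Omega_n}|u-\mathbf u_n|=\sup_{\overline\Omega}|u-u_n|\lesssim h^{1/3}.$$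
   Context: Notation: $a\vee b=\max\{a,b\}$, $|\cdot|$ is the Euclidean norm, $a\lesssim b$ means $a\le C\,b$ for a universal constant $C>0$, possibly depending on the kernel $\eta$ or the label function $g$, and $a\gtrsim b$ means $b\lesssim a$. Domain. $\Omega\subset\mathbb R^d$ is an open bounded domain, and $d_\Omega(x,y)=\inf\{\int_0^1|\dot\xi(t)|\,dt:\ \xi\in C^1([0,1];\overline\Omega),\ \xi(0)=x,\ \xi(1)=y\}$ for $x,y\in\overline\Omega$. Relatively open, connected, and relative boundary $\partial^{\mathrm{rel}}$ refer to the metric space $(\overline\Omega,d_\Omega)$. Domain assumption: there exist $\phi:[0,\infty)\to[0,\infty)$ with $\lim_{h\downarrow0}\phi(h)/h=0$ and $r_\Omega>0$ such that $d_\Omega(x,y)\le|x-y|+\phi(|x-y|)$ for all $x,y\in\Omega$ with $|x-y|\le r_\Omega$. For $h>0$ set $\sigma_\phi(h)=\sup_{0<s\le h}\phi(s)/s$. Labels and point clouds. $\mathcal O\subset\overline\Omega$ is closed, $\Omega_{\mathcal O}=\overline\Omega\setminus\mathcal O$, and $g:\mathcal O\to\mathbb R$ is the labelling function. For $n\in\mathbb N$, $\Omega_n\subset\overline\Omega$ is a (finite) point cloud, $\mathcal O_n\subset\Omega_n$ is the set of labelled vertices, and $\mathbf g_n:\mathcal O_n\to\mathbb R$. With the Hausdorff distance $d_H(A,B)=\sup_{x\in A}\inf_{y\in B}|x-y|\vee\sup_{x\in B}\inf_{y\in A}|x-y|$, the graph resolution is $\delta_n=d_H(\Omega_n,\overline\Omega)\vee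 d_H(\mathcal O_n,\mathcal O)$. Closest point projections: $\pi_n(x)\in\operatorname{argmin}_{\mathbf x\in\Omega_n}|x-\mathbf x|$ for $x\in\overline\Omega$, and $\pi_{\mathcal O_n}(z)\in\operatorname{argmin}_{\mathbf z\in\mathcal O_n}|z-\mathbf z|$ for $z\in\mathcal O$. Kernel assumption: $\eta:(0,\infty)\to[0,\infty)$ is nonincreasing with $\operatorname{supp}\eta\subset[0,1]$, $\sigma_\eta:=\sup_{t>0}t\eta(t)\in(0,\infty)$, and there exists $t_0\in(0,1]$ (chosen as the largest number with this property) with $\sigma_\eta=t_0\eta(t_0)$. For the graph length scale $h>0$ set $\eta_h(t)=\frac1{\sigma_\eta h}\eta(t/h)$, with the convention $\eta(0)\cdot0:=0$. Graph. Weights on $\Omega_n$: $\mathbf w_n(\mathbf x,\mathbf y)=\eta_h(|\mathbf x-\mathbf y|)$ for $\mathbf x\ne\mathbf y$ and $0$ for $\mathbf x=\mathbf y$. Graph distance: $\mathbf d_n(\mathbf x,\mathbf x)=0$ and, for $\mathbf x\ne\mathbf y$, $\mathbf d_n(\mathbf x,\mathbf y)=\min\{\sum_{i=1}^N\mathbf w_n(\mathbf x_{i-1},\mathbf x_i)^{-1}\}$ over all $N\in\mathbb N$ and sequences $(\mathbf x_i)_{i=0}^N$ in $\Omega_n$ with $\mathbf x_0=\mathbf x$, $\mathbf x_N=\mathbf y$ (with $0^{-1}=\infty$). For $A\subset\Omega_n$, $\operatorname{Lip}_n(\mathbf v;A)=\max_{\mathbf x\neq\mathbf y\in A}|\mathbf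 v(\mathbf x)-\mathbf v(\mathbf y)|/\mathbf d_n(\mathbf x,\mathbf y)$. Graph infinity Laplacian equation: $\min_{\mathbf y\in\Omega_n}\eta_h(|\mathbf x-\mathbf y|)(\mathbf u_n(\mathbf y)-\mathbf u_n(\mathbf x))+\max_{\mathbf y\in\Omega_n}\eta_h(|\mathbf x-\mathbf y|)(\mathbf u_n(\mathbf y)-\mathbf u_n(\mathbf x))=0$ for $\mathbf x\in\Omega_n\setminus\mathcal O_n$, and $\mathbf u_n=\mathbf g_n$ on $\mathcal O_n$. Absolutely minimizing Lipschitz extension. For $A\subset\overline\Omega$, $\operatorname{Lip}_\Omega(u;A)=\sup_{x\ne y\in A}|u(x)-u(y)|/d_\Omega(x,y)$. A function $u\in C(\overline\Omega)$ is an absolutely minimizing Lipschitz extension of $g$ if $u=g$ on $\mathcal O$ and $\operatorname{Lip}_\Omega(u;\overline V)=\operatorname{Lip}_\Omega(u;\partial^{\mathrm{rel}}V)$ for all relatively open and connected subsets $V\subset\Omega_{\mathcal O}$. Data assumption: $\sup_{n\in\mathbb N}\operatorname{Lip}_n(\mathbf g_n;\mathcal O_n)<\infty$, $\operatorname{Lip}_\Omega(g;\mathcal O)<\infty$, and there exists a constant $C>0$ such that $|\mathbf g_n(\pi_{\mathcal O_n}(z))-g(z)|\le C\delta_n$ for all $z\in\mathcal O$. Scaling assumption on $(\delta_n,h,\varepsilon)$: $h\le r_\Omega$, $\ \frac h\varepsilon<\frac12$, and $\sigma_\phi(h)+\frac{\delta_n}h\le\frac{t_0}{4+2\sigma_\phi(h)}\left(1-2\frac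 h\varepsilon\right)$.
   Formalization: The equality of the suprema over Ω_n and over the closure of Ω is false in general; proved instead: the first is at most the second, the second at most the first plus Cδ_n, and both obey the rate. The examples (convex, C^{1,4/5} boundary) for the condition on φ are not treated. *)

theory Defs
  imports "HOL-Analysis.Analysis"
begin

section \<open>Lipschitz constants and the Hausdorff distance\<close>

text \<open>Values in \<^typ>\<open>ennreal\<close>: the supremum over no pairs is 0, an infinite distance
  contributes the quotient 0, and an unbounded family gives \<open>\<infinity>\<close>.\<close>

definition lip_const :: "('a \<Rightarrow> 'a \<Rightarrow> ennreal) \<Rightarrow> ('a \<Rightarrow> real) \<Rightarrow> 'a set \<Rightarrow> ennreal" where
  "lip_const d v A =
     (SUP p\<in>{(x, y). x \<in> A \<and> y \<in> A \<and> x \<noteq> y}. ennreal \<bar>v (fst p) - v (snd p)\<bar> / d (fst p) (snd p))"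

text \<open>Intended for nonempty bounded sets only.\<close>

definition hausdorff_dist :: "'a::metric_space set \<Rightarrow> 'a set \<Rightarrow> real" where
  "hausdorff_dist A B = max (SUP x\<in>A. INF y\<in>B. dist x y) (SUP x\<in>B. INF y\<in>A. dist x y)"

section \<open>The domain\<close>

text \<open>The value 0 outside the closure only serves to make the distance a total function that is
  symmetric and nonnegative, as the locale \<^locale>\<open>Metric_space\<close> demands.  Under the
  domain assumption below, and for open connected \<open>\<Omega>\<close>, the infimum ranges over a nonempty set.\<close>

definition geo_dist :: "'a::euclidean_space set \<Rightarrow> 'a \<Rightarrow> 'a \<Rightarrow> real" where
  "geo_dist \<Omega> x y =
     (if x \<in> closure \<Omega> \<and> y \<in> closure \<Omega>
      then Inf {integral {0..1} (\<lambda>t. norm (\<xi>' t)) | \<xi> \<xi>'.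
                  (\<forall>t\<in>{0..1}. (\<xi> has_vector_derivative \<xi>' t) (at t within {0..1})) \<and>
                  continuous_on {0..1} \<xi>' \<and> \<xi> ` {0..1} \<subseteq> closure \<Omega> \<and> \<xi> 0 = x \<and> \<xi> 1 = y}
      else 0)"

definition domain_assumption :: "'a::euclidean_space set \<Rightarrow> (real \<Rightarrow> real) \<Rightarrow> real \<Rightarrow> bool" where
  "domain_assumption \<Omega> \<phi> r \<longleftrightarrow>
     (\<forall>s\<ge>0. \<phi> s \<ge> 0) \<and> ((\<lambda>s. \<phi> s / s) \<longlongrightarrow> 0) (at_right 0) \<and> r > 0 \<and>
     (\<forall>x\<in>\<Omega>. \<forall>y\<in>\<Omega>. dist x y \<le> r \<longrightarrow> geo_dist \<Omega> x y \<le> dist x y + \<phi> (dist x y))"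

definition \<sigma>_phi :: "(real \<Rightarrow> real) \<Rightarrow> real \<Rightarrow> real" where
  "\<sigma>_phi \<phi> h = (SUP s\<in>{0<..h}. \<phi> s / s)"

abbreviation Lip_domain :: "'a::euclidean_space set \<Rightarrow> ('a \<Rightarrow> real) \<Rightarrow> 'a set \<Rightarrow> ennreal" where
  "Lip_domain \<Omega> \<equiv> lip_const (\<lambda>x y. ennreal (geo_dist \<Omega> x y))"

abbreviation geo_topology :: "'a::euclidean_space set \<Rightarrow> 'a topology" where
  "geo_topology \<Omega> \<equiv> Metric_space.mtopology (closure \<Omega>) (geo_dist \<Omega>)"

text \<open>Only the values of \<open>u\<close> on \<open>closure \<Omega>\<close> and of \<open>g\<close> on the label set \<open>\<O>\<close> matter.\<close>

definition is_AMLE ::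
  "'a::euclidean_space set \<Rightarrow> 'a set \<Rightarrow> ('a \<Rightarrow> real) \<Rightarrow> ('a \<Rightarrow> real) \<Rightarrow> bool" where
  "is_AMLE \<Omega> \<O> g u \<longleftrightarrow>
     continuous_on (closure \<Omega>) u \<and> (\<forall>x\<in>\<O>. u x = g x) \<and>
     (\<forall>V. V \<subseteq> closure \<Omega> - \<O> \<and> openin (geo_topology \<Omega>) V \<and> connectedin (geo_topology \<Omega>) V \<longrightarrow>
        Lip_domain \<Omega> u (geo_topology \<Omega> closure_of V) =
        Lip_domain \<Omega> u (geo_topology \<Omega> frontier_of V))"

text \<open>Positive infimum of the norm of the gradient.  The function \<open>u\<close> lives on \<open>closure \<Omega>\<close>, so
  the gradient is a priori meaningful only at those points of the open set \<open>\<Omega>\<close> where \<open>u\<close> is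
  differentiable (for Lipschitz \<open>u\<close>: almost all); the infimum is taken over these.\<close>

definition gradient_bounded_below :: "'a::euclidean_space set \<Rightarrow> ('a \<Rightarrow> real) \<Rightarrow> bool" where
  "gradient_bounded_below \<Omega> u \<longleftrightarrow>
     (\<exists>\<alpha>>0. \<forall>x\<in>\<Omega>. \<forall>D. GDERIV u x :> D \<longrightarrow> \<alpha> \<le> norm D)"

section \<open>The kernel\<close>

text \<open>Only the values of \<open>\<eta>\<close> on the positive reals matter.\<close>

definition \<sigma>_eta :: "(real \<Rightarrow> real) \<Rightarrow> real" where
  "\<sigma>_eta \<eta> = (SUP t\<in>{0<..}. t * \<eta> t)"

definition kernel_assumption :: "(real \<Rightarrow> real) \<Rightarrow> real \<Rightarrow> bool" where
  "kernel_assumption \<eta> t0 \<longleftrightarrow>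
     (\<forall>t>0. \<eta> t \<ge> 0) \<and> antimono_on {0<..} \<eta> \<and> closure {t. t > 0 \<and> \<eta> t \<noteq> 0} \<subseteq> {0..1} \<and>
     bdd_above ((\<lambda>t. t * \<eta> t) ` {0<..}) \<and> \<sigma>_eta \<eta> > 0 \<and>
     t0 \<in> {0<..1} \<and> \<sigma>_eta \<eta> = t0 * \<eta> t0 \<and> (\<forall>t\<in>{0<..1}. \<sigma>_eta \<eta> = t * \<eta> t \<longrightarrow> t \<le> t0)"

definition \<eta>_scaled :: "(real \<Rightarrow> real) \<Rightarrow> real \<Rightarrow> real \<Rightarrow> real" where
  "\<eta>_scaled \<eta> h t = \<eta> (t / h) / (\<sigma>_eta \<eta> * h)"

section \<open>The graph\<close>

definition graph_weight :: "(real \<Rightarrow> real) \<Rightarrow> real \<Rightarrow> 'a::euclidean_space \<Rightarrow> 'a \<Rightarrow> real" where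
  "graph_weight \<eta> h x y = (if x = y then 0 else \<eta>_scaled \<eta> h (dist x y))"

text \<open>In \<^typ>\<open>ennreal\<close> we have \<open>inverse 0 = \<infinity>\<close>, and the distance between points that no path
  connects is \<open>\<infinity>\<close>.\<close>

definition graph_dist ::
  "(real \<Rightarrow> real) \<Rightarrow> real \<Rightarrow> 'a::euclidean_space set \<Rightarrow> 'a \<Rightarrow> 'a \<Rightarrow> ennreal" where
  "graph_dist \<eta> h X x y =
     (if x = y then 0
      else Inf {(\<Sum>i=1..N. inverse (ennreal (graph_weight \<eta> h (p (i - 1)) (p i)))) | p N.
                  p ` {0..N::nat} \<subseteq> X \<and> p 0 = x \<and> p N = y})"

abbreviation Lip_graph ::
  "(real \<Rightarrow> real) \<Rightarrow> real \<Rightarrow> 'a::euclidean_space set \<Rightarrow> ('a \<Rightarrow> real) \<Rightarrow> 'a set \<Rightarrow> ennreal" where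
  "Lip_graph \<eta> h X \<equiv> lip_const (graph_dist \<eta> h X)"

text \<open>The term for \<open>y = x\<close> is 0 whatever \<open>\<eta> 0\<close> is.\<close>

definition solves_graph_infinity_laplace ::
  "(real \<Rightarrow> real) \<Rightarrow> real \<Rightarrow> 'a::euclidean_space set \<Rightarrow> 'a set \<Rightarrow> ('a \<Rightarrow> real) \<Rightarrow> ('a \<Rightarrow> real) \<Rightarrow> bool"
where
  "solves_graph_infinity_laplace \<eta> h X L \<gamma> v \<longleftrightarrow>
     (\<forall>x\<in>X - L. (MIN y\<in>X. \<eta>_scaled \<eta> h (dist x y) * (v y - v x)) +
                 (MAX y\<in>X. \<eta>_scaled \<eta> h (dist x y) * (v y - v x)) = 0) \<and>
     (\<forall>x\<in>L. v x = \<gamma> x)"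

section \<open>Point clouds and assumptions on the data\<close>

definition labelled_cloud ::
  "'a::euclidean_space set \<Rightarrow> 'a set \<Rightarrow> 'a set \<Rightarrow> 'a set \<Rightarrow> ('a \<Rightarrow> 'a) \<Rightarrow> ('a \<Rightarrow> 'a) \<Rightarrow> bool" where
  "labelled_cloud \<Omega> \<O> X L \<pi>X \<pi>L \<longleftrightarrow>
     finite X \<and> X \<subseteq> closure \<Omega> \<and> L \<subseteq> X \<and> L \<noteq> {} \<and>
     (\<forall>x\<in>closure \<Omega>. is_arg_min (dist x) (\<lambda>y. y \<in> X) (\<pi>X x)) \<and>
     (\<forall>z\<in>\<O>. is_arg_min (dist z) (\<lambda>y. y \<in> L) (\<pi>L z))"

definition resolution :: "'a::euclidean_space set \<Rightarrow> 'a set \<Rightarrow> 'a set \<Rightarrow> 'a set \<Rightarrow> real" where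
  "resolution \<Omega> \<O> X L = max (hausdorff_dist X (closure \<Omega>)) (hausdorff_dist L \<O>)"

text \<open>The data assumption on the sequences of clouds \<open>X n\<close>, label sets \<open>L n\<close> and labels \<open>\<gamma> n\<close>,
  with its two finite constants \<open>M\<close> and \<open>K\<close> made explicit, because estimates that are uniform in
  \<open>n\<close> and \<open>h\<close> may depend on them.\<close>

definition data_assumption ::
  "'a::euclidean_space set \<Rightarrow> 'a set \<Rightarrow> ('a \<Rightarrow> real) \<Rightarrow> (real \<Rightarrow> real) \<Rightarrow> real \<Rightarrow>
   (nat \<Rightarrow> 'a set) \<Rightarrow> (nat \<Rightarrow> 'a set) \<Rightarrow> (nat \<Rightarrow> 'a \<Rightarrow> real) \<Rightarrow> (nat \<Rightarrow> 'a \<Rightarrow> 'a) \<Rightarrow>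
   real \<Rightarrow> real \<Rightarrow> bool" where
  "data_assumption \<Omega> \<O> g \<eta> h X L \<gamma> \<pi>L M K \<longleftrightarrow>
     (SUP n. Lip_graph \<eta> h (X n) (\<gamma> n) (L n)) \<le> ennreal M \<and>
     Lip_domain \<Omega> g \<O> < \<infinity> \<and>
     (\<forall>n. \<forall>z\<in>\<O>. \<bar>\<gamma> n (\<pi>L n z) - g z\<bar> \<le> K * resolution \<Omega> \<O> (X n) (L n))"

definition scaling_assumption ::
  "(real \<Rightarrow> real) \<Rightarrow> real \<Rightarrow> real \<Rightarrow> real \<Rightarrow> real \<Rightarrow> real \<Rightarrow> bool" where
  "scaling_assumption \<phi> r t0 \<delta> h \<epsilon> \<longleftrightarrow>
     h \<le> r \<and> h / \<epsilon> < 1 / 2 \<and>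
     \<sigma>_phi \<phi> h + \<delta> / h \<le> t0 / (4 + 2 * \<sigma>_phi \<phi> h) * (1 - 2 * (h / \<epsilon>))"

end

theory Submission
  imports Defs
begin

text \<open>Fix a length \<open>\<epsilon>\<close> between the graph length scale \<open>h\<close> and 1, and let \<open>f\<^sup>\<epsilon>\<close> be the supremum of \<open>f\<close>
  over intrinsic balls of radius \<open>\<epsilon>\<close>. The proof compares \<open>u\<^sup>\<epsilon>\<close> with the corresponding infimum of
  the graph solution \<open>v\<close>, as value functions of a game with steps of length \<open>\<epsilon>\<close>.

  An absolutely minimizing function enjoys comparison with cones from above
  (\<open>cone_comparison_if_minimizing\<close>). Comparing \<open>u\<close> with one cone gives \<open>2 u\<^sup>\<epsilon> \<le> u + u\<^bsup>2\<epsilon>\<^esup>\<close> at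
  distance \<open>2 \<epsilon>\<close> from the labels, and because the intrinsic distance has midpoints this says that
  \<open>u\<^sup>\<epsilon>\<close> is subharmonic: \<open>2 u\<^sup>\<epsilon>(x)\<close> is at most the sum of the maximum and the minimum of \<open>u\<^sup>\<epsilon>\<close> over
  the \<open>\<epsilon>\<close>-ball around \<open>x\<close> (\<open>ball_sup_doubling\<close>, \<open>ball_sup_subharmonic\<close>). The graph equation
  likewise yields comparison with cones of the graph distance (\<open>graph_cone_comparison\<close>). The graph
  distance is the intrinsic one up to an additive error of order \<open>h\<close> and relative errors of order
  \<open>\<delta>/h\<close> and \<open>h\<^bsup>4/5\<^esup>\<close>, so that the infimum of \<open>v\<close> over \<open>\<epsilon>\<close>-balls is superharmonic up to an error of
  order \<open>h + \<epsilon> \<delta>/h + \<epsilon> h\<^bsup>4/5\<^esup>\<close> (\<open>cloud_ball_sup_doubling\<close>). The lower bounds on \<open>h\<close> in terms of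
  \<open>\<delta>\<close> make this an error of order \<open>h\<close>.

  If a subharmonic function is strictly so, by more than the error of the superharmonic one, then
  their difference is largest close to the labels (\<open>step_comparison_principle\<close>), where both
  functions are Lipschitz continuous and the difference is of order \<open>\<epsilon>\<close>. Strictness is bought with
  convexity: if \<open>U\<close> is subharmonic and its maximum over each \<open>\<epsilon>\<close>-ball exceeds the value at the
  centre by \<open>t\<close>, then adding \<open>\<beta> (U + c)\<^sup>2\<close> gains \<open>\<beta> t\<^sup>2\<close>, at the price of an error of order \<open>\<beta>\<close>.
  So \<open>\<beta>\<close> has to be a multiple of \<open>h/t\<^sup>2\<close>. Under a lower bound on the gradient \<open>t\<close> is of order \<open>\<epsilon>\<close>,
  and \<open>\<epsilon> = h\<^bsup>1/3\<^esup>\<close> balances \<open>h/\<epsilon>\<^sup>2\<close> against \<open>\<epsilon>\<close> (\<open>estimate_with_gradient_bound\<close>). Without it, flat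
  parts of \<open>u\<^sup>\<epsilon>\<close> are lowered so as to acquire the slope \<open>t = \<epsilon>\<^sup>2\<close> per step; paths have \<open>1/\<epsilon>\<close> steps
  up to a constant, so this costs an error of order \<open>\<epsilon>\<close>, and \<open>\<epsilon> = h\<^bsup>1/5\<^esup>\<close> balances \<open>h/\<epsilon>\<^sup>4\<close> against
  \<open>\<epsilon>\<close> (\<open>slope_patching\<close>, \<open>general_estimate\<close>). These estimates bound \<open>u - v\<close> from above; applied to
  \<open>-u\<close> and \<open>-v\<close> they bound it from below.

  Two further ingredients concern the domain and the gradient. The domain assumption speaks about
  points of the open set \<open>\<Omega>\<close>, whereas all arguments above take place in its closure; boundary
  points are reached by arcs of class \<open>C\<^sup>1\<close> that are concatenated from infinitely many pieces
  (\<open>timed_arc_limit\<close>). And the gradient is bounded below only where it exists; but a function with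
  comparison with cones is differentiable wherever a paraboloid touches it from above, and such
  points are dense, so the bound turns into one on the slope over every ball away from the labels
  (\<open>touching_differentiable\<close>, \<open>slope_ge_of_gradient_ge\<close>).\<close>

section \<open>Continuously differentiable arcs\<close>

definition c1_arc ::
  "'a::euclidean_space set \<Rightarrow> 'a \<Rightarrow> 'a \<Rightarrow> (real \<Rightarrow> 'a) \<Rightarrow> (real \<Rightarrow> 'a) \<Rightarrow> bool" where
  "c1_arc S x y \<xi> \<xi>' \<longleftrightarrow>
     (\<forall>t\<in>{0..1}. (\<xi> has_vector_derivative \<xi>' t) (at t within {0..1})) \<and>
     continuous_on {0..1} \<xi>' \<and> \<xi> ` {0..1} \<subseteq> S \<and> \<xi> 0 = x \<and> \<xi> 1 = y"

text \<open>A \<open>C\<^sup>1\<close> arc over the whole line that moves during the unit interval only, so that two of them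
  can be concatenated without a kink. The clock \<open>s\<close> dominates the arc length, and the bound on its
  speed \<open>w\<close> lets arcs be strung together infinitely often.\<close>

definition timed_arc :: "'a::euclidean_space set \<Rightarrow> 'a \<Rightarrow> 'a \<Rightarrow> real \<Rightarrow> bool" where
  "timed_arc S x y l \<longleftrightarrow> l > 0 \<and> (\<exists>p v s w m.
     (\<forall>t. (p has_vector_derivative v t) (at t)) \<and> continuous_on UNIV v \<and>
     (\<forall>t. (s has_real_derivative w t) (at t)) \<and>
     (\<forall>t. norm (v t) \<le> w t) \<and> (\<forall>t. w t \<le> 2 * l) \<and> (\<forall>t. p t \<in> S) \<and>
     (\<forall>t\<le>0. p t = x \<and> s t = 0 \<and> v t = 0 \<and> w t = 0) \<and>
     (\<forall>t\<ge>1. p t = y \<and> s t = m \<and> v t = 0 \<and> w t = 0) \<and> m \<le> l)"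

lemma timed_arcI:
  fixes v :: "real \<Rightarrow> 'a::euclidean_space"
  assumes "\<And>t. (p has_vector_derivative v t) (at t)" "continuous_on UNIV v"
      "\<And>t. (s has_real_derivative w t) (at t)" "\<And>t. norm (v t) \<le> w t" "\<And>t. w t \<le> 2 * l"
      "\<And>t. p t \<in> S" "\<And>t. t \<le> 0 \<Longrightarrow> p t = x \<and> s t = 0 \<and> v t = 0 \<and> w t = 0"
      "\<And>t. t \<ge> 1 \<Longrightarrow> p t = y \<and> s t = m \<and> v t = 0 \<and> w t = 0" "m \<le> l" "l > 0"
  shows "timed_arc S x y l"
  unfolding timed_arc_def using assms by blast

lemma timed_arcE:
  assumes "timed_arc S x y l"
  obtains p v s w m where "\<And>t. (p has_vector_derivative v t) (at t)" "continuous_on UNIV v"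
      "\<And>t. (s has_real_derivative w t) (at t)" "\<And>t. norm (v t) \<le> w t" "\<And>t. w t \<le> 2 * l"
      "\<And>t. p t \<in> S" "\<And>t. t \<le> 0 \<Longrightarrow> p t = x \<and> s t = 0 \<and> v t = 0 \<and> w t = 0"
      "\<And>t. t \<ge> 1 \<Longrightarrow> p t = y \<and> s t = m \<and> v t = 0 \<and> w t = 0" "m \<le> l" "l > 0"
  using assms unfolding timed_arc_def
  by - (elim conjE exE, rule that, (erule spec | assumption | (drule spec, erule mp, assumption))+)

lemma has_real_derivative_pos_part_square:
  "((\<lambda>t::real. (max 0 t)\<^sup>2) has_real_derivative 2 * max 0 t) (at t)"
proof -
  consider "t > 0" | "t < 0" | "t = 0" by linarith
  then show ?thesis
  proof cases
    case 1
    have "((\<lambda>t::real. t\<^sup>2) has_real_derivative 2 * max 0 t) (at t)"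
      using 1 by (auto intro!: derivative_eq_intros)
    then show ?thesis
      by (rule DERIV_cong_ev[THEN iffD1, rotated -1])
        (use 1 eventually_nhds_in_open[of "{0<..}" t] in \<open>auto elim!: eventually_mono\<close>)
  next
    case 2
    have "((\<lambda>t::real. 0) has_real_derivative 2 * max 0 t) (at t)"
      using 2 by (auto intro!: derivative_eq_intros)
    then show ?thesis
      by (rule DERIV_cong_ev[THEN iffD1, rotated -1])
        (use 2 eventually_nhds_in_open[of "{..<0}" t] in \<open>auto elim!: eventually_mono\<close>)
  next
    case 3
    have "((\<lambda>h::real. ((max 0 h)\<^sup>2) / h) \<longlongrightarrow> 0) (at 0)"
    proof (rule Lim_null_comparison[where g = "\<lambda>h. \<bar>h\<bar>"])
      have "norm ((max 0 h)\<^sup>2 / h) \<le> \<bar>h\<bar>" for h :: real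
        by (cases "h \<le> 0") (auto simp: max_def power2_eq_square abs_mult divide_simps)
      then show "\<forall>\<^sub>F h in at 0. norm ((max 0 h)\<^sup>2 / h) \<le> \<bar>h::real\<bar>" by simp
      show "((\<lambda>h::real. \<bar>h\<bar>) \<longlongrightarrow> 0) (at 0)" by (auto intro!: tendsto_eq_intros)
    qed
    then show ?thesis using 3 by (simp add: has_field_derivative_iff)
  qed
qed

text \<open>A \<open>C\<^sup>1\<close> transition from 0 to 1 over the unit interval whose derivative is the hat function with
  peak 2.\<close>

definition ramp :: "real \<Rightarrow> real" where
  "ramp t = 2 * ((max 0 t)\<^sup>2 - 2 * (max 0 (t - 1/2))\<^sup>2 + (max 0 (t - 1))\<^sup>2)"

definition hat :: "real \<Rightarrow> real" where
  "hat t = 4 * (max 0 t - 2 * max 0 (t - 1/2) + max 0 (t - 1))"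

lemma has_real_derivative_ramp: "(ramp has_real_derivative hat t) (at t)"
proof -
  have s: "((\<lambda>t::real. (max 0 (t - a))\<^sup>2) has_real_derivative 2 * max 0 (t - a)) (at t)" for a
  proof -
    have "((\<lambda>t. t - a) has_real_derivative 1) (at t)" by (auto intro!: derivative_eq_intros)
    from DERIV_chain2[where f = "\<lambda>t. (max 0 t)\<^sup>2", OF has_real_derivative_pos_part_square this]
    show ?thesis by simp
  qed
  show ?thesis
    unfolding ramp_def[abs_def] hat_def
    by (rule DERIV_cong[OF DERIV_cmult[OF DERIV_add[OF DERIV_diff[OF s[of 0, simplified]
            DERIV_cmult[OF s[of "1/2"]]] s[of 1]]]]) (simp add: algebra_simps)
qed

lemma continuous_on_hat: "continuous_on A hat"
  unfolding hat_def[abs_def] by (intro continuous_intros)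

lemma hat_bounds: "0 \<le> hat t" "hat t \<le> 2"
  by (auto simp: hat_def max_def)

lemma ramp_ends: "t \<le> 0 \<Longrightarrow> ramp t = 0" "t \<ge> 1 \<Longrightarrow> ramp t = 1"
  by (auto simp: ramp_def max_def power2_eq_square algebra_simps)

lemma ramp_bounds: "0 \<le> ramp t" "ramp t \<le> 1"
proof -
  have m: "ramp a \<le> ramp b" if "a \<le> b" for a b
    using that by (rule DERIV_nonneg_imp_nondecreasing)
      (use has_real_derivative_ramp hat_bounds in blast)
  show "0 \<le> ramp t" using m[of "min 0 t" t] ramp_ends(1)[of "min 0 t"] by simp
  show "ramp t \<le> 1" using m[of t "max 1 t"] ramp_ends(2)[of "max 1 t"] by simp
qed

lemma hat_outside: "t \<le> 0 \<Longrightarrow> hat t = 0" "t \<ge> 1 \<Longrightarrow> hat t = 0"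
  by (auto simp: hat_def max_def)

text \<open>A unit-speed arc is brought to rest at both ends by running it through the ramp.\<close>

lemma timed_arc_smoothing:
  fixes q :: "real \<Rightarrow> 'a::euclidean_space"
  assumes q: "\<And>t. t \<in> {0..l} \<Longrightarrow> (q has_vector_derivative v t) (at t)"
    and v: "continuous_on {0..l} v" "\<And>t. t \<in> {0..l} \<Longrightarrow> norm (v t) \<le> 1"
    and S: "q ` {0..l} \<subseteq> S" and "l > 0"
  shows "timed_arc S (q 0) (q l) l"
proof (rule timed_arcI)
  let ?p = "\<lambda>t. q (l * ramp t)" and ?v = "\<lambda>t. (l * hat t) *\<^sub>R v (l * ramp t)"
  have in_l: "l * ramp t \<in> {0..l}" for t
    using ramp_bounds[of t] \<open>l > 0\<close> by (auto simp: mult_left_le)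
  have dr: "((\<lambda>t. l * ramp t) has_real_derivative l * hat t) (at t)" for t
    using has_real_derivative_ramp by (auto intro!: derivative_eq_intros)
  show "(?p has_vector_derivative ?v t) (at t)" for t
    using vector_diff_chain_at[OF dr[unfolded has_real_derivative_iff_has_vector_derivative] q[OF in_l]]
    by (simp add: o_def)
  have "continuous_on UNIV ramp"
    using has_real_derivative_ramp by (auto intro!: DERIV_continuous_on)
  then show "continuous_on UNIV ?v"
    using in_l by (intro continuous_intros continuous_on_hat continuous_on_compose2[OF v(1)]) auto
  show "((\<lambda>t. l * ramp t) has_real_derivative l * hat t) (at t)" for t by fact
  show "norm (?v t) \<le> l * hat t" for t
    using v(2)[OF in_l[of t]] \<open>l > 0\<close> hat_bounds[of t]
    by (simp add: abs_mult mult_left_le)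
  show "l * hat t \<le> 2 * l" for t
    using hat_bounds[of t] \<open>l > 0\<close> by simp
  show "?p t \<in> S" for t using S in_l[of t] by blast
qed (use \<open>l > 0\<close> in \<open>auto simp: ramp_ends hat_outside\<close>)

lemma timed_arc_segment:
  assumes "closed_segment x y \<subseteq> S" "norm (y - x) \<le> l" "l > 0"
  shows "timed_arc S x y l"
proof -
  let ?q = "\<lambda>t. x + (t / l) *\<^sub>R (y - x)"
  have "timed_arc S (?q 0) (?q l) l"
  proof (rule timed_arc_smoothing[where v = "\<lambda>t. (1 / l) *\<^sub>R (y - x)"])
    show "(?q has_vector_derivative (1 / l) *\<^sub>R (y - x)) (at t)" for t
      using assms(3) by (auto intro!: derivative_eq_intros simp: has_vector_derivative_def)
    show "?q ` {0..l} \<subseteq> S"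
    proof clarify
      fix t assume t: "t \<in> {0..l}"
      have "?q t = (1 - t / l) *\<^sub>R x + (t / l) *\<^sub>R y" by (simp add: algebra_simps)
      then have "?q t \<in> closed_segment x y"
        unfolding closed_segment_def using t assms(3) by (intro CollectI exI[of _ "t / l"]) auto
      then show "?q t \<in> S" using assms(1) by blast
    qed
  qed (use assms in auto)
  then show ?thesis using assms(3) by simp
qed

lemma timed_arc_sym:
  assumes "timed_arc S x y l" shows "timed_arc S y x l"
  using assms
proof (rule timed_arcE)
  fix p v s w m
  assume p: "\<And>t. (p has_vector_derivative v t) (at t)" "continuous_on UNIV v"
      "\<And>t. (s has_real_derivative w t) (at t)" "\<And>t. norm (v t) \<le> w t" "\<And>t. w t \<le> 2 * l"
      "\<And>t. p t \<in> S" "\<And>t. t \<le> 0 \<Longrightarrow> p t = x \<and> s t = 0 \<and> v t = 0 \<and> w t = 0"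
      "\<And>t. t \<ge> 1 \<Longrightarrow> p t = y \<and> s t = m \<and> v t = 0 \<and> w t = 0" "m \<le> l" "l > 0"
  show ?thesis
  proof (rule timed_arcI)
    show "((\<lambda>t. p (1 - t)) has_vector_derivative - v (1 - t)) (at t)" for t
    proof -
      have "((\<lambda>t. 1 - t) has_vector_derivative -1) (at t)"
        by (auto intro!: derivative_eq_intros)
      from vector_diff_chain_at[OF this p(1)] show ?thesis by (simp add: o_def)
    qed
    show "continuous_on UNIV (\<lambda>t. - v (1 - t))"
      by (intro continuous_intros continuous_on_compose2[OF p(2)]) auto
    show "((\<lambda>t. m - s (1 - t)) has_real_derivative w (1 - t)) (at t)" for t
    proof -
      have "((\<lambda>t. 1 - t) has_real_derivative -1) (at t)"
        by (auto intro!: derivative_eq_intros)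
      from DERIV_chain2[where f = s, OF p(3) this] show ?thesis
        by (auto intro!: derivative_eq_intros)
    qed
  qed (use p in auto)
qed

lemma timed_arc_trans:
  assumes "timed_arc S x y a" "timed_arc S y z b" shows "timed_arc S x z (a + b)"
proof -
  obtain p v s w m where p: "\<And>t. (p has_vector_derivative v t) (at t)" "continuous_on UNIV v"
      "\<And>t. (s has_real_derivative w t) (at t)" "\<And>t. norm (v t) \<le> w t" "\<And>t. w t \<le> 2 * a"
      "\<And>t. p t \<in> S" "\<And>t. t \<le> 0 \<Longrightarrow> p t = x \<and> s t = 0 \<and> v t = 0 \<and> w t = 0"
      "\<And>t. t \<ge> 1 \<Longrightarrow> p t = y \<and> s t = m \<and> v t = 0 \<and> w t = 0"
    and m: "m \<le> a" and a: "a > 0"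
    by (rule timed_arcE[OF assms(1)]) (rule that; assumption)
  obtain p' v' s' w' m' where p': "\<And>t. (p' has_vector_derivative v' t) (at t)" "continuous_on UNIV v'"
      "\<And>t. (s' has_real_derivative w' t) (at t)" "\<And>t. norm (v' t) \<le> w' t" "\<And>t. w' t \<le> 2 * b"
      "\<And>t. p' t \<in> S" "\<And>t. t \<le> 0 \<Longrightarrow> p' t = y \<and> s' t = 0 \<and> v' t = 0 \<and> w' t = 0"
      "\<And>t. t \<ge> 1 \<Longrightarrow> p' t = z \<and> s' t = m' \<and> v' t = 0 \<and> w' t = 0"
    and m': "m' \<le> b" and b: "b > 0"
    by (rule timed_arcE[OF assms(2)]) (rule that; assumption)
  \<comment> \<open>time is split in proportion to length, so that the speed bound is preserved\<close>
  define k where "k = (a + b) / a"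
  define k' where "k' = (a + b) / b"
  define \<tau> where "\<tau> t = k * t" for t
  define \<tau>' where "\<tau>' t = k' * (t - 1) + 1" for t
  have k: "k > 0" "k' > 0" "k * a = a + b" "k' * b = a + b" using a b by (auto simp: k_def k'_def)
  have split: "\<tau>' t \<le> 0 \<or> \<tau> t \<ge> 1" for t
    using a b by (auto simp: \<tau>_def \<tau>'_def k_def k'_def field_simps)
  have d: "(\<tau> has_real_derivative k) (at t)" "(\<tau>' has_real_derivative k') (at t)" for t
    by (auto simp: \<tau>_def[abs_def] \<tau>'_def[abs_def] intro!: derivative_eq_intros)
  have cont: "continuous_on UNIV \<tau>" "continuous_on UNIV \<tau>'"
    using d by (auto intro!: DERIV_continuous_on)
  have mono: "\<tau> t \<le> 0 \<Longrightarrow> \<tau>' t \<le> 0" "\<tau>' t \<ge> 1 \<Longrightarrow> \<tau> t \<ge> 1" for t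
    using split[of t] by auto
  show ?thesis
  proof (rule timed_arcI)
    show "((\<lambda>t. p (\<tau> t) + p' (\<tau>' t) - y) has_vector_derivative
        k *\<^sub>R v (\<tau> t) + k' *\<^sub>R v' (\<tau>' t)) (at t)" for t
      using vector_diff_chain_at[OF d(1)[unfolded has_real_derivative_iff_has_vector_derivative] p(1)]
        vector_diff_chain_at[OF d(2)[unfolded has_real_derivative_iff_has_vector_derivative] p'(1)]
      by (auto simp: o_def intro!: derivative_eq_intros)
    show "continuous_on UNIV (\<lambda>t. k *\<^sub>R v (\<tau> t) + k' *\<^sub>R v' (\<tau>' t))"
      by (intro continuous_intros continuous_on_compose2[OF p(2)] continuous_on_compose2[OF p'(2)] cont)
        auto
    show "((\<lambda>t. s (\<tau> t) + s' (\<tau>' t)) has_real_derivative k * w (\<tau> t) + k' * w' (\<tau>' t)) (at t)" for t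
      using DERIV_chain2[OF p(3) d(1)] DERIV_chain2[OF p'(3) d(2)]
      by (auto intro!: derivative_eq_intros simp: mult.commute)
    show "norm (k *\<^sub>R v (\<tau> t) + k' *\<^sub>R v' (\<tau>' t)) \<le> k * w (\<tau> t) + k' * w' (\<tau>' t)" for t
      using k p(4) p'(4) by (intro order_trans[OF norm_triangle_ineq] add_mono) (auto intro!: mult_left_mono)
    show "k * w (\<tau> t) + k' * w' (\<tau>' t) \<le> 2 * (a + b)" for t
    proof -
      have "k * w (\<tau> t) \<le> k * (2 * a)" "k' * w' (\<tau>' t) \<le> k' * (2 * b)"
        using p(5) p'(5) k by (auto intro!: mult_left_mono simp del: mult_le_cancel_left_pos)
      moreover have "k * (2 * a) = 2 * (a + b)" "k' * (2 * b) = 2 * (a + b)"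
        using k(3,4) by (auto simp: mult.left_commute)
      ultimately show ?thesis
        using split[of t] p(8)[of "\<tau> t"] p'(7)[of "\<tau>' t"] a b by auto
    qed
    show "p (\<tau> t) + p' (\<tau>' t) - y \<in> S" for t
      using split[of t] p(6)[of "\<tau> t"] p'(6)[of "\<tau>' t"] p(8)[of "\<tau> t"] p'(7)[of "\<tau>' t"] by auto
    show "p (\<tau> t) + p' (\<tau>' t) - y = x \<and> s (\<tau> t) + s' (\<tau>' t) = 0 \<and>
        k *\<^sub>R v (\<tau> t) + k' *\<^sub>R v' (\<tau>' t) = 0 \<and> k * w (\<tau> t) + k' * w' (\<tau>' t) = 0" if "t \<le> 0" for t
    proof -
      have "\<tau> t \<le> 0" using that k by (simp add: \<tau>_def mult_nonneg_nonpos)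
      then show ?thesis using mono p(7)[of "\<tau> t"] p'(7)[of "\<tau>' t"] by auto
    qed
    show "p (\<tau> t) + p' (\<tau>' t) - y = z \<and> s (\<tau> t) + s' (\<tau>' t) = m + m' \<and>
        k *\<^sub>R v (\<tau> t) + k' *\<^sub>R v' (\<tau>' t) = 0 \<and> k * w (\<tau> t) + k' * w' (\<tau>' t) = 0" if "t \<ge> 1" for t
    proof -
      have "\<tau>' t \<ge> 1" using that k by (simp add: \<tau>'_def)
      then show ?thesis using mono p(8)[of "\<tau> t"] p'(8)[of "\<tau>' t"] by auto
    qed
  qed (use a b m m' in auto)
qed

text \<open>The gap between \<open>l\<close> and the arc length is spread evenly as additional speed. Then the clock is
  strictly increasing even where the arc stands still, and its inverse function reparametrises the
  arc to speed at most 1.\<close>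

lemma timed_arc_of_c1_arc:
  assumes arc: "c1_arc S x y \<xi> \<xi>'" and l: "integral {0..1} (\<lambda>t. norm (\<xi>' t)) < l"
  shows "timed_arc S x y l"
proof -
  define c where "c = l - integral {0..1} (\<lambda>t. norm (\<xi>' t))"
  define f where "f t = \<xi>' (max 0 (min 1 t))" for t
  define W where "W t = norm (f t) + c" for t
  have \<xi>: "\<And>t. t \<in> {0..1} \<Longrightarrow> (\<xi> has_vector_derivative \<xi>' t) (at t within {0..1})"
    "continuous_on {0..1} \<xi>'" "\<xi> ` {0..1} \<subseteq> S" "\<xi> 0 = x" "\<xi> 1 = y"
    using arc by (auto simp: c1_arc_def)
  have "c > 0" using l by (simp add: c_def)
  have f_cont: "continuous_on A f" for A
    unfolding f_def[abs_def] by (intro continuous_on_compose2[OF \<xi>(2)] continuous_intros) auto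
  have W_cont: "continuous_on A W" for A
    unfolding W_def[abs_def] by (intro continuous_intros f_cont)
  have W_pos: "W t > 0" "norm (f t) \<le> W t" for t using \<open>c > 0\<close> by (auto simp: W_def add_nonneg_pos)
  have prim: "((\<lambda>t. integral {-2..t} F - integral {-2..0} F) has_vector_derivative F t) (at t)"
    if "continuous_on {-2..3} F" "t \<in> {-2<..<3}" for F :: "real \<Rightarrow> 'b::euclidean_space" and t
  proof -
    have "((\<lambda>t. integral {-2..t} F) has_vector_derivative F t) (at t within {-2..3})"
      by (rule integral_has_vector_derivative) (use that in auto)
    then have "((\<lambda>t. integral {-2..t} F) has_vector_derivative F t) (at t)"
      using that(2) by (subst (asm) at_within_interior) auto
    then show ?thesis by (auto intro!: derivative_eq_intros)
  qed
  define s where "s t = integral {-2..t} W - integral {-2..0} W" for t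
  define q where "q t = x + (integral {-2..t} f - integral {-2..0} f)" for t
  have s': "(s has_real_derivative W t) (at t)" if "t \<in> {-2<..<3}" for t
    unfolding s_def[abs_def] has_real_derivative_iff_has_vector_derivative
    by (rule prim[OF W_cont that])
  have q': "(q has_vector_derivative f t) (at t)" if "t \<in> {-2<..<3}" for t
    unfolding q_def[abs_def]
    using has_vector_derivative_add[OF has_vector_derivative_const prim[OF f_cont that]] by simp
  have split: "integral {-2..t} F - integral {-2..0} F = integral {0..t} F"
    if "t \<in> {0..1}" "continuous_on UNIV F" for F :: "real \<Rightarrow> 'b::euclidean_space" and t
  proof -
    have "F integrable_on {-2..t}"
      by (rule integrable_continuous_real) (rule continuous_on_subset[OF that(2)], simp)
    from Henstock_Kurzweil_Integration.integral_combine[OF _ _ this, of 0] show ?thesis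
      using that(1) by (simp add: algebra_simps)
  qed
  have q_eq: "q t = \<xi> t" if "t \<in> {0..1}" for t
  proof -
    have ftc: "(\<xi>' has_integral \<xi> t - \<xi> 0) {0..t}"
      by (rule fundamental_theorem_of_calculus)
        (use that in \<open>auto intro: has_vector_derivative_within_subset[OF \<xi>(1)]\<close>)
    have "integral {0..t} f = integral {0..t} \<xi>'"
      by (rule integral_cong) (use that in \<open>auto simp: f_def\<close>)
    moreover have "integral {0..t} \<xi>' = \<xi> t - x" using integral_unique[OF ftc] \<xi>(4) by simp
    ultimately show ?thesis
      unfolding q_def using split[OF that f_cont] by simp
  qed
  have s01: "s 0 = 0" "s 1 = l"
  proof -
    have W_eq: "integral {0..1} W = integral {0..1} (\<lambda>t. norm (\<xi>' t) + c)"
      by (rule integral_cong) (auto simp: W_def f_def)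
    have F1: "(\<lambda>t. norm (\<xi>' t)) integrable_on {0..1}"
      by (intro integrable_continuous_real continuous_intros \<xi>(2))
    have c1: "((\<lambda>_. c) has_integral c) {0..1 :: real}"
      using has_integral_const_real[of c 0 1] by simp
    have "integral {0..1} (\<lambda>t. norm (\<xi>' t) + c) = integral {0..1} (\<lambda>t. norm (\<xi>' t)) + c"
      by (rule integral_unique) (rule has_integral_add[OF integrable_integral[OF F1] c1])
    moreover have "s 1 = integral {0..1} W" unfolding s_def by (rule split[OF _ W_cont]) simp
    ultimately show "s 1 = l" using W_eq c_def by linarith
  qed (simp add: s_def)
  have incr: "s a < s b" if "a < b" "a > -2" "b < 3" for a b
  proof (rule DERIV_pos_imp_increasing[OF that(1)])
    fix t assume "a \<le> t" "t \<le> b"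
    then have "t \<in> {-2<..<3}" using that by simp
    then show "\<exists>y. (s has_real_derivative y) (at t) \<and> 0 < y" using s' W_pos(1) by blast
  qed
  define \<sigma> where "\<sigma> = inv_into {-1..2} s"
  have inj: "inj_on s {-1..2}"
    by (rule strict_mono_on_imp_inj_on) (auto simp: strict_mono_on_def intro!: incr)
  have \<sigma>s: "\<sigma> (s t) = t" if "t \<in> {-1..2}" for t
    unfolding \<sigma>_def using inj that by (rule inv_into_f_f)
  have s_cont: "isCont s t" if "t \<in> {-2<..<3}" for t using s'[OF that] by (rule DERIV_isCont)
  have onto: "\<exists>t\<in>{a..b}. s t = r" if "s a \<le> r" "r \<le> s b" "a \<le> b" "a > -2" "b < 3" for a b r
    using IVT[of s a r b] that s_cont by auto
  have \<sigma>_cont: "isCont \<sigma> r" and s\<sigma>: "s (\<sigma> r) = r"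
    if r: "s (-1) < r" "r < s 2" for r
  proof -
    obtain t where t: "t \<in> {-1..2}" "s t = r" using onto[of "-1" r 2] r by auto
    then have "t \<noteq> -1" "t \<noteq> 2" using r by auto
    then have "-1 < t" "t < 2" using t by auto
    then have "isCont \<sigma> (s t)"
      by (rule isCont_inverse_function2) (auto intro!: \<sigma>s s_cont)
    then show "isCont \<sigma> r" using t by simp
    show "s (\<sigma> r) = r" using \<sigma>s t by auto
  qed
  have in_range: "s (-1) < r" "r < s 2" if "r \<in> {0..l}" for r
    using that incr[of "-1" 0] incr[of 1 2] s01 by auto
  have \<sigma>01: "\<sigma> r \<in> {0..1}" if "r \<in> {0..l}" for r
    using onto[of 0 r 1] that s01 \<sigma>s by force
  have \<sigma>': "(\<sigma> has_real_derivative inverse (W (\<sigma> r))) (at r)" if "r \<in> {0..l}" for r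
  proof (rule DERIV_inverse_function[of s _ _ r "s (-1)" "s 2"])
    show "(s has_real_derivative W (\<sigma> r)) (at (\<sigma> r))" using \<sigma>01[OF that] by (intro s') auto
  qed (use in_range[OF that] W_pos[of "\<sigma> r"] s\<sigma> \<sigma>_cont in auto)
  have "timed_arc S (q (\<sigma> 0)) (q (\<sigma> l)) l"
  proof (rule timed_arc_smoothing[where v = "\<lambda>r. inverse (W (\<sigma> r)) *\<^sub>R f (\<sigma> r)"])
    fix r assume r: "r \<in> {0..l}"
    have "(q has_vector_derivative f (\<sigma> r)) (at (\<sigma> r))" using \<sigma>01[OF r] by (intro q') auto
    from vector_diff_chain_at[OF \<sigma>'[OF r, unfolded has_real_derivative_iff_has_vector_derivative] this]
    show "((\<lambda>r. q (\<sigma> r)) has_vector_derivative inverse (W (\<sigma> r)) *\<^sub>R f (\<sigma> r)) (at r)"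
      by (simp add: o_def)
    show "norm (inverse (W (\<sigma> r)) *\<^sub>R f (\<sigma> r)) \<le> 1"
      using W_pos[of "\<sigma> r"] by (simp add: divide_simps)
  next
    have "continuous_on {0..l} \<sigma>"
      using \<sigma>_cont in_range by (intro continuous_at_imp_continuous_on) auto
    then show "continuous_on {0..l} (\<lambda>r. inverse (W (\<sigma> r)) *\<^sub>R f (\<sigma> r))"
      by (intro continuous_intros continuous_on_compose2[OF W_cont[of UNIV]]
          continuous_on_compose2[OF f_cont[of UNIV]]) (auto simp: W_pos less_imp_neq[symmetric] less_imp_neq[OF W_pos(1), symmetric])
    show "(\<lambda>r. q (\<sigma> r)) ` {0..l} \<subseteq> S" using \<sigma>01 q_eq \<xi>(3) by force
    have "integral {0..1} (\<lambda>t. norm (\<xi>' t)) \<ge> 0"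
      by (rule integral_nonneg) (auto intro!: integrable_continuous_real continuous_intros \<xi>(2))
    then show "l > 0" using l by linarith
  qed
  moreover have "\<sigma> 0 = 0" "\<sigma> l = 1" using \<sigma>s[of 0] \<sigma>s[of 1] s01 by auto
  ultimately show ?thesis using q_eq[of 0] q_eq[of 1] \<xi>(4,5) by simp
qed

text \<open>The increment of the clock bounds the length of each piece, not only of the whole arc; this
  makes arcs that are nearly shortest near-geodesics.\<close>

lemma c1_arc_piece:
  fixes p :: "real \<Rightarrow> 'a::euclidean_space"
  assumes p: "\<And>t. (p has_vector_derivative v t) (at t)" "continuous_on UNIV v" "\<And>t. p t \<in> S"
    and s: "\<And>t. (s has_real_derivative w t) (at t)" "\<And>t. norm (v t) \<le> w t" and "a \<le> b"
  obtains \<xi> \<xi>' where "c1_arc S (p a) (p b) \<xi> \<xi>'" "integral {0..1} (\<lambda>t. norm (\<xi>' t)) \<le> s b - s a"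
proof
  let ?m = "\<lambda>t. a + t * (b - a)"
  have m: "(?m has_real_derivative (b - a)) (at t)" for t by (auto intro!: derivative_eq_intros)
  have "((\<lambda>t. p (?m t)) has_vector_derivative (b - a) *\<^sub>R v (?m t)) (at t)" for t
    using vector_diff_chain_at[OF m[unfolded has_real_derivative_iff_has_vector_derivative] p(1)]
    by (simp add: o_def)
  moreover have cont: "continuous_on {0..1} (\<lambda>t. (b - a) *\<^sub>R v (?m t))"
    by (intro continuous_intros continuous_on_compose2[OF p(2)]) auto
  ultimately show "c1_arc S (p a) (p b) (\<lambda>t. p (?m t)) (\<lambda>t. (b - a) *\<^sub>R v (?m t))"
    unfolding c1_arc_def using p(3) by (auto intro: has_vector_derivative_at_within)
  have "((\<lambda>t. s (?m t)) has_real_derivative w (?m t) * (b - a)) (at t)" for t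
    by (rule DERIV_chain2[where f = s, OF s(1) m])
  then have "((\<lambda>t. w (?m t) * (b - a)) has_integral s (?m 1) - s (?m 0)) {0..1}"
    by (intro fundamental_theorem_of_calculus)
      (auto simp: has_real_derivative_iff_has_vector_derivative[symmetric] intro: DERIV_subset)
  then have i: "((\<lambda>t. w (?m t) * (b - a)) has_integral s b - s a) {0..1}" by simp
  have "integral {0..1} (\<lambda>t. norm ((b - a) *\<^sub>R v (?m t))) \<le> integral {0..1} (\<lambda>t. w (?m t) * (b - a))"
  proof (rule integral_le)
    show "(\<lambda>t. norm ((b - a) *\<^sub>R v (?m t))) integrable_on {0..1}"
      by (intro integrable_continuous_real continuous_on_norm cont)
    show "norm ((b - a) *\<^sub>R v (?m t)) \<le> w (?m t) * (b - a)" for t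
      using mult_right_mono[OF s(2)[of "?m t"], of "b - a"] \<open>a \<le> b\<close> by (simp add: mult.commute)
  qed (use i in blast)
  then show "integral {0..1} (\<lambda>t. norm ((b - a) *\<^sub>R v (?m t))) \<le> s b - s a"
    unfolding integral_unique[OF i] .
qed

lemma sums_has_vector_derivative:
  fixes f :: "nat \<Rightarrow> real \<Rightarrow> 'b::banach"
  assumes f: "\<And>k t. (f k has_vector_derivative f' k t) (at t)"
    and M: "\<And>k t. norm (f' k t) \<le> M k" "summable M" and a: "\<And>k. f k a = 0"
  obtains F where "\<And>t. (\<lambda>k. f k t) sums F t"
    "\<And>t. (F has_vector_derivative (\<Sum>k. f' k t)) (at t)"
proof -
  have u: "uniform_limit UNIV (\<lambda>n t. \<Sum>k<n. f' k t) (\<lambda>t. \<Sum>k. f' k t) sequentially"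
    using M by (intro Weierstrass_m_test) auto
  have "\<exists>F. \<forall>t\<in>UNIV. (\<lambda>k. f k t) sums F t \<and>
      (F has_derivative (\<lambda>h. h *\<^sub>R (\<Sum>k. f' k t))) (at t within UNIV)"
  proof (rule has_derivative_series[where f' = "\<lambda>k t h. h *\<^sub>R f' k t" and x = a and l = 0])
    fix e :: real assume "e > 0"
    then have "\<forall>\<^sub>F n in sequentially. \<forall>t\<in>UNIV. dist (\<Sum>k<n. f' k t) (\<Sum>k. f' k t) < e"
      using u by (auto simp: uniform_limit_iff)
    then show "\<forall>\<^sub>F n in sequentially. \<forall>t\<in>UNIV. \<forall>h.
        norm ((\<Sum>k<n. h *\<^sub>R f' k t) - h *\<^sub>R (\<Sum>k. f' k t)) \<le> e * norm h"
    proof (rule eventually_mono, intro ballI allI)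
      fix n t and h :: real
      assume "\<forall>t\<in>UNIV. dist (\<Sum>k<n. f' k t) (\<Sum>k. f' k t) < e"
      then have "norm ((\<Sum>k<n. f' k t) - (\<Sum>k. f' k t)) \<le> e" by (simp add: dist_norm less_imp_le)
      moreover have "(\<Sum>k<n. h *\<^sub>R f' k t) - h *\<^sub>R (\<Sum>k. f' k t) =
          h *\<^sub>R ((\<Sum>k<n. f' k t) - (\<Sum>k. f' k t))"
        by (simp add: scaleR_right.sum scaleR_diff_right)
      ultimately show "norm ((\<Sum>k<n. h *\<^sub>R f' k t) - h *\<^sub>R (\<Sum>k. f' k t)) \<le> e * norm h"
        using mult_left_mono[of "norm ((\<Sum>k<n. f' k t) - (\<Sum>k. f' k t))" e "\<bar>h\<bar>"]
        by (simp add: mult.commute)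
    qed
  qed (use f a in \<open>auto simp: has_vector_derivative_def\<close>)
  then show ?thesis using that by (auto simp: has_vector_derivative_def)
qed

text \<open>The \<open>k\<close>-th arc is run during the time from \<open>1/2 ^ (k + 1)\<close> to \<open>1/2 ^ k\<close>. The arcs shrink like
  \<open>1/8 ^ k\<close>, so after the acceleration by \<open>2 ^ (k + 1)\<close> their velocities are still summable and
  the concatenation is \<open>C\<^sup>1\<close> up to its initial point.\<close>

lemma timed_arc_limit:
  assumes "closed S" and x: "x \<longlonglongrightarrow> z" and "l > 0"
    and arcs: "\<And>k. timed_arc S (x (Suc k)) (x k) (l * (1/8) ^ Suc k)"
  shows "timed_arc S z (x 0) l"
proof -
  have "\<forall>k. \<exists>p v s w m.
     (\<forall>t. (p has_vector_derivative v t) (at t)) \<and> continuous_on UNIV v \<and>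
     (\<forall>t. (s has_real_derivative w t) (at t)) \<and>
     (\<forall>t. norm (v t) \<le> w t) \<and> (\<forall>t. w t \<le> 2 * (l * (1/8) ^ Suc k)) \<and> (\<forall>t. p t \<in> S) \<and>
     (\<forall>t\<le>0. p t = x (Suc k) \<and> s t = 0 \<and> v t = 0 \<and> w t = 0) \<and>
     (\<forall>t\<ge>1. p t = x k \<and> s t = m \<and> v t = 0 \<and> w t = 0) \<and> m \<le> l * (1/8) ^ Suc k"
    using arcs unfolding timed_arc_def by blast
  then obtain p v s w m where all: "\<forall>k.
     (\<forall>t. (p k has_vector_derivative v k t) (at t)) \<and> continuous_on UNIV (v k) \<and>
     (\<forall>t. (s k has_real_derivative w k t) (at t)) \<and>
     (\<forall>t. norm (v k t) \<le> w k t) \<and> (\<forall>t. w k t \<le> 2 * (l * (1/8) ^ Suc k)) \<and> (\<forall>t. p k t \<in> S) \<and>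
     (\<forall>t\<le>0. p k t = x (Suc k) \<and> s k t = 0 \<and> v k t = 0 \<and> w k t = 0) \<and>
     (\<forall>t\<ge>1. p k t = x k \<and> s k t = m k \<and> v k t = 0 \<and> w k t = 0) \<and> m k \<le> l * (1/8) ^ Suc k"
    unfolding choice_iff by (elim exE) (rule that)
  then have
    p: "\<And>k t. (p k has_vector_derivative v k t) (at t)" "\<And>k. continuous_on UNIV (v k)"
      "\<And>k t. (s k has_real_derivative w k t) (at t)" "\<And>k t. norm (v k t) \<le> w k t"
      "\<And>k t. w k t \<le> 2 * (l * (1/8) ^ Suc k)" "\<And>k t. p k t \<in> S"
      "\<And>k t. t \<le> 0 \<Longrightarrow> p k t = x (Suc k) \<and> s k t = 0 \<and> v k t = 0 \<and> w k t = 0"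
      "\<And>k t. t \<ge> 1 \<Longrightarrow> p k t = x k \<and> s k t = m k \<and> v k t = 0 \<and> w k t = 0"
      "\<And>k. m k \<le> l * (1/8) ^ Suc k"
    by blast+
  define \<tau> where "\<tau> k t = 2 ^ Suc k * t - 1" for k :: nat and t :: real
  have \<tau>': "(\<tau> k has_real_derivative 2 ^ Suc k) (at t)" for k t
    by (auto simp: \<tau>_def[abs_def] intro!: derivative_eq_intros)
  have \<tau>_cont: "continuous_on UNIV (\<tau> k)" for k using \<tau>' by (auto intro!: DERIV_continuous_on)
  define f where "f k t = p k (\<tau> k t) - x k" for k t
  define f' where "f' k t = (2 ^ Suc k) *\<^sub>R v k (\<tau> k t)" for k t
  define g where "g k t = s k (\<tau> k t)" for k t
  define g' where "g' k t = 2 ^ Suc k * w k (\<tau> k t)" for k t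
  define M where "M k = 2 * l * (1/4) ^ Suc k" for k :: nat
  have f_deriv: "(f k has_vector_derivative f' k t) (at t)" for k t
    using vector_diff_chain_at[OF \<tau>'[of k t, unfolded has_real_derivative_iff_has_vector_derivative]
        p(1)[of k "\<tau> k t"]]
    unfolding f_def[abs_def] f'_def[abs_def] by (auto intro!: derivative_eq_intros simp: o_def)
  have g_deriv: "(g k has_vector_derivative g' k t) (at t)" for k t
    using DERIV_chain2[where f = "s k", OF p(3) \<tau>'[of k t]]
    by (simp add: g_def[abs_def] g'_def mult.commute has_real_derivative_iff_has_vector_derivative)
  have g'_bounds: "norm (f' k t) \<le> g' k t" "g' k t \<le> M k" for k t
  proof -
    show "norm (f' k t) \<le> g' k t" using p(4)[of k "\<tau> k t"] by (simp add: f'_def g'_def)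
    have "g' k t \<le> 2 ^ Suc k * (2 * (l * (1/8) ^ Suc k))"
      unfolding g'_def by (intro mult_left_mono p(5)) auto
    also have "\<dots> = 2 * l * (2 * (1/8)) ^ Suc k" unfolding power_mult_distrib by simp
    finally show "g' k t \<le> M k" by (simp add: M_def)
  qed
  have norm_bounds: "norm (f' k t) \<le> M k" "norm (g' k t) \<le> M k" for k t
  proof -
    show "norm (f' k t) \<le> M k" using g'_bounds[of k t] by (rule order_trans)
    have "0 \<le> g' k t" using norm_ge_zero g'_bounds(1) by (rule order_trans)
    then show "norm (g' k t) \<le> M k" using g'_bounds(2) by simp
  qed
  have M_sum: "M sums (2 * l / 3)"
    unfolding M_def[abs_def] using geometric_sums[of "1/4 :: real"] sums_mult[of _ "4/3" "2 * l / 4"] by simp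
  have "f k 1 = 0" "g k 0 = 0" for k
    using p(8)[of "\<tau> k 1" k] p(7)[of "\<tau> k 0" k] one_le_power[of "2::real" k]
    by (auto simp: f_def g_def \<tau>_def)
  obtain F where F: "\<And>t. (\<lambda>k. f k t) sums F t" "\<And>t. (F has_vector_derivative (\<Sum>k. f' k t)) (at t)"
    by (rule sums_has_vector_derivative[OF f_deriv norm_bounds(1) _ \<open>\<And>k. f k 1 = 0\<close>])
      (use M_sum in \<open>auto simp: sums_iff\<close>)
  obtain G where G: "\<And>t. (\<lambda>k. g k t) sums G t" "\<And>t. (G has_vector_derivative (\<Sum>k. g' k t)) (at t)"
    by (rule sums_has_vector_derivative[OF g_deriv norm_bounds(2) _ \<open>\<And>k. g k 0 = 0\<close>])
      (use M_sum in \<open>auto simp: sums_iff\<close>)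
  have summ: "summable (\<lambda>k. norm (f' k t))" "summable (\<lambda>k. g' k t)" for t
    using norm_bounds M_sum by (auto simp: sums_iff intro!: summable_comparison_test'[of M 0 "\<lambda>k. norm (f' k t)"]
        summable_comparison_test'[of M 0 "\<lambda>k. g' k t"])
  have early: "\<tau> k t \<le> 0" if "t \<le> (1/2) ^ Suc k" for k t
    using that by (simp add: \<tau>_def field_simps)
  have late: "\<tau> k t \<ge> 1" if "t \<ge> (1/2) ^ k" for k t
    using that by (simp add: \<tau>_def field_simps)
  define P where "P n t = x 0 + (\<Sum>k<n. f k t)" for n t
  have P: "P n t \<in> S \<and> (t \<le> (1/2) ^ n \<longrightarrow> P n t = x n)" for n t
  proof (induction n)
    case 0
    show ?case using p(6)[of 0 1] p(8)[of 1 0] by (simp add: P_def)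
  next
    case (Suc n)
    have step: "P (Suc n) t = P n t + p n (\<tau> n t) - x n" by (simp add: P_def f_def)
    consider "t \<le> (1/2) ^ n" | "t \<ge> (1/2) ^ n" by linarith
    then show ?case
    proof cases
      case 1
      then have "P (Suc n) t = p n (\<tau> n t)" using Suc step by simp
      then show ?thesis using p(6,7) early by auto
    next
      case 2
      then have "P (Suc n) t = P n t" using p(8)[OF late] step by simp
      moreover have "(1/2) ^ Suc n < (1/2 :: real) ^ n" by simp
      then have "\<not> t \<le> (1/2) ^ Suc n" using 2 by linarith
      ultimately show ?thesis using Suc by simp
    qed
  qed
  have P_lim: "(\<lambda>n. P n t) \<longlonglongrightarrow> x 0 + F t" for t
    unfolding P_def using F(1)[of t] by (auto simp: sums_def intro!: tendsto_intros)
  have ends: "f' k t = 0 \<and> g' k t = 0" if "t \<le> 0 \<or> t \<ge> 1" for k t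
  proof -
    have "t \<le> (1/2) ^ Suc k \<or> t \<ge> (1/2) ^ k"
      using that power_le_one[of "1/2 :: real" k] zero_le_power[of "1/2 :: real" "Suc k"] by linarith
    then show ?thesis using p(7)[OF early] p(8)[OF late] by (auto simp: f'_def g'_def)
  qed
  show ?thesis
  proof (rule timed_arcI)
    show "((\<lambda>t. x 0 + F t) has_vector_derivative (\<Sum>k. f' k t)) (at t)" for t
      using has_vector_derivative_add[OF has_vector_derivative_const F(2)] by simp
    have "continuous_on UNIV (\<lambda>t. \<Sum>k<n. f' k t)" for n
      unfolding f'_def by (intro continuous_intros continuous_on_compose2[OF p(2)] \<tau>_cont) auto
    moreover have "uniform_limit UNIV (\<lambda>n t. \<Sum>k<n. f' k t) (\<lambda>t. \<Sum>k. f' k t) sequentially"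
      using norm_bounds M_sum by (intro Weierstrass_m_test) (auto simp: sums_iff)
    ultimately show "continuous_on UNIV (\<lambda>t. \<Sum>k. f' k t)"
      by (intro uniform_limit_theorem[where F = sequentially]) auto
    show "(G has_real_derivative (\<Sum>k. g' k t)) (at t)" for t
      using G(2) by (simp add: has_real_derivative_iff_has_vector_derivative)
    show "norm (\<Sum>k. f' k t) \<le> (\<Sum>k. g' k t)" for t
      using summ g'_bounds by (intro order_trans[OF summable_norm] suminf_le) auto
    show "(\<Sum>k. g' k t) \<le> 2 * l" for t
    proof -
      have "(\<Sum>k. g' k t) \<le> (\<Sum>k. M k)"
        using summ g'_bounds M_sum by (intro suminf_le) (auto simp: sums_iff)
      then show ?thesis using M_sum \<open>l > 0\<close> by (simp add: sums_iff)
    qed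
    show "x 0 + F t \<in> S" for t
      using closed_sequentially[OF \<open>closed S\<close> _ P_lim] P by blast
    show "x 0 + F t = z \<and> G t = 0 \<and> (\<Sum>k. f' k t) = 0 \<and> (\<Sum>k. g' k t) = 0" if "t \<le> 0" for t
    proof -
      have "t \<le> (1/2) ^ k" for k using that zero_le_power[of "1/2 :: real" k] by linarith
      then have "P n t = x n" "t \<le> (1/2) ^ Suc n" for n using P[of n t] by blast+
      then have "(\<lambda>n. P n t) \<longlonglongrightarrow> z" "\<And>k. g k t = 0"
        using x p(7)[OF early] by (auto simp: g_def)
      then have "x 0 + F t = z" "G t = 0"
        using LIMSEQ_unique[OF P_lim] G(1)[of t] sums_unique2[of "\<lambda>_. 0" "G t" 0] by auto
      then show ?thesis using ends that by simp
    qed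
    show "x 0 + F t = x 0 \<and> G t = G 1 \<and> (\<Sum>k. f' k t) = 0 \<and> (\<Sum>k. g' k t) = 0" if "t \<ge> 1" for t
    proof -
      have *: "1 \<ge> (1/2 :: real) ^ k" "t \<ge> (1/2) ^ k" for k
        using that power_le_one[of "1/2 :: real" k] by auto
      have "f k t = 0" "g k t = g k 1" for k
        using p(8)[OF late[OF *(2)]] p(8)[OF late[OF *(1)]] by (auto simp: f_def g_def)
      then have "F t = 0" "G t = G 1"
        using F(1)[of t] G(1)[of t] G(1)[of 1] sums_unique2[of "\<lambda>_. 0" "F t" 0] sums_unique2 by auto
      then show ?thesis using ends that by simp
    qed
    have *: "1 \<ge> (1/2 :: real) ^ k" for k using power_le_one[of "1/2 :: real" k] by auto
    have b: "g k 1 \<le> l * (1/8) ^ Suc k" for k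
      using p(8)[OF late[OF *]] p(9) by (auto simp: g_def)
    have "(\<lambda>k. l * (1/8) ^ Suc k) sums (l / 7)"
      using geometric_sums[of "1/8 :: real"] sums_mult[of _ "8/7" "l / 8"] by simp
    from sums_le[OF b G(1) this] show "G 1 \<le> l" using \<open>l > 0\<close> by simp
  qed fact
qed

section \<open>The intrinsic distance of the domain\<close>

lemma geo_dist_altdef:
  assumes "x \<in> closure \<Omega>" "y \<in> closure \<Omega>"
  shows "geo_dist \<Omega> x y =
    Inf {integral {0..1} (\<lambda>t. norm (\<xi>' t)) | \<xi> \<xi>'. c1_arc (closure \<Omega>) x y \<xi> \<xi>'}"
  using assms by (simp add: geo_dist_def c1_arc_def)

lemma dist_le_arc_length:
  assumes "c1_arc S x y \<xi> \<xi>'"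
  shows "dist x y \<le> integral {0..1} (\<lambda>t. norm (\<xi>' t))"
proof -
  have \<xi>: "\<And>t. t \<in> {0..1} \<Longrightarrow> (\<xi> has_vector_derivative \<xi>' t) (at t within {0..1})"
    "continuous_on {0..1} \<xi>'" "\<xi> 0 = x" "\<xi> 1 = y"
    using assms by (auto simp: c1_arc_def)
  have "(\<xi>' has_integral \<xi> 1 - \<xi> 0) {0..1}"
    by (rule fundamental_theorem_of_calculus) (use \<xi> in auto)
  then have "y - x = integral {0..1} \<xi>'" using \<xi> by (simp add: integral_unique)
  moreover have "norm (integral {0..1} \<xi>') \<le> integral {0..1} (\<lambda>t. norm (\<xi>' t))"
    by (rule integral_norm_bound_integral) (auto intro!: integrable_continuous_real continuous_intros \<xi>)
  ultimately show ?thesis by (simp add: dist_norm norm_minus_commute[of x])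
qed

lemma geo_dist_le:
  assumes "c1_arc (closure \<Omega>) x y \<xi> \<xi>'"
  shows "geo_dist \<Omega> x y \<le> integral {0..1} (\<lambda>t. norm (\<xi>' t))"
proof -
  have "x \<in> closure \<Omega>" "y \<in> closure \<Omega>" using assms by (auto simp: c1_arc_def)
  moreover have "bdd_below {integral {0..1} (\<lambda>t. norm (\<xi>' t)) | \<xi> \<xi>'. c1_arc (closure \<Omega>) x y \<xi> \<xi>'}"
    using dist_le_arc_length by (intro bdd_belowI[of _ "dist x y"]) auto
  ultimately show ?thesis using assms by (auto simp: geo_dist_altdef intro!: cInf_lower)
qed

lemma geo_dist_le_timed_arc:
  assumes "timed_arc (closure \<Omega>) x y l" shows "geo_dist \<Omega> x y \<le> l"
proof (rule timed_arcE[OF assms])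
  fix p v s w m
  assume p: "\<And>t. (p has_vector_derivative v t) (at t)" "continuous_on UNIV v"
      "\<And>t. (s has_real_derivative w t) (at t)" "\<And>t. norm (v t) \<le> w t" "\<And>t. w t \<le> 2 * l"
      "\<And>t. p t \<in> closure \<Omega>" "\<And>t. t \<le> 0 \<Longrightarrow> p t = x \<and> s t = 0 \<and> v t = 0 \<and> w t = 0"
      "\<And>t. t \<ge> 1 \<Longrightarrow> p t = y \<and> s t = m \<and> v t = 0 \<and> w t = 0" "m \<le> l" "l > 0"
  obtain \<xi> \<xi>' where "c1_arc (closure \<Omega>) (p 0) (p 1) \<xi> \<xi>'"
    "integral {0..1} (\<lambda>t. norm (\<xi>' t)) \<le> s 1 - s 0"
    using c1_arc_piece[OF p(1,2,6,3,4), of 0 1] by auto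
  then show "geo_dist \<Omega> x y \<le> l" using geo_dist_le p(7)[of 0] p(8)[of 1] p(9) by fastforce
qed

lemma c1_arc_of_timed_arc:
  assumes "timed_arc S x y l"
  obtains \<xi> \<xi>' where "c1_arc S x y \<xi> \<xi>'"
proof (rule timed_arcE[OF assms])
  fix p v s w m
  assume p: "\<And>t. (p has_vector_derivative v t) (at t)" "continuous_on UNIV v"
      "\<And>t. (s has_real_derivative w t) (at t)" "\<And>t. norm (v t) \<le> w t" "\<And>t. w t \<le> 2 * l"
      "\<And>t. p t \<in> S" "\<And>t. t \<le> 0 \<Longrightarrow> p t = x \<and> s t = 0 \<and> v t = 0 \<and> w t = 0"
      "\<And>t. t \<ge> 1 \<Longrightarrow> p t = y \<and> s t = m \<and> v t = 0 \<and> w t = 0" "m \<le> l" "l > 0"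
  show thesis
    by (rule c1_arc_piece[OF p(1,2,6,3,4), of 0 1]) (use that p(7)[of 0] p(8)[of 1] in auto)
qed

lemma timed_arc_ends: "timed_arc S x y l \<Longrightarrow> x \<in> S \<and> y \<in> S \<and> l > 0"
  by (erule timed_arcE) (metis order_refl)

lemma
  assumes "timed_arc (closure \<Omega>) x y l'"
  shows dist_le_geo_dist: "dist x y \<le> geo_dist \<Omega> x y"
    and timed_arc_of_geo_dist_less: "geo_dist \<Omega> x y < l \<Longrightarrow> timed_arc (closure \<Omega>) x y l"
proof -
  let ?A = "{integral {0..1} (\<lambda>t. norm (\<xi>' t)) | \<xi> \<xi>'. c1_arc (closure \<Omega>) x y \<xi> \<xi>'}"
  obtain \<xi> \<xi>' where "c1_arc (closure \<Omega>) x y \<xi> \<xi>'" by (rule c1_arc_of_timed_arc[OF assms])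
  then have ne: "?A \<noteq> {}" by auto
  have eq: "geo_dist \<Omega> x y = Inf ?A"
    using timed_arc_ends[OF assms] by (simp add: geo_dist_altdef)
  show "dist x y \<le> geo_dist \<Omega> x y"
    unfolding eq
  proof (rule cInf_greatest[OF ne])
    fix a assume "a \<in> ?A"
    then obtain \<xi> \<xi>' where "c1_arc (closure \<Omega>) x y \<xi> \<xi>'" "a = integral {0..1} (\<lambda>t. norm (\<xi>' t))"
      by auto
    then show "dist x y \<le> a" by (simp add: dist_le_arc_length)
  qed
  assume "geo_dist \<Omega> x y < l"
  then have "\<exists>a\<in>?A. a < l" unfolding eq by (rule cInf_lessD[OF ne])
  then obtain \<xi> \<xi>' where "c1_arc (closure \<Omega>) x y \<xi> \<xi>'" "integral {0..1} (\<lambda>t. norm (\<xi>' t)) < l"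
    by auto
  then show "timed_arc (closure \<Omega>) x y l" by (rule timed_arc_of_c1_arc)
qed

text \<open>Being joined by an arc is an equivalence relation with open classes, and \<open>\<Omega>\<close> is connected.\<close>

lemma timed_arc_in_domain:
  assumes "open \<Omega>" "connected \<Omega>" "x \<in> \<Omega>" "y \<in> \<Omega>"
  shows "\<exists>l. timed_arc (closure \<Omega>) x y l"
proof (rule connected_equivalence_relation[OF assms(2-4)])
  fix a assume "a \<in> \<Omega>"
  then obtain e where e: "e > 0" "ball a e \<subseteq> \<Omega>" using assms(1) by (meson openE)
  show "\<exists>T. openin (top_of_set \<Omega>) T \<and> a \<in> T \<and> (\<forall>x\<in>T. \<exists>l. timed_arc (closure \<Omega>) a x l)"
  proof (intro exI conjI ballI)
    show "openin (top_of_set \<Omega>) (ball a e)" using e by (intro open_subset) auto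
    fix x assume "x \<in> ball a e"
    then have "closed_segment a x \<subseteq> closure \<Omega>"
      using e closure_subset convex_ball[of a e] by (intro order_trans[OF closed_segment_subset[of a "ball a e"]]) auto
    then show "timed_arc (closure \<Omega>) a x (norm (x - a) + 1)"
      by (rule timed_arc_segment) (auto intro: add_nonneg_pos)
  qed (use e in auto)
next
  show "\<exists>l. timed_arc (closure \<Omega>) v u l" if "\<exists>l. timed_arc (closure \<Omega>) u v l" for u v
    using that timed_arc_sym by blast
  show "\<exists>l. timed_arc (closure \<Omega>) u z l"
    if "\<exists>l. timed_arc (closure \<Omega>) u v l" "\<exists>l. timed_arc (closure \<Omega>) v z l" for u v z
    using that timed_arc_trans by blast
qed

text \<open>Nearby points of \<open>\<Omega>\<close> are joined by arcs of at most about twice their distance. A sequence in \<open>\<Omega>\<close>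
  that converges to a boundary point fast enough can therefore be followed to its limit.\<close>

lemma timed_arc_dense:
  assumes dom: "open \<Omega>" "connected \<Omega>" "domain_assumption \<Omega> \<phi> r"
    and z: "z \<in> closure \<Omega>" and "e > 0"
  obtains x where "x \<in> \<Omega>" "dist z x < e" "timed_arc (closure \<Omega>) z x e"
proof -
  have \<phi>: "((\<lambda>s. \<phi> s / s) \<longlongrightarrow> 0) (at_right 0)" and "r > 0"
    and geo: "\<And>x y. x \<in> \<Omega> \<Longrightarrow> y \<in> \<Omega> \<Longrightarrow> dist x y \<le> r \<Longrightarrow> geo_dist \<Omega> x y \<le> dist x y + \<phi> (dist x y)"
    using dom(3) by (auto simp: domain_assumption_def)
  have "\<forall>\<^sub>F s in at_right 0. \<phi> s / s < 1" using order_tendstoD(2)[OF \<phi>, of 1] by simp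
  then obtain a where a: "a > 0" "\<And>s. 0 < s \<Longrightarrow> s < a \<Longrightarrow> \<phi> s / s < 1"
    unfolding eventually_at_right_field by auto
  have near: "timed_arc (closure \<Omega>) x y l"
    if xy: "x \<in> \<Omega>" "y \<in> \<Omega>" "dist x y < a" "dist x y \<le> r" "2 * dist x y < l" for x y l
  proof (cases "x = y")
    case True
    have "x \<in> closure \<Omega>" using xy(1) closure_subset by blast
    then show ?thesis using True timed_arc_segment[of x x "closure \<Omega>" l] xy(5) by simp
  next
    case False
    then have "\<phi> (dist x y) < dist x y" using a(2)[of "dist x y"] xy(3) by (simp add: divide_simps)
    then have "geo_dist \<Omega> x y < l" using geo[OF xy(1,2,4)] xy(5) by linarith
    then show ?thesis
      using timed_arc_in_domain[OF dom(1,2) xy(1,2)] timed_arc_of_geo_dist_less by blast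
  qed
  define \<rho> where "\<rho> k = min (min (a/2) (r/2)) (e * (1/8) ^ Suc k / 8)" for k :: nat
  have \<rho>: "\<rho> k > 0" for k using a \<open>r > 0\<close> \<open>e > 0\<close> by (auto simp: \<rho>_def)
  have "\<exists>x\<in>\<Omega>. dist x z < \<rho> k" for k using z \<rho> by (auto simp: closure_approachable)
  then obtain x where x: "\<And>k. x k \<in> \<Omega>" "\<And>k. dist (x k) z < \<rho> k" by metis
  have lim: "x \<longlonglongrightarrow> z"
  proof (rule metric_LIMSEQ_I)
    fix e' :: real assume "e' > 0"
    have "(\<lambda>k. (e / 64) * (1/8 :: real) ^ k) \<longlonglongrightarrow> 0"
      by (intro tendsto_mult_right_zero LIMSEQ_power_zero) simp
    then have "(\<lambda>k. e * (1/8) ^ Suc k / 8) \<longlonglongrightarrow> 0" by (simp add: mult.commute)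
    then obtain N where N: "\<forall>k\<ge>N. e * (1/8) ^ Suc k / 8 < e'"
      using order_tendstoD(2)[of "\<lambda>k. e * (1/8) ^ Suc k / 8" 0 sequentially e'] \<open>e' > 0\<close>
      unfolding eventually_sequentially by blast
    have "dist (x k) z < e'" if "k \<ge> N" for k
    proof -
      have "\<rho> k \<le> e * (1/8) ^ Suc k / 8" by (simp add: \<rho>_def)
      moreover have "e * (1/8) ^ Suc k / 8 < e'" using N that by blast
      ultimately show ?thesis using x(2)[of k] by linarith
    qed
    then show "\<exists>N. \<forall>k\<ge>N. dist (x k) z < e'" by blast
  qed
  have "timed_arc (closure \<Omega>) (x (Suc k)) (x k) (e * (1/8) ^ Suc k)" for k
  proof (rule near)
    have "dist (x (Suc k)) (x k) < \<rho> k + \<rho> (Suc k)"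
      using dist_triangle2[of "x (Suc k)" "x k" z] x(2)[of k] x(2)[of "Suc k"] by linarith
    moreover have "\<rho> (Suc k) \<le> \<rho> k"
    proof -
      have "e * (1/8) ^ Suc (Suc k) / 8 \<le> e * (1/8) ^ Suc k / 8" using \<open>e > 0\<close> by simp
      then show ?thesis unfolding \<rho>_def by linarith
    qed
    ultimately have D: "dist (x (Suc k)) (x k) < 2 * \<rho> k" by linarith
    have "\<rho> k \<le> a/2" by (simp add: \<rho>_def)
    with D show "dist (x (Suc k)) (x k) < a" by linarith
    have "\<rho> k \<le> r/2" by (simp add: \<rho>_def)
    with D show "dist (x (Suc k)) (x k) \<le> r" by linarith
    have "\<rho> k \<le> e * (1/8) ^ Suc k / 8" unfolding \<rho>_def by (rule min.cobounded2)
    with D have "2 * dist (x (Suc k)) (x k) < (e * (1/8) ^ Suc k) / 2" by linarith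
    also have "\<dots> < e * (1/8) ^ Suc k" using \<open>e > 0\<close> by simp
    finally show "2 * dist (x (Suc k)) (x k) < e * (1/8) ^ Suc k" .
  qed (use x in auto)
  then have "timed_arc (closure \<Omega>) z (x 0) e"
    by (rule timed_arc_limit[OF closed_closure lim \<open>e > 0\<close>])
  moreover have "dist z (x 0) < e" using x(2)[of 0] \<open>e > 0\<close> by (auto simp: \<rho>_def dist_commute)
  ultimately show thesis using that x(1) by blast
qed

lemma timed_arc_exists:
  assumes dom: "open \<Omega>" "connected \<Omega>" "domain_assumption \<Omega> \<phi> r"
    and "x \<in> closure \<Omega>" "y \<in> closure \<Omega>"
  shows "\<exists>l. timed_arc (closure \<Omega>) x y l"
proof -
  obtain x' where x': "x' \<in> \<Omega>" "timed_arc (closure \<Omega>) x x' 1"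
    using timed_arc_dense[OF dom assms(4) zero_less_one] by blast
  obtain y' where y': "y' \<in> \<Omega>" "timed_arc (closure \<Omega>) y y' 1"
    using timed_arc_dense[OF dom assms(5) zero_less_one] by blast
  obtain l where "timed_arc (closure \<Omega>) x' y' l"
    using timed_arc_in_domain[OF dom(1,2) x'(1) y'(1)] by blast
  then show ?thesis using timed_arc_trans[OF timed_arc_trans[OF x'(2)] timed_arc_sym[OF y'(2)]] by blast
qed

lemma timed_arc_near_geo_dist:
  assumes dom: "open \<Omega>" "connected \<Omega>" "domain_assumption \<Omega> \<phi> r"
    and xy: "x \<in> closure \<Omega>" "y \<in> closure \<Omega>" and "e > 0"
  shows "timed_arc (closure \<Omega>) x y (geo_dist \<Omega> x y + e)"
proof -
  obtain l where "timed_arc (closure \<Omega>) x y l" using timed_arc_exists[OF dom xy] by blast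
  then show ?thesis by (rule timed_arc_of_geo_dist_less) (use \<open>e > 0\<close> in simp)
qed

lemma Metric_space_geo_dist:
  assumes dom: "open \<Omega>" "connected \<Omega>" "domain_assumption \<Omega> \<phi> r"
  shows "Metric_space (closure \<Omega>) (geo_dist \<Omega>)"
proof -
  note ex = timed_arc_exists[OF dom]
  have le: "geo_dist \<Omega> x y \<le> geo_dist \<Omega> y x" if xy: "x \<in> closure \<Omega>" "y \<in> closure \<Omega>" for x y
  proof (rule field_le_epsilon)
    fix e :: real assume "e > 0"
    then show "geo_dist \<Omega> x y \<le> geo_dist \<Omega> y x + e"
      by (intro geo_dist_le_timed_arc timed_arc_sym[OF timed_arc_near_geo_dist[OF dom]] xy)
  qed
  show ?thesis
  proof
    fix x y z
    show "0 \<le> geo_dist \<Omega> x y"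
    proof (cases "x \<in> closure \<Omega> \<and> y \<in> closure \<Omega>")
      case True
      then have "dist x y \<le> geo_dist \<Omega> x y" using dist_le_geo_dist ex by blast
      with zero_le_dist show ?thesis by (rule order_trans)
    qed (auto simp: geo_dist_def)
    show "geo_dist \<Omega> x y = geo_dist \<Omega> y x"
    proof (cases "x \<in> closure \<Omega> \<and> y \<in> closure \<Omega>")
      case True
      then show ?thesis using le[of x y] le[of y x] by auto
    qed (auto simp: geo_dist_def)
    assume x: "x \<in> closure \<Omega>" and y: "y \<in> closure \<Omega>"
    show "geo_dist \<Omega> x y = 0 \<longleftrightarrow> x = y"
    proof
      assume "geo_dist \<Omega> x y = 0"
      moreover have "dist x y \<le> geo_dist \<Omega> x y" using dist_le_geo_dist ex[OF x y] by blast
      ultimately show "x = y" by simp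
    next
      assume [simp]: "x = y"
      have "geo_dist \<Omega> x x \<le> e" if "e > 0" for e
        using timed_arc_segment[of x x "closure \<Omega>" e] that x by (intro geo_dist_le_timed_arc) auto
      then have "geo_dist \<Omega> x x \<le> 0" by (rule field_le_epsilon) auto
      moreover have "dist x x \<le> geo_dist \<Omega> x x" using dist_le_geo_dist ex[OF x x] by blast
      ultimately show "geo_dist \<Omega> x y = 0" by simp
    qed
    assume z: "z \<in> closure \<Omega>"
    show "geo_dist \<Omega> x z \<le> geo_dist \<Omega> x y + geo_dist \<Omega> y z"
    proof (rule field_le_epsilon)
      fix e :: real assume "e > 0"
      then have "timed_arc (closure \<Omega>) x y (geo_dist \<Omega> x y + e/2)"
        "timed_arc (closure \<Omega>) y z (geo_dist \<Omega> y z + e/2)"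
        using x y z by (auto intro!: timed_arc_near_geo_dist[OF dom])
      from geo_dist_le_timed_arc[OF timed_arc_trans[OF this]]
      show "geo_dist \<Omega> x z \<le> geo_dist \<Omega> x y + geo_dist \<Omega> y z + e" by simp
    qed
  qed
qed

lemma near_geodesic_geo_dist:
  assumes dom: "open \<Omega>" "connected \<Omega>" "domain_assumption \<Omega> \<phi> r"
    and xy: "x \<in> closure \<Omega>" "y \<in> closure \<Omega>" and "e > 0"
  obtains p where "continuous_on {0..1::real} p" "p ` {0..1} \<subseteq> closure \<Omega>" "p 0 = x" "p 1 = y"
    "\<And>t. t \<in> {0..1} \<Longrightarrow> geo_dist \<Omega> x (p t) + geo_dist \<Omega> (p t) y \<le> geo_dist \<Omega> x y + e"
proof -
  have "timed_arc (closure \<Omega>) x y (geo_dist \<Omega> x y + e)"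
    by (rule timed_arc_near_geo_dist[OF dom xy \<open>e > 0\<close>])
  then show thesis
  proof (rule timed_arcE)
    fix p v s w m
    assume p: "\<And>t. (p has_vector_derivative v t) (at t)" "continuous_on UNIV v"
        "\<And>t. (s has_real_derivative w t) (at t)" "\<And>t. norm (v t) \<le> w t"
        "\<And>t. w t \<le> 2 * (geo_dist \<Omega> x y + e)"
        "\<And>t. p t \<in> closure \<Omega>" "\<And>t. t \<le> 0 \<Longrightarrow> p t = x \<and> s t = 0 \<and> v t = 0 \<and> w t = 0"
        "\<And>t. t \<ge> 1 \<Longrightarrow> p t = y \<and> s t = m \<and> v t = 0 \<and> w t = 0" "m \<le> geo_dist \<Omega> x y + e"
    have piece: "geo_dist \<Omega> (p a) (p b) \<le> s b - s a" if "a \<le> b" for a b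
      using c1_arc_piece[OF p(1,2,6,3,4) that] geo_dist_le order_trans by metis
    show thesis
    proof (rule that)
      show "continuous_on {0..1} p"
        using p(1) by (intro continuous_on_vector_derivative) (auto intro: has_vector_derivative_at_within)
      show "geo_dist \<Omega> x (p t) + geo_dist \<Omega> (p t) y \<le> geo_dist \<Omega> x y + e" if "t \<in> {0..1}" for t
        using piece[of 0 t] piece[of t 1] p(7)[of 0] p(8)[of 1] p(9) that by auto
    qed (use p in auto)
  qed
qed

text \<open>The expansion passes from \<open>\<Omega>\<close> to its closure, because every point of the closure has interior
  points arbitrarily close in the intrinsic sense.\<close>

lemma geo_dist_le_local:
  assumes dom: "open \<Omega>" "connected \<Omega>" "domain_assumption \<Omega> \<phi> r"
    and B: "\<And>s. s \<in> {0<..r} \<Longrightarrow> \<phi> s \<le> B * s powr (9/5)" "B \<ge> 0"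
    and xy: "x \<in> closure \<Omega>" "y \<in> closure \<Omega>" "dist x y < r"
  shows "geo_dist \<Omega> x y \<le> dist x y + B * dist x y powr (9/5)"
proof (cases "x = y")
  case True
  interpret Metric_space "closure \<Omega>" "geo_dist \<Omega>" by (rule Metric_space_geo_dist[OF dom])
  show ?thesis using True xy zero by simp
next
  case False
  interpret Metric_space "closure \<Omega>" "geo_dist \<Omega>" by (rule Metric_space_geo_dist[OF dom])
  define D where "D = dist x y"
  have "D > 0" using False by (simp add: D_def)
  have bound: "geo_dist \<Omega> x y \<le> 2 * e + ((D + 2 * e) + B * (D + 2 * e) powr (9/5))"
    if e: "e > 0" "D + 2 * e \<le> r" for e
  proof -
    obtain x' where x': "x' \<in> \<Omega>" "dist x x' < e" "timed_arc (closure \<Omega>) x x' e"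
      using timed_arc_dense[OF dom xy(1) e(1)] by blast
    obtain y' where y': "y' \<in> \<Omega>" "dist y y' < e" "timed_arc (closure \<Omega>) y y' e"
      using timed_arc_dense[OF dom xy(2) e(1)] by blast
    have cl: "x' \<in> closure \<Omega>" "y' \<in> closure \<Omega>" using x' y' closure_subset by auto
    have D': "dist x' y' \<le> D + 2 * e"
      using dist_triangle[of x' y' x] dist_triangle[of x y' y] x'(2) y'(2)
      by (simp add: D_def dist_commute)
    have "geo_dist \<Omega> x' y' \<le> (D + 2 * e) + B * (D + 2 * e) powr (9/5)"
    proof (cases "x' = y'")
      case True
      then show ?thesis using cl zero \<open>D > 0\<close> e B(2) by simp
    next
      case False
      then have "geo_dist \<Omega> x' y' \<le> dist x' y' + \<phi> (dist x' y')" "\<phi> (dist x' y') \<le> B * dist x' y' powr (9/5)"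
        using dom(3) x'(1) y'(1) D' e B(1) by (auto simp: domain_assumption_def)
      moreover have "dist x' y' powr (9/5) \<le> (D + 2 * e) powr (9/5)"
        using D' by (intro powr_mono2) auto
      ultimately show ?thesis using D' mult_left_mono[OF _ B(2)] by fastforce
    qed
    moreover have "geo_dist \<Omega> x x' \<le> e" "geo_dist \<Omega> y y' \<le> e"
      using geo_dist_le_timed_arc x' y' by auto
    ultimately show ?thesis
      using triangle[OF xy(1) cl(1) xy(2)] triangle[OF cl(1,2) xy(2)] commute[of y y'] by linarith
  qed
  have "((\<lambda>e. 2 * e + ((D + 2 * e) + B * (D + 2 * e) powr (9/5))) \<longlongrightarrow>
      2 * 0 + ((D + 2 * 0) + B * (D + 2 * 0) powr (9/5))) (at_right 0)"
    using \<open>D > 0\<close> by (intro tendsto_intros) auto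
  moreover have "\<forall>\<^sub>F e in at_right 0. geo_dist \<Omega> x y \<le> 2 * e + ((D + 2 * e) + B * (D + 2 * e) powr (9/5))"
    unfolding eventually_at_right_field
  proof (intro exI[of _ "(r - D) / 2"] conjI allI impI)
    show "(r - D) / 2 > 0" using xy(3) by (simp add: D_def)
    fix e assume "e > 0" "e < (r - D) / 2"
    then show "geo_dist \<Omega> x y \<le> 2 * e + ((D + 2 * e) + B * (D + 2 * e) powr (9/5))"
      by (intro bound) auto
  qed
  ultimately have "geo_dist \<Omega> x y \<le> 2 * 0 + ((D + 2 * 0) + B * (D + 2 * 0) powr (9/5))"
    by (rule tendsto_lowerbound) simp
  then show ?thesis by (simp add: D_def)
qed

text \<open>By compactness the intrinsic distance is bounded, so that enlarging the constant covers all
  pairs of points whose distance is not small.\<close>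

lemma geo_dist_le_global:
  assumes dom: "open \<Omega>" "connected \<Omega>" "domain_assumption \<Omega> \<phi> r" and "bounded \<Omega>" "\<Omega> \<noteq> {}"
    and B: "\<And>s. s \<in> {0<..r} \<Longrightarrow> \<phi> s \<le> B * s powr (9/5)"
  obtains B' where "B' \<ge> 0" "\<And>x y. x \<in> closure \<Omega> \<Longrightarrow> y \<in> closure \<Omega> \<Longrightarrow>
    geo_dist \<Omega> x y \<le> dist x y + B' * dist x y powr (9/5)"
proof -
  interpret Metric_space "closure \<Omega>" "geo_dist \<Omega>" by (rule Metric_space_geo_dist[OF dom])
  have "r > 0" using dom(3) by (simp add: domain_assumption_def)
  have loc: "geo_dist \<Omega> x y \<le> dist x y + max B 0 * dist x y powr (9/5)"
    if "x \<in> closure \<Omega>" "y \<in> closure \<Omega>" "dist x y < r" for x y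
  proof (rule geo_dist_le_local[OF dom _ _ that])
    show "\<phi> s \<le> max B 0 * s powr (9/5)" if "s \<in> {0<..r}" for s
      by (rule order_trans[OF B[OF that]], rule mult_right_mono) simp_all
  qed simp
  obtain a where a: "a \<in> closure \<Omega>" using assms(5) closure_subset by blast
  have "continuous_on (closure \<Omega>) (geo_dist \<Omega> a)"
    unfolding continuous_on_def
  proof
    fix x assume x: "x \<in> closure \<Omega>"
    define F where "F = at x within closure \<Omega>"
    have d: "((\<lambda>y. dist x y) \<longlongrightarrow> 0) F" unfolding F_def using tendsto_dist[OF tendsto_const tendsto_ident_at, of x x] by simp
    have "((\<lambda>y. dist x y powr (9/5)) \<longlongrightarrow> 0 powr (9/5)) F"
      by (rule tendsto_powr'[OF d tendsto_const]) simp
    from tendsto_add[OF d tendsto_mult[OF tendsto_const this]]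
    have lim: "((\<lambda>y. dist x y + max B 0 * dist x y powr (9/5)) \<longlongrightarrow> 0) F" by simp
    have ev: "\<forall>\<^sub>F y in F.
        norm (geo_dist \<Omega> a y - geo_dist \<Omega> a x) \<le> dist x y + max B 0 * dist x y powr (9/5)"
      unfolding eventually_at F_def
    proof (intro exI[of _ r] conjI ballI impI)
      fix y assume y: "y \<in> closure \<Omega>" "y \<noteq> x \<and> dist y x < r"
      have "norm (geo_dist \<Omega> a y - geo_dist \<Omega> a x) \<le> geo_dist \<Omega> x y"
        using triangle[OF a x y(1)] triangle[OF a y(1) x] commute[of x y]
        unfolding real_norm_def by linarith
      also have "\<dots> \<le> dist x y + max B 0 * dist x y powr (9/5)"
        using y by (intro loc x) (auto simp: dist_commute)
      finally show "norm (geo_dist \<Omega> a y - geo_dist \<Omega> a x) \<le> dist x y + max B 0 * dist x y powr (9/5)" .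
    qed fact
    have "((\<lambda>y. geo_dist \<Omega> a y - geo_dist \<Omega> a x) \<longlongrightarrow> 0) (at x within closure \<Omega>)"
      using Lim_null_comparison[OF ev lim] unfolding F_def .
    then show "(geo_dist \<Omega> a \<longlongrightarrow> geo_dist \<Omega> a x) (at x within closure \<Omega>)"
      by (rule LIM_zero_cancel)
  qed
  moreover have "compact (closure \<Omega>)" using assms(4) by (simp add: compact_closure)
  ultimately have "bounded (geo_dist \<Omega> a ` closure \<Omega>)"
    by (rule compact_imp_bounded[OF compact_continuous_image])
  then obtain K where "\<forall>y\<in>closure \<Omega>. norm (geo_dist \<Omega> a y) \<le> K"
    by (auto simp: bounded_iff)
  then have K: "geo_dist \<Omega> a y \<le> K" if "y \<in> closure \<Omega>" for y
    using that abs_ge_self[of "geo_dist \<Omega> a y"] by fastforce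
  define B' where "B' = max (max B 0) (2 * K / r powr (9/5))"
  have glob: "geo_dist \<Omega> x y \<le> dist x y + B' * dist x y powr (9/5)"
    if xy: "x \<in> closure \<Omega>" "y \<in> closure \<Omega>" for x y
  proof (cases "dist x y < r")
    case True
    have "max B 0 * dist x y powr (9/5) \<le> B' * dist x y powr (9/5)"
      by (rule mult_right_mono) (simp_all add: B'_def)
    then show ?thesis using loc[OF xy True] by simp
  next
    case False
    have "0 \<le> K" using K[OF a] nonneg[of a a] by linarith
    have "geo_dist \<Omega> x y \<le> 2 * K"
      using triangle[OF xy(1) a xy(2)] K[OF xy(1)] K[OF xy(2)] commute[of x a] by linarith
    also have "\<dots> = 2 * K / r powr (9/5) * r powr (9/5)" using \<open>r > 0\<close> by simp
    also have "\<dots> \<le> B' * dist x y powr (9/5)"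
      using False \<open>r > 0\<close> \<open>0 \<le> K\<close> by (intro mult_mono powr_mono2) (auto simp: B'_def le_max_iff_disj)
    finally show ?thesis by (simp add: add_increasing)
  qed
  show thesis by (rule that[OF _ glob]) (auto simp: B'_def)
qed

section \<open>Compact length spaces and comparison with cones\<close>

text \<open>The properties of the intrinsic distance that the comparison arguments rest on: near-geodesics,
  and an expansion around the Euclidean distance.\<close>

locale intrinsic_domain = Metric_space S d
  for S :: "'a::euclidean_space set" and d :: "'a \<Rightarrow> 'a \<Rightarrow> real" +
  fixes B :: real
  assumes compact_S: "compact S" and B_nonneg: "B \<ge> 0"
    and dist_le_d: "\<And>x y. x \<in> S \<Longrightarrow> y \<in> S \<Longrightarrow> dist x y \<le> d x y"
    and d_le_dist: "\<And>x y. x \<in> S \<Longrightarrow> y \<in> S \<Longrightarrow> d x y \<le> dist x y + B * dist x y powr (9/5)"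
    and near_geodesic: "\<And>x y e. x \<in> S \<Longrightarrow> y \<in> S \<Longrightarrow> e > 0 \<Longrightarrow>
      \<exists>p. continuous_on {0..1::real} p \<and> p ` {0..1} \<subseteq> S \<and> p 0 = x \<and> p 1 = y \<and>
        (\<forall>t\<in>{0..1}. d x (p t) + d (p t) y \<le> d x y + e)"
begin

lemma d_self: "x \<in> S \<Longrightarrow> d x x = 0"
  using zero by simp

text \<open>The global comparison with the Euclidean distance that replaces the local expansion when
  constants do not matter.\<close>

definition \<kappa> :: real where
  "\<kappa> = 1 + B * diameter S powr (4/5)"

lemma \<kappa>_ge_1: "\<kappa> \<ge> 1"
  using B_nonneg by (simp add: \<kappa>_def)

lemma powr_9_5: "s \<ge> 0 \<Longrightarrow> s powr (9/5) = s * s powr (4/5)" for s :: real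
  using powr_add[of s 1 "4/5"] by (cases "s = 0") auto

lemma d_le_expansion:
  assumes "x \<in> S" "y \<in> S" "dist x y \<le> h"
  shows "d x y \<le> (1 + B * h powr (4/5)) * dist x y"
proof -
  have "B * dist x y powr (9/5) \<le> B * (dist x y * h powr (4/5))"
    unfolding powr_9_5[OF zero_le_dist] using assms(3) B_nonneg
    by (intro mult_left_mono powr_mono2) auto
  then show ?thesis using d_le_dist[OF assms(1,2)] by (simp add: algebra_simps)
qed

lemma d_le_\<kappa>: "x \<in> S \<Longrightarrow> y \<in> S \<Longrightarrow> d x y \<le> \<kappa> * dist x y"
  unfolding \<kappa>_def
  by (rule d_le_expansion) (auto intro: diameter_bounded_bound compact_imp_bounded compact_S)

lemma d_le_diameter: "x \<in> S \<Longrightarrow> y \<in> S \<Longrightarrow> d x y \<le> \<kappa> * diameter S"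
  using \<kappa>_ge_1 by (intro order_trans[OF d_le_\<kappa>] mult_left_mono diameter_bounded_bound
      compact_imp_bounded compact_S) auto

lemma continuous_on_if_lipschitz:
  assumes "\<And>x y. x \<in> S \<Longrightarrow> y \<in> S \<Longrightarrow> f x - f y \<le> \<Lambda> * d x y" "\<Lambda> \<ge> 0"
  shows "continuous_on S f"
proof (rule lipschitz_on_continuous_on)
  show "(\<Lambda> * \<kappa>)-lipschitz_on S f"
  proof (rule lipschitz_onI)
    fix x y assume xy: "x \<in> S" "y \<in> S"
    have "dist (f x) (f y) \<le> \<Lambda> * d x y"
      using assms(1)[OF xy] assms(1)[OF xy(2,1)] commute[of x y] by (simp add: dist_real_def abs_le_iff)
    also have "\<dots> \<le> \<Lambda> * (\<kappa> * dist x y)" by (rule mult_left_mono[OF d_le_\<kappa>[OF xy] assms(2)])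
    finally show "dist (f x) (f y) \<le> \<Lambda> * \<kappa> * dist x y" by (simp add: mult.assoc)
  qed (use assms(2) \<kappa>_ge_1 in simp)
qed

lemma continuous_on_d: "x \<in> S \<Longrightarrow> continuous_on S (d x)"
  by (rule continuous_on_if_lipschitz[where \<Lambda> = 1]) (use triangle commute in \<open>fastforce+\<close>)

text \<open>A near-geodesic crosses the sphere of radius \<open>a\<close> around \<open>x\<close>; compactness removes the error.\<close>

lemma between_point:
  assumes x: "x \<in> S" and y: "y \<in> S" and "a \<ge> 0" "b \<ge> 0" "d x y \<le> a + b"
  obtains z where "z \<in> S" "d x z \<le> a" "d z y \<le> b"
proof -
  define K where "K = {z \<in> S. d x z \<le> a}"
  have "K = S \<inter> d x -` {..a}" by (auto simp: K_def)
  then have "closed K"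
    using continuous_closed_preimage[OF continuous_on_d[OF x], of "{..a}"] compact_S
    by (simp add: compact_imp_closed)
  then have K: "compact K" using compact_S by (metis (no_types) K_def compact_Int_closed inf.absorb_iff2 mem_Collect_eq subsetI)
  have near: "\<exists>z\<in>K. d y z \<le> b + e" if "e > 0" for e
  proof (cases "a \<ge> d x y")
    case True
    then show ?thesis using y d_self \<open>b \<ge> 0\<close> that by (intro bexI[of _ y]) (auto simp: K_def)
  next
    case False
    obtain p where p: "continuous_on {0..1::real} p" "p ` {0..1} \<subseteq> S" "p 0 = x" "p 1 = y"
        "\<forall>t\<in>{0..1}. d x (p t) + d (p t) y \<le> d x y + e"
      using near_geodesic[OF x y \<open>e > 0\<close>] by auto
    have "continuous_on {0..1} (\<lambda>t. d x (p t))"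
      by (rule continuous_on_compose2[OF continuous_on_d[OF x] p(1,2)])
    then obtain t where t: "0 \<le> t" "t \<le> 1" "d x (p t) = a"
      using IVT'[of "\<lambda>t. d x (p t)" 0 a 1] p(3,4) False \<open>a \<ge> 0\<close> x d_self by auto
    then have "p t \<in> K" using p(2) by (auto simp: K_def)
    moreover have "a + d (p t) y \<le> d x y + e" using p(5) t by auto
    then have "d y (p t) \<le> b + e" using assms(5) commute[of y "p t"] by linarith
    ultimately show ?thesis by blast
  qed
  then have "K \<noteq> {}" using zero_less_one by blast
  moreover have "continuous_on K (d y)"
    using continuous_on_d[OF y] by (rule continuous_on_subset) (auto simp: K_def)
  ultimately obtain z where z: "z \<in> K" "\<forall>z'\<in>K. d y z \<le> d y z'"
    using continuous_attains_inf[OF K] by blast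
  have "d y z \<le> b"
  proof (rule field_le_epsilon)
    fix e :: real assume "e > 0"
    then show "d y z \<le> b + e" using near z(2) by (meson order_trans)
  qed
  then show thesis using that[of z] z(1) commute[of y z] by (simp add: K_def)
qed

lemma openin_iff:
  "openin (top_of_set S) V \<longleftrightarrow> V \<subseteq> S \<and> (\<forall>x\<in>V. \<exists>e>0. \<forall>y\<in>S. d x y < e \<longrightarrow> y \<in> V)"
proof -
  have "(\<exists>e>0. \<forall>y\<in>S. dist y x < e \<longrightarrow> y \<in> V) \<longleftrightarrow> (\<exists>e>0. \<forall>y\<in>S. d x y < e \<longrightarrow> y \<in> V)"
    if x: "x \<in> S" for x
  proof
    assume "\<exists>e>0. \<forall>y\<in>S. dist y x < e \<longrightarrow> y \<in> V"
    then obtain e where e: "e > 0" "\<forall>y\<in>S. dist y x < e \<longrightarrow> y \<in> V" by blast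
    have "y \<in> V" if "y \<in> S" "d x y < e" for y
      using e(2) that dist_le_d[OF x that(1)] by (simp add: dist_commute)
    then show "\<exists>e>0. \<forall>y\<in>S. d x y < e \<longrightarrow> y \<in> V" using e(1) by blast
  next
    assume "\<exists>e>0. \<forall>y\<in>S. d x y < e \<longrightarrow> y \<in> V"
    then obtain e where e: "e > 0" "\<forall>y\<in>S. d x y < e \<longrightarrow> y \<in> V" by blast
    have "y \<in> V" if "y \<in> S" "dist y x < e / \<kappa>" for y
    proof -
      have "\<kappa> * dist x y < e"
        using that(2) \<kappa>_ge_1 by (simp add: dist_commute field_simps)
      then show ?thesis using e(2) that(1) d_le_\<kappa>[OF x that(1)] by simp
    qed
    then show "\<exists>e>0. \<forall>y\<in>S. dist y x < e \<longrightarrow> y \<in> V"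
      using e(1) \<kappa>_ge_1 by (intro exI[of _ "e / \<kappa>"]) auto
  qed
  then show ?thesis unfolding openin_euclidean_subtopology_iff by blast
qed

lemma mtopology_eq: "mtopology = top_of_set S"
proof -
  have "openin mtopology V \<longleftrightarrow> openin (top_of_set S) V" for V
  proof -
    have "(\<exists>r>0. mball x r \<subseteq> V) \<longleftrightarrow> (\<exists>r>0. \<forall>y\<in>S. d x y < r \<longrightarrow> y \<in> V)" if "x \<in> S" for x
      using that by (simp add: mball_def subset_iff Ball_def conj_commute imp_conjL)
    then show ?thesis unfolding openin_mtopology openin_iff by blast
  qed
  then show ?thesis by (simp add: topology_eq)
qed

lemma closure_subset_S: "V \<subseteq> S \<Longrightarrow> closure V \<subseteq> S"
  using compact_S by (simp add: closure_minimal compact_imp_closed)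

lemma relative_closure: "V \<subseteq> S \<Longrightarrow> top_of_set S closure_of V = closure V"
  using closure_subset_S by (auto simp: closure_of_subtopology_subset closure_of_subtopology euclidean_closure_of inf.absorb2)

lemma relative_frontier:
  assumes "openin (top_of_set S) V"
  shows "top_of_set S frontier_of V = closure V - V"
  using assms relative_closure[of V] openin_subset[OF assms] by (simp add: frontier_of_def interior_of_openin)

lemma exit_point:
  assumes V: "openin (top_of_set S) V" and "x \<in> V" "z \<in> S" "z \<notin> V" "e > 0"
  obtains y where "y \<in> closure V - V" "d x y + d y z \<le> d x z + e"
proof -
  have x: "x \<in> S" using openin_subset[OF V] \<open>x \<in> V\<close> by auto
  obtain p where p: "continuous_on {0..1::real} p" "p ` {0..1} \<subseteq> S" "p 0 = x" "p 1 = z"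
      "\<forall>t\<in>{0..1}. d x (p t) + d (p t) z \<le> d x z + e"
    using near_geodesic[OF x assms(3,5)] by auto
  have "connected (p ` {0..1})" by (intro connected_continuous_image p) auto
  then have "connectedin (top_of_set S) (p ` {0..1})" using p(2) by (simp add: connectedin_subtopology)
  then have "p ` {0..1} \<inter> (top_of_set S frontier_of V) \<noteq> {}"
  proof (rule connectedin_Int_frontier_of)
    show "p ` {0..1} \<inter> V \<noteq> {}" using \<open>x \<in> V\<close> p(3) by force
    show "p ` {0..1} - V \<noteq> {}" using \<open>z \<notin> V\<close> p(4) by force
  qed
  then show thesis using that p(5) unfolding relative_frontier[OF V] by blast
qed

text \<open>Near-geodesics between close points do not leave a small ball, so \<open>S\<close> is locally connected.\<close>

lemma component_openin:
  assumes W: "openin (top_of_set S) W"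
  shows "openin (top_of_set S) (connected_component_set W x)"
    and "p \<in> closure (connected_component_set W x) \<Longrightarrow> p \<in> W \<Longrightarrow> p \<in> connected_component_set W x"
proof -
  have WS: "W \<subseteq> S" using openin_subset[OF W] by simp
  have local: "\<exists>e>0. \<forall>y\<in>S. d v y < e \<longrightarrow> connected_component W v y" if v: "v \<in> W" for v
  proof -
    obtain e where e: "e > 0" "\<And>y. y \<in> S \<Longrightarrow> d v y < e \<Longrightarrow> y \<in> W"
      using W v unfolding openin_iff by blast
    have "connected_component W v y" if y: "y \<in> S" "d v y < e" for y
    proof -
      have "(e - d v y) / 2 > 0" using y by simp
      then obtain p where p: "continuous_on {0..1::real} p" "p ` {0..1} \<subseteq> S" "p 0 = v" "p 1 = y"
          "\<forall>t\<in>{0..1}. d v (p t) + d (p t) y \<le> d v y + (e - d v y) / 2"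
        using near_geodesic[of v y] v y WS by blast
      have "p t \<in> W" if t: "t \<in> {0..1}" for t
      proof (rule e(2))
        show "p t \<in> S" using p(2) t by blast
        have "d v (p t) + d (p t) y \<le> d v y + (e - d v y) / 2" using p(5) t by blast
        moreover have "0 \<le> d (p t) y" by simp
        ultimately show "d v (p t) < e" using y(2) by argo
      qed
      then have "p ` {0..1} \<subseteq> W" by blast
      moreover have "connected (p ` {0..1})" by (intro connected_continuous_image p) auto
      moreover have "v \<in> p ` {0..1}" "y \<in> p ` {0..1}" using p(3,4) by force+
      ultimately show ?thesis unfolding connected_component_def by blast
    qed
    then show ?thesis using e(1) by blast
  qed
  show "openin (top_of_set S) (connected_component_set W x)"
    unfolding openin_iff
  proof (intro conjI ballI)
    show "connected_component_set W x \<subseteq> S" using WS connected_component_subset by blast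
    fix v assume v: "v \<in> connected_component_set W x"
    then have "v \<in> W" using connected_component_in by fastforce
    then obtain e where "e > 0" "\<forall>y\<in>S. d v y < e \<longrightarrow> connected_component W v y" using local by blast
    then show "\<exists>e>0. \<forall>y\<in>S. d v y < e \<longrightarrow> y \<in> connected_component_set W x"
      using v connected_component_trans[of W x v] by blast
  qed
  assume p: "p \<in> closure (connected_component_set W x)" "p \<in> W"
  obtain e where e: "e > 0" "\<forall>y\<in>S. d p y < e \<longrightarrow> connected_component W p y" using local p(2) by blast
  obtain y where y: "y \<in> connected_component_set W x" "dist y p < e / \<kappa>"
    using p(1) e(1) \<kappa>_ge_1 unfolding closure_approachable by (meson divide_pos_pos less_le_trans zero_less_one)
  have "y \<in> S" "p \<in> S" using y(1) WS p(2) connected_component_in by fastforce+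
  then have "d p y < e"
    using y(2) d_le_\<kappa>[of p y] \<kappa>_ge_1 by (simp add: dist_commute field_simps)
  then have "connected_component W p y" using e(2) \<open>y \<in> S\<close> by blast
  then show "p \<in> connected_component_set W x"
    using y(1) connected_component_trans connected_component_sym by fastforce
qed

subsection \<open>Comparison with cones\<close>

text \<open>Only nonnegative slopes are admitted. For a negative slope a geodesic from the vertex would have
  to be prolonged beyond \<open>x\<close> until it leaves \<open>W\<close>, but it may come to an end at the boundary of the
  domain.\<close>

definition cone_comparison :: "'a set \<Rightarrow> ('a \<Rightarrow> real) \<Rightarrow> bool" where
  "cone_comparison L u \<longleftrightarrow> (\<forall>W z a b. openin (top_of_set S) W \<and> W \<inter> L = {} \<and> z \<in> S - W \<and> a \<ge> 0 \<and>
     (\<forall>x\<in>closure W - W. u x \<le> b + a * d x z) \<longrightarrow> (\<forall>x\<in>W. u x \<le> b + a * d x z))"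

lemma cone_comparisonD:
  assumes "cone_comparison L u" "openin (top_of_set S) W" "W \<inter> L = {}" "z \<in> S" "z \<notin> W" "a \<ge> 0"
    "\<And>x. x \<in> closure W \<Longrightarrow> x \<notin> W \<Longrightarrow> u x \<le> b + a * d x z" "x \<in> W"
  shows "u x \<le> b + a * d x z"
proof -
  have "\<forall>x\<in>closure W - W. u x \<le> b + a * d x z" using assms(7) by blast
  then show ?thesis using assms unfolding cone_comparison_def by blast
qed

text \<open>On a component \<open>V\<close> of the set where \<open>u\<close> exceeds the cone, \<open>u\<close> agrees with the cone on the
  frontier and hence has Lipschitz constant \<open>a\<close> on \<open>V\<close>. Walking from a point of \<open>V\<close> towards the
  vertex, which lies outside, one leaves \<open>V\<close> at a frontier point, and along the way \<open>u\<close> cannot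
  fall faster than the cone does.\<close>

lemma cone_comparison_if_minimizing:
  assumes u: "continuous_on S u"
    and min: "\<And>V K. V \<subseteq> S - L \<Longrightarrow> openin (top_of_set S) V \<Longrightarrow> connected V \<Longrightarrow> K \<ge> 0 \<Longrightarrow>
      (\<And>x y. x \<in> closure V - V \<Longrightarrow> y \<in> closure V - V \<Longrightarrow> \<bar>u x - u y\<bar> \<le> K * d x y) \<Longrightarrow>
      (\<And>x y. x \<in> closure V \<Longrightarrow> y \<in> closure V \<Longrightarrow> \<bar>u x - u y\<bar> \<le> K * d x y)"
  shows "cone_comparison L u"
  unfolding cone_comparison_def
proof (intro allI impI ballI, elim conjE)
  fix W z a b x
  assume W: "openin (top_of_set S) W" "W \<inter> L = {}" "z \<in> S - W" "a \<ge> 0"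
    and bd: "\<forall>x\<in>closure W - W. u x \<le> b + a * d x z" and "x \<in> W"
  have WS: "W \<subseteq> S" using openin_subset[OF W(1)] by simp
  let ?c = "\<lambda>x. b + a * d x z"
  show "u x \<le> ?c x"
  proof (rule ccontr)
    assume "\<not> u x \<le> ?c x"
    have contD: "continuous_on S (\<lambda>x. d x z)"
      using continuous_on_d[of z] W(3) by (simp add: commute[of _ z])
    have cont: "continuous_on S (\<lambda>x. u x - ?c x)"
      by (intro continuous_intros u contD)
    define W0 where "W0 = {x \<in> W. u x > ?c x}"
    have "openin (top_of_set S) (S \<inter> (\<lambda>x. u x - ?c x) -` {0<..})"
      using cont by (rule continuous_openin_preimage_gen) auto
    moreover have "W0 = W \<inter> (S \<inter> (\<lambda>x. u x - ?c x) -` {0<..})" using WS by (auto simp: W0_def)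
    ultimately have W0: "openin (top_of_set S) W0" using W(1) by (simp add: openin_Int)
    define V where "V = connected_component_set W0 x"
    have "x \<in> W0" using \<open>x \<in> W\<close> \<open>\<not> u x \<le> ?c x\<close> by (simp add: W0_def)
    then have xV: "x \<in> V" by (simp add: V_def)
    have V: "openin (top_of_set S) V" "\<And>p. p \<in> closure V \<Longrightarrow> p \<in> W0 \<Longrightarrow> p \<in> V" "connected V"
      unfolding V_def using component_openin[OF W0] by auto
    have VW: "V \<subseteq> W0" unfolding V_def by (rule connected_component_subset)
    have VS: "V \<subseteq> S" using VW WS by (auto simp: W0_def)
    have eq: "u p = ?c p" if p: "p \<in> closure V" "p \<notin> V" for p
    proof (rule antisym)
      have "p \<notin> W0" using V(2) p by blast
      moreover have "p \<in> closure W" using p(1) VW closure_mono[of V W] by (auto simp: W0_def)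
      ultimately show "u p \<le> ?c p" using bd by (auto simp: W0_def)
      have "closure V \<subseteq> S" using VS by (rule closure_subset_S)
      then have "continuous_on (closure V) (\<lambda>x. u x - ?c x)" using cont continuous_on_subset by blast
      moreover have "\<And>x. x \<in> V \<Longrightarrow> u x - ?c x \<ge> 0" using VW by (auto simp: W0_def)
      ultimately have "u p - ?c p \<ge> 0" using p(1) continuous_ge_on_closure[of V "\<lambda>x. u x - ?c x" p 0] by blast
      then show "?c p \<le> u p" by simp
    qed
    have lip: "\<bar>u x - u y\<bar> \<le> a * d x y" if "x \<in> closure V" "y \<in> closure V" for x y
    proof (rule min[OF _ V(1,3) W(4) _ that])
      show "V \<subseteq> S - L" using VS VW W(2) by (auto simp: W0_def)
      fix p q assume pq: "p \<in> closure V - V" "q \<in> closure V - V"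
      then have S: "p \<in> S" "q \<in> S" "z \<in> S" using closure_subset_S[OF VS] W(3) by auto
      have "u p - u q = a * (d p z - d q z)" using eq pq by (auto simp: algebra_simps)
      then have "\<bar>u p - u q\<bar> = a * \<bar>d p z - d q z\<bar>" using W(4) by (simp add: abs_mult)
      also have "\<dots> \<le> a * d p q"
        using triangle[OF S] triangle[OF S(2,1,3)] commute[of p q] W(4)
        by (intro mult_left_mono) (auto simp: abs_le_iff)
      finally show "\<bar>u p - u q\<bar> \<le> a * d p q" .
    qed
    have "u x \<le> ?c x + e" if "e > 0" for e
    proof -
      have "z \<notin> V" "z \<in> S" using W(3) VW by (auto simp: W0_def)
      moreover have "e / (a + 1) > 0" using W(4) \<open>e > 0\<close> by simp
      ultimately obtain y where y: "y \<in> closure V - V" "d x y + d y z \<le> d x z + e / (a + 1)"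
        using exit_point[OF V(1) xV] by blast
      have "x \<in> closure V" using xV closure_subset by blast
      then have "u x \<le> ?c y + a * d x y" using lip[of x y] eq[of y] y(1) by force
      also have "\<dots> = b + a * (d x y + d y z)" by (simp add: algebra_simps)
      also have "\<dots> \<le> b + a * (d x z + e / (a + 1))" using y(2) W(4) by (intro add_left_mono mult_left_mono)
      also have "\<dots> \<le> ?c x + e" using W(4) \<open>e > 0\<close> by (simp add: field_simps)
      finally show ?thesis .
    qed
    then have "u x \<le> ?c x" by (rule field_le_epsilon)
    then show False using \<open>\<not> u x \<le> ?c x\<close> by simp
  qed
qed

text \<open>Cones with vertices at the labels bound the difference between a point and a label. With this
  bound, cones with an arbitrary vertex \<open>y\<close> can be compared outside the labels and \<open>y\<close>.\<close>

lemma lipschitz_if_cone_comparison: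
  assumes cc: "cone_comparison L u" "cone_comparison L (\<lambda>x. - u x)"
    and L: "closed L" "L \<subseteq> S" and "\<Lambda> \<ge> 0"
    and g: "\<And>x y. x \<in> L \<Longrightarrow> y \<in> L \<Longrightarrow> \<bar>u x - u y\<bar> \<le> \<Lambda> * d x y"
    and xy: "x \<in> S" "y \<in> S"
  shows "\<bar>u x - u y\<bar> \<le> \<Lambda> * d x y"
proof -
  have op: "openin (top_of_set S) (S - F)" if "closed F" for F
    using that by (simp add: Diff_eq openin_open_Int open_Compl)
  have one: "f x \<le> f z + \<Lambda> * d x z"
    if f: "cone_comparison L f" "\<And>x y. x \<in> L \<Longrightarrow> y \<in> L \<Longrightarrow> f x - f y \<le> \<Lambda> * d x y"
      and "x \<in> S" "z \<in> L" for f x z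
  proof (cases "x \<in> L")
    case True
    then show ?thesis using f(2)[OF True that(4)] by linarith
  next
    case False
    show ?thesis
    proof (rule cone_comparisonD[OF f(1) op[OF L(1)]])
      fix y assume "y \<in> closure (S - L)" "y \<notin> S - L"
      then have "y \<in> L" using closure_subset_S[of "S - L"] by blast
      then show "f y \<le> f z + \<Lambda> * d y z" using f(2)[OF _ that(4), of y] by linarith
    qed (use that False L \<open>\<Lambda> \<ge> 0\<close> in auto)
  qed
  have half: "f x \<le> f y + \<Lambda> * d x y"
    if f: "cone_comparison L f" "cone_comparison L (\<lambda>x. - f x)"
      "\<And>x y. x \<in> L \<Longrightarrow> y \<in> L \<Longrightarrow> f x - f y \<le> \<Lambda> * d x y" and "x \<in> S" "y \<in> S" for f x y
  proof (cases "x \<in> L \<or> x = y")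
    case True
    have "- f y \<le> - f x + \<Lambda> * d y x" if "x \<in> L"
      by (rule one[OF f(2)]) (use f(3) commute that \<open>y \<in> S\<close> in \<open>fastforce+\<close>)
    then show ?thesis using True commute[of x y] d_self \<open>y \<in> S\<close> by auto
  next
    case False
    show ?thesis
    proof (rule cone_comparisonD[OF f(1) op[of "insert y L"]])
      fix p assume "p \<in> closure (S - insert y L)" "p \<notin> S - insert y L"
      then have p: "p = y \<or> p \<in> L" "p \<in> S" using closure_subset_S[of "S - insert y L"] by auto
      have "- f y \<le> - f p + \<Lambda> * d y p" if "p \<in> L"
        by (rule one[OF f(2)]) (use f(3) commute that \<open>y \<in> S\<close> in \<open>fastforce+\<close>)
      then show "f p \<le> f y + \<Lambda> * d p y" using p commute[of p y] d_self \<open>y \<in> S\<close> by auto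
    qed (use that False L \<open>\<Lambda> \<ge> 0\<close> in auto)
  qed
  have g': "u x - u y \<le> \<Lambda> * d x y" "- u x - - u y \<le> \<Lambda> * d x y" if "x \<in> L" "y \<in> L" for x y
    using g[OF that] by auto
  have "u x \<le> u y + \<Lambda> * d x y" by (rule half[OF cc g'(1) xy])
  moreover have "u y \<le> u x + \<Lambda> * d y x" by (rule half[OF cc g'(1) xy(2,1)])
  ultimately show ?thesis using commute[of x y] by (simp add: abs_le_iff)
qed

end

section \<open>Comparison at a fixed step size\<close>

text \<open>The second difference of the square equals \<open>a\<^sup>2 + b\<^sup>2 - 2 * X * (b - a)\<close>: the first term is the
  gain, and the excess of \<open>b\<close> over \<open>a\<close> only costs a multiple of \<open>\<eta>\<close>.\<close>

lemma convex_gain: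
  fixes X :: real
  assumes "a \<ge> s" "s \<ge> 0" "b \<le> a + \<eta>" "X \<ge> 0" "X \<le> Q" "\<eta> \<ge> 0" "\<beta> \<ge> 0"
  shows "(a - b) + \<beta> * ((X + a)\<^sup>2 + (X - b)\<^sup>2 - 2 * X\<^sup>2) \<ge> \<beta> * s\<^sup>2 - (1 + 2 * \<beta> * Q) * \<eta>"
proof -
  have "X * (b - a) \<le> X * \<eta>" using assms by (intro mult_left_mono) auto
  also have "\<dots> \<le> Q * \<eta>" using assms by (intro mult_right_mono) auto
  finally have "X * (b - a) \<le> Q * \<eta>" .
  moreover have "s\<^sup>2 \<le> a\<^sup>2" using assms by (intro power_mono) auto
  moreover have "0 \<le> b\<^sup>2" by simp
  moreover have "(X + a)\<^sup>2 + (X - b)\<^sup>2 - 2 * X\<^sup>2 = a\<^sup>2 + b\<^sup>2 - 2 * (X * (b - a))"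
    by (simp add: power2_eq_square algebra_simps)
  ultimately have "s\<^sup>2 - 2 * (Q * \<eta>) \<le> (X + a)\<^sup>2 + (X - b)\<^sup>2 - 2 * X\<^sup>2" by linarith
  then have "\<beta> * (s\<^sup>2 - 2 * (Q * \<eta>)) \<le> \<beta> * ((X + a)\<^sup>2 + (X - b)\<^sup>2 - 2 * X\<^sup>2)"
    using assms by (intro mult_left_mono) auto
  then show ?thesis using assms(3) by (simp add: algebra_simps)
qed

inductive descent_chain :: "('a \<Rightarrow> 'a \<Rightarrow> bool) \<Rightarrow> 'a set \<Rightarrow> nat \<Rightarrow> 'a \<Rightarrow> 'a \<Rightarrow> bool"
  for near :: "'a \<Rightarrow> 'a \<Rightarrow> bool" and V :: "'a set" where
  stop: "x \<notin> V \<Longrightarrow> descent_chain near V 0 x x"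
| step: "x \<in> V \<Longrightarrow> near x w \<Longrightarrow> descent_chain near V k w y \<Longrightarrow> descent_chain near V (Suc k) x y"

text \<open>Let \<open>V\<close> consist of the points of \<open>I\<close> where \<open>q\<close> gains less than \<open>t\<close> in one step. In \<open>V\<close> the
  function is replaced by the solution of an eikonal equation with slope \<open>t\<close> and boundary values
  \<open>q\<close>: the best value \<open>q y - k t\<close> over walks of \<open>k\<close> steps inside \<open>V\<close> that leave it at \<open>y\<close>. It
  gains \<open>t\<close> in the first step of the best walk and loses at most \<open>t\<close> in any step. Because \<open>q\<close> is
  subharmonic, it falls by at most \<open>t\<close> per step in \<open>V\<close>; so \<open>U\<close> does not exceed \<open>q\<close>, and it falls
  below \<open>q\<close> by at most \<open>2 t\<close> per step of a walk out of \<open>I\<close>. The suprema need not be attained,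
  which is why \<open>\<eta>\<close> appears.\<close>

lemma slope_patching:
  fixes near :: "'a \<Rightarrow> 'a \<Rightarrow> bool" and q :: "'a \<Rightarrow> real"
  assumes near_sym: "\<And>x w. x \<in> S \<Longrightarrow> near x w \<Longrightarrow> w \<in> S \<and> near w x"
    and I: "I \<subseteq> S" and t: "t > 0" and \<eta>: "\<eta> > 0"
    and q: "\<And>x. x \<in> I \<Longrightarrow> \<exists>w. near x w \<and> (\<forall>w'. near x w' \<longrightarrow> q w' \<le> q w \<and> 2 * q x \<le> q w + q w')"
    and reach: "\<And>x. x \<in> S \<Longrightarrow> \<exists>z p. (\<forall>i<N. near (p i) (p (Suc i))) \<and> p 0 = x \<and> p N = z \<and> z \<notin> I"
  obtains U where "\<And>x. x \<in> S \<Longrightarrow> U x \<le> q x" "\<And>x. x \<in> S \<Longrightarrow> q x - 2 * real N * t \<le> U x"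
    "\<And>x. x \<in> I \<Longrightarrow> \<exists>w. near x w \<and> U x + t - \<eta> \<le> U w \<and>
      (\<forall>w'. near x w' \<longrightarrow> 2 * U x - \<eta> \<le> U w + U w')"
proof -
  define V where "V = {x \<in> I. \<forall>w. near x w \<longrightarrow> q w < q x + t}"
  define A where "A x = {q y - real k * t | k y. descent_chain near V k x y}" for x
  define U where "U x = Sup (A x)" for x
  have VS: "x \<in> S" "x \<in> I" if "x \<in> V" for x using that I by (auto simp: V_def)
  have drop: "q x - t \<le> q w'" if xV: "x \<in> V" and xw': "near x w'" for x w'
  proof -
    obtain w where w: "near x w" "\<And>w'. near x w' \<Longrightarrow> 2 * q x \<le> q w + q w'" using q[OF VS(2)[OF xV]] by meson
    have "q w < q x + t" using w(1) xV by (auto simp: V_def)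
    then show ?thesis using w(2)[OF xw'] by linarith
  qed
  have chain_le: "q y - real k * t \<le> q x" if "descent_chain near V k x y" for k x y
    using that
  proof induction
    case (step x w k y)
    then have "q w < q x + t" by (auto simp: V_def)
    then show ?case using step.IH by (simp add: algebra_simps)
  qed simp
  have chain_ex: "\<exists>k y. k \<le> n \<and> descent_chain near V k x y \<and> q x - real k * t \<le> q y"
    if "x \<in> S" "\<forall>i<n. near (p i) (p (Suc i))" "p 0 = x" "p n \<notin> I" for n x and p :: "nat \<Rightarrow> 'a"
    using that
  proof (induction n arbitrary: x p)
    case 0
    then have "x \<notin> V" by (auto simp: V_def)
    then show ?case using descent_chain.stop[of x V near] by (intro exI[of _ 0] exI[of _ x]) auto
  next
    case (Suc n)
    show ?case
    proof (cases "x \<in> V")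
      case False
      then show ?thesis using descent_chain.stop[of x V near] by (intro exI[of _ 0] exI[of _ x]) auto
    next
      case True
      have x1: "near x (p 1)" using Suc.prems(2,3) by auto
      have "\<exists>k y. k \<le> n \<and> descent_chain near V k (p 1) y \<and> q (p 1) - real k * t \<le> q y"
      proof (rule Suc.IH[of "p 1" "\<lambda>i. p (Suc i)"])
        show "p 1 \<in> S" using near_sym[OF Suc.prems(1) x1] by blast
        show "\<forall>i<n. near (p (Suc i)) (p (Suc (Suc i)))" using Suc.prems(2) by simp
        show "p (Suc 0) = p 1" by simp
        show "p (Suc n) \<notin> I" by (rule Suc.prems(4))
      qed
      then obtain k y where ky: "k \<le> n" "descent_chain near V k (p 1) y" "q (p 1) - real k * t \<le> q y"
        by blast
      have "descent_chain near V (Suc k) x y" by (rule descent_chain.step[of x V near "p 1" k y, OF True x1 ky(2)])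
      moreover have "q x - real (Suc k) * t \<le> q y" using drop[OF True x1] ky(3) by (simp add: algebra_simps)
      ultimately show ?thesis using ky(1) by (intro exI[of _ "Suc k"] exI[of _ y]) auto
    qed
  qed
  have ex: "\<exists>k y. k \<le> N \<and> descent_chain near V k x y \<and> q x - real k * t \<le> q y" if x: "x \<in> S" for x
  proof -
    obtain z p where "\<forall>i<N. near (p i) (p (Suc i))" "p 0 = x" "p N = z" "z \<notin> I"
      using reach[OF x] by blast
    then show ?thesis by (intro chain_ex[OF x, where p = p]) auto
  qed
  have A_bdd: "bdd_above (A x)" for x
    by (rule bdd_aboveI[of _ "q x"]) (use chain_le in \<open>auto simp: A_def\<close>)
  have A_ne: "A x \<noteq> {}" if "x \<in> S" for x using ex[OF that] by (auto simp: A_def)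
  have U_upper: "U x \<le> q x" if "x \<in> S" for x
    unfolding U_def by (rule cSup_least[OF A_ne[OF that]]) (use chain_le in \<open>auto simp: A_def\<close>)
  have U_chain: "q y - real k * t \<le> U x" if "descent_chain near V k x y" for x k y
    unfolding U_def by (rule cSup_upper[OF _ A_bdd]) (use that in \<open>auto simp: A_def\<close>)
  have U_out: "U x = q x" if "x \<notin> V" "x \<in> S" for x
    using U_chain[OF descent_chain.stop[OF that(1)]] U_upper[OF that(2)] by simp
  have U_lower: "q x - 2 * real N * t \<le> U x" if x: "x \<in> S" for x
  proof -
    obtain k y where ky: "k \<le> N" "descent_chain near V k x y" "q x - real k * t \<le> q y" using ex[OF x] by blast
    have "real k * t \<le> real N * t" using ky(1) t by (simp add: mult_right_mono)
    then show ?thesis using U_chain[OF ky(2)] ky(3) by linarith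
  qed
  have U_step: "U w - t \<le> U x" if x: "x \<in> V" and w: "near x w" for x w
  proof -
    have "w \<in> S" using near_sym VS x w by blast
    have "U w \<le> U x + t" unfolding U_def[of w]
    proof (rule cSup_least[OF A_ne[OF \<open>w \<in> S\<close>]])
      fix a assume "a \<in> A w"
      then obtain k y where a: "a = q y - real k * t" "descent_chain near V k w y" by (auto simp: A_def)
      have "descent_chain near V (Suc k) x y" by (rule descent_chain.step[of x V near w k y, OF x w a(2)])
      then show "a \<le> U x + t" using U_chain[of "Suc k" x y] a(1) by (simp add: algebra_simps)
    qed
    then show ?thesis by simp
  qed
  have good: "\<exists>w. near x w \<and> U x + t - \<eta> \<le> U w \<and> (\<forall>w'. near x w' \<longrightarrow> 2 * U x - \<eta> \<le> U w + U w')"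
    if x: "x \<in> I" for x
  proof (cases "x \<in> V")
    case True
    have xS: "x \<in> S" using I x by blast
    obtain a where a: "a \<in> A x" "U x - \<eta> < a"
      using less_cSupE[of "U x - \<eta>" "A x"] A_ne[OF xS] \<eta> unfolding U_def by auto
    obtain k y where ky: "a = q y - real k * t" "descent_chain near V k x y"
      using a(1) by (auto simp: A_def)
    from ky(2) obtain w k' where w: "k = Suc k'" "near x w" "descent_chain near V k' w y"
      using True by (cases rule: descent_chain.cases) auto
    have Uw: "U x + t - \<eta> \<le> U w" using U_chain[OF w(3)] a(2) ky(1) w(1) by (simp add: algebra_simps)
    have "U x - t \<le> U w'" if w': "near x w'" for w'
    proof (cases "w' \<in> V")
      case True
      then show ?thesis using U_step[of w' x] near_sym[OF xS w'] by auto
    next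
      case False
      then have "U w' = q w'" using U_out near_sym[OF xS w'] by auto
      then show ?thesis using drop[OF \<open>x \<in> V\<close> w'] U_upper[OF xS] by linarith
    qed
    then show ?thesis using w(2) Uw by fastforce
  next
    case False
    have xS: "x \<in> S" using I x by blast
    obtain w where w: "near x w" "\<And>w'. near x w' \<Longrightarrow> q w' \<le> q w" "\<And>w'. near x w' \<Longrightarrow> 2 * q x \<le> q w + q w'"
      using q[OF x] by blast
    have wS: "w \<in> S" "near w x" using near_sym[OF xS w(1)] by auto
    have gain: "q x + t \<le> q w"
      using False x w(2) by (force simp: V_def not_less)
    \<comment> \<open>the steepest ascent from x does not lose slope, so it leads to another point outside V\<close>
    have "w \<notin> V"
    proof
      assume "w \<in> V"
      obtain w2 where w2: "near w w2" "2 * q w \<le> q w2 + q x"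
        using q[OF VS(2)[OF \<open>w \<in> V\<close>]] wS(2) by blast
      have "q w2 < q w + t" using \<open>w \<in> V\<close> w2(1) by (auto simp: V_def)
      then show False using w2(2) gain by linarith
    qed
    then have "U w = q w" "U x = q x" using U_out wS xS False by auto
    moreover have "2 * q x - \<eta> \<le> q w + U w'" if w': "near x w'" for w'
    proof (cases "w' \<in> V")
      case True
      have "U x - t \<le> U w'" by (rule U_step[OF True]) (use near_sym[OF xS w'] in auto)
      then show ?thesis using gain \<open>U x = q x\<close> \<eta> by linarith
    next
      case False
      then have "U w' = q w'" using U_out near_sym[OF xS w'] by auto
      then show ?thesis using w(3)[OF w'] \<eta> by linarith
    qed
    ultimately show ?thesis using w(1) gain \<eta> by (intro exI[of _ w]) auto
  qed
  show thesis by (rule that[OF U_upper U_lower good])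
qed

text \<open>Close to a maximum of \<open>U - W\<close>, the best ascent \<open>w1\<close> for \<open>U\<close> and the best descent \<open>w2\<close> for \<open>W\<close>
  are played against each other: both inequalities are evaluated at the pair \<open>w1\<close>, \<open>w2\<close>, and their
  difference says that \<open>U - W\<close> is larger by a fixed amount at one of these points.\<close>

lemma step_comparison_principle:
  fixes U W :: "'a \<Rightarrow> real"
  assumes U: "\<And>x. x \<in> I \<Longrightarrow> \<exists>w\<in>S. near x w \<and> (\<forall>w'\<in>S. near x w' \<longrightarrow> 2 * U x + a \<le> U w + U w')"
    and W: "\<And>x. x \<in> I \<Longrightarrow> \<exists>w\<in>S. near x w \<and> (\<forall>w'\<in>S. near x w' \<longrightarrow> W w + W w' \<le> 2 * W x + a')"
    and "a' < a" and bounded: "\<And>x. x \<in> S \<Longrightarrow> U x - W x \<le> Q"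
    and boundary: "\<And>x. x \<in> S - I \<Longrightarrow> U x - W x \<le> b" and "x \<in> S"
  shows "U x - W x \<le> b"
proof (rule ccontr)
  assume "\<not> U x - W x \<le> b"
  define s where "s = (SUP x\<in>S. U x - W x)"
  have bdd: "bdd_above ((\<lambda>x. U x - W x) ` S)" using bounded by (intro bdd_aboveI2)
  have le_s: "U x - W x \<le> s" if "x \<in> S" for x unfolding s_def by (rule cSUP_upper[OF that bdd])
  have "s > b" using le_s[OF \<open>x \<in> S\<close>] \<open>\<not> U x - W x \<le> b\<close> by linarith
  then have "max b (s - (a - a') / 3) < s" using \<open>a' < a\<close> by simp
  then obtain y where y: "y \<in> S" "max b (s - (a - a') / 3) < U y - W y"
    using less_cSUP_iff[OF _ bdd] \<open>x \<in> S\<close> unfolding s_def by blast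
  then have "y \<in> I" using boundary[of y] by force
  obtain w1 where w1: "w1 \<in> S" "near y w1" "\<And>w'. w' \<in> S \<Longrightarrow> near y w' \<Longrightarrow> 2 * U y + a \<le> U w1 + U w'"
    using U[OF \<open>y \<in> I\<close>] by blast
  obtain w2 where w2: "w2 \<in> S" "near y w2" "\<And>w'. w' \<in> S \<Longrightarrow> near y w' \<Longrightarrow> W w2 + W w' \<le> 2 * W y + a'"
    using W[OF \<open>y \<in> I\<close>] by blast
  have "2 * U y + a \<le> U w1 + U w2" "W w2 + W w1 \<le> 2 * W y + a'"
    using w1(3)[OF w2(1,2)] w2(3)[OF w1(1,2)] by auto
  moreover have "s - (a - a') / 3 < U y - W y" using y(2) by simp
  then have "3 * s - (a - a') < 3 * (U y - W y)" by (simp add: field_simps)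
  ultimately show False using le_s[OF w1(1)] le_s[OF w2(1)] \<open>a' < a\<close> by argo
qed

context intrinsic_domain
begin

definition ball_sup :: "('a \<Rightarrow> real) \<Rightarrow> real \<Rightarrow> 'a \<Rightarrow> real" where
  "ball_sup f e x = Sup (f ` {y \<in> S. d x y \<le> e})"

text \<open>This covers continuous functions as well as functions with finitely many values, such as the
  piecewise constant extension of a function on a point cloud.\<close>

definition attains_sup :: "('a \<Rightarrow> real) \<Rightarrow> bool" where
  "attains_sup f \<longleftrightarrow> (\<forall>x\<in>S. \<forall>e\<ge>0. \<exists>y\<in>S. d x y \<le> e \<and> (\<forall>z\<in>S. d x z \<le> e \<longrightarrow> f z \<le> f y))"

lemma attains_sup_continuous:
  assumes "continuous_on S f" shows "attains_sup f"
  unfolding attains_sup_def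
proof (intro ballI allI impI)
  fix x and e :: real assume x: "x \<in> S" "e \<ge> 0"
  define K where "K = S \<inter> d x -` {..e}"
  have "closed K"
    unfolding K_def using continuous_closed_preimage[OF continuous_on_d[OF x(1)], of "{..e}"] compact_S
    by (simp add: compact_imp_closed)
  then have "compact (S \<inter> K)" using compact_S by (rule compact_Int_closed[rotated])
  moreover have "S \<inter> K = K" by (auto simp: K_def)
  ultimately have "compact K" by simp
  moreover have "x \<in> K" using x d_self by (simp add: K_def)
  moreover have "continuous_on K f" using assms by (rule continuous_on_subset) (auto simp: K_def)
  ultimately obtain y where "y \<in> K" "\<forall>z\<in>K. f z \<le> f y"
    using continuous_attains_sup[of K f] by blast
  then show "\<exists>y\<in>S. d x y \<le> e \<and> (\<forall>z\<in>S. d x z \<le> e \<longrightarrow> f z \<le> f y)" by (auto simp: K_def)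
qed

lemma attains_sup_finite:
  assumes "finite (f ` S)" shows "attains_sup f"
  unfolding attains_sup_def
proof (intro ballI allI impI)
  fix x and e :: real assume x: "x \<in> S" "e \<ge> 0"
  define K where "K = {y \<in> S. d x y \<le> e}"
  have "finite (f ` K)" using assms by (rule finite_subset[rotated]) (auto simp: K_def)
  moreover have "x \<in> K" using x d_self by (simp add: K_def)
  then have "f ` K \<noteq> {}" by blast
  ultimately have "Max (f ` K) \<in> f ` K" "\<forall>z\<in>K. f z \<le> Max (f ` K)"
    by (blast intro: Max_in Max_ge)+
  then show "\<exists>y\<in>S. d x y \<le> e \<and> (\<forall>z\<in>S. d x z \<le> e \<longrightarrow> f z \<le> f y)"
    by (force simp: K_def)
qed

lemma
  assumes f: "attains_sup f" and x: "x \<in> S" and e: "e \<ge> 0"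
  shows ball_sup_attained: "\<exists>y\<in>S. d x y \<le> e \<and> f y = ball_sup f e x"
    and ball_sup_upper: "\<And>z. z \<in> S \<Longrightarrow> d x z \<le> e \<Longrightarrow> f z \<le> ball_sup f e x"
proof -
  obtain y where y: "y \<in> S" "d x y \<le> e" "\<And>z. z \<in> S \<Longrightarrow> d x z \<le> e \<Longrightarrow> f z \<le> f y"
    using f x e unfolding attains_sup_def by meson
  have eq: "ball_sup f e x = f y"
    unfolding ball_sup_def by (rule cSup_eq_maximum) (use y in auto)
  show "\<exists>y\<in>S. d x y \<le> e \<and> f y = ball_sup f e x" using y eq by auto
  show "f z \<le> ball_sup f e x" if "z \<in> S" "d x z \<le> e" for z using y(3)[OF that] eq by simp
qed

lemma ball_sup_centre: "attains_sup f \<Longrightarrow> x \<in> S \<Longrightarrow> e \<ge> 0 \<Longrightarrow> f x \<le> ball_sup f e x"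
  using ball_sup_upper d_self by auto

lemma ball_sup_le:
  assumes f: "attains_sup f" "x \<in> S" "e \<ge> 0" and b: "\<And>y. y \<in> S \<Longrightarrow> d x y \<le> e \<Longrightarrow> f y \<le> b"
  shows "ball_sup f e x \<le> b"
proof -
  obtain y where "y \<in> S" "d x y \<le> e" "f y = ball_sup f e x" using ball_sup_attained[OF f] by blast
  then show ?thesis using b[of y] by simp
qed

text \<open>Midpoints make the supremum over a ball a semigroup in the radius, so that a bound by half of
  the doubled ball becomes a subharmonicity inequality at step size \<open>e\<close>.\<close>

lemma ball_sup_subharmonic:
  assumes f: "attains_sup f" and x: "x \<in> S" and e: "e \<ge> 0"
    and half: "2 * ball_sup f e x \<le> f x + ball_sup f (2 * e) x + a"
  shows "\<exists>w\<in>S. d x w \<le> e \<and> ball_sup f e w = ball_sup f (2 * e) x \<and>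
    (\<forall>w'\<in>S. d x w' \<le> e \<longrightarrow> ball_sup f e w' \<le> ball_sup f e w \<and>
      2 * ball_sup f e x - a \<le> ball_sup f e w + ball_sup f e w')"
proof -
  have e2: "2 * e \<ge> 0" using e by simp
  obtain y where y: "y \<in> S" "d x y \<le> 2 * e" "f y = ball_sup f (2 * e) x"
    using ball_sup_attained[OF f x e2] by blast
  obtain w where w: "w \<in> S" "d x w \<le> e" "d w y \<le> e"
    using between_point[OF x y(1) e e] y(2) by auto
  have le: "ball_sup f e w' \<le> ball_sup f (2 * e) x" if w': "w' \<in> S" "d x w' \<le> e" for w'
  proof (rule ball_sup_le[OF f w'(1) e])
    fix z assume z: "z \<in> S" "d w' z \<le> e"
    have "d x z \<le> 2 * e" using triangle[OF x w'(1) z(1)] w' z by linarith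
    then show "f z \<le> ball_sup f (2 * e) x" by (rule ball_sup_upper[OF f x e2 z(1)])
  qed
  have ge: "f x \<le> ball_sup f e w'" if w': "w' \<in> S" "d x w' \<le> e" for w'
    by (rule ball_sup_upper[OF f w'(1) e x]) (use w'(2) commute[of x w'] in simp)
  have eq: "ball_sup f e w = ball_sup f (2 * e) x"
    using ball_sup_upper[OF f w(1) e y(1) w(3)] y(3) le[OF w(1,2)] by simp
  show ?thesis
  proof (intro bexI[of _ w] conjI ballI impI)
    fix w' assume w': "w' \<in> S" "d x w' \<le> e"
    show "ball_sup f e w' \<le> ball_sup f e w" using le[OF w'] eq by simp
    show "2 * ball_sup f e x - a \<le> ball_sup f e w + ball_sup f e w'"
      using ge[OF w'] eq half by linarith
  qed (use w eq in auto)
qed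

text \<open>The cone with vertex \<open>x\<close> that starts from the value \<open>u x\<close> and reaches the supremum at distance
  \<open>\<rho>\<close> dominates \<open>u\<close> at the centre and on the sphere, hence in between.\<close>

lemma cone_in_ball:
  assumes cc: "cone_comparison L u" and u: "continuous_on S u" and x: "x \<in> S" and "\<rho> > 0"
    and L: "\<And>z. z \<in> L \<Longrightarrow> \<rho> \<le> d x z" and y: "y \<in> S" "d x y \<le> \<rho>"
  shows "u y \<le> u x + (ball_sup u \<rho> x - u x) / \<rho> * d x y"
proof -
  define m where "m = ball_sup u \<rho> x"
  define a where "a = (m - u x) / \<rho>"
  have as: "attains_sup u" using u by (rule attains_sup_continuous)
  have m: "u z \<le> m" if "z \<in> S" "d x z \<le> \<rho>" for z
    unfolding m_def using ball_sup_upper[OF as x _ that] \<open>\<rho> > 0\<close> by simp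
  have "a \<ge> 0" using m[OF x] d_self[OF x] \<open>\<rho> > 0\<close> by (simp add: a_def)
  have a\<rho>: "u x + a * \<rho> = m" using \<open>\<rho> > 0\<close> by (simp add: a_def)
  define W where "W = S \<inter> d x -` {0<..<\<rho>}"
  have W: "openin (top_of_set S) W"
    unfolding W_def by (rule continuous_openin_preimage_gen[OF continuous_on_d[OF x]]) simp
  have sphere: "u z \<le> u x + a * d z x" if "z \<in> S" "d x z = 0 \<or> d x z = \<rho>" for z
    using that(2)
  proof
    assume "d x z = 0"
    then have "z = x" using zero[OF x that(1)] by simp
    then show ?thesis using d_self[OF x] by simp
  next
    assume "d x z = \<rho>"
    then show ?thesis using m[OF that(1)] a\<rho> commute[of z x] by simp
  qed
  show ?thesis
  proof (cases "y \<in> W")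
    case True
    have "u y \<le> u x + a * d y x"
    proof (rule cone_comparisonD[OF cc W _ x _ \<open>a \<ge> 0\<close> _ True])
      show "W \<inter> L = {}" using L by (force simp: W_def)
      show "x \<notin> W" using d_self[OF x] by (simp add: W_def)
      fix z assume z: "z \<in> closure W" "z \<notin> W"
      have zS: "z \<in> S" using z(1) closure_subset_S[of W] by (auto simp: W_def)
      have "closed (S \<inter> d x -` {..\<rho>})"
        using continuous_closed_preimage[OF continuous_on_d[OF x], of "{..\<rho>}"] compact_S
        by (simp add: compact_imp_closed)
      moreover have "W \<subseteq> S \<inter> d x -` {..\<rho>}" by (auto simp: W_def)
      ultimately have "d x z \<le> \<rho>" using z(1) closure_minimal by blast
      moreover have "\<not> (0 < d x z \<and> d x z < \<rho>)" using z(2) zS by (simp add: W_def)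
      ultimately have "d x z = 0 \<or> d x z = \<rho>" using nonneg[of x z] by linarith
      then show "u z \<le> u x + a * d z x" by (rule sphere[OF zS])
    qed
    then show ?thesis using commute[of x y] by (simp add: a_def m_def)
  next
    case False
    then have "\<not> (0 < d x y \<and> d x y < \<rho>)" using y(1) by (simp add: W_def)
    then have "d x y = 0 \<or> d x y = \<rho>" using y(2) nonneg[of x y] by linarith
    then show ?thesis using sphere[OF y(1)] commute[of x y] by (simp add: a_def m_def)
  qed
qed

lemma ball_sup_doubling:
  assumes cc: "cone_comparison L u" and u: "continuous_on S u" and x: "x \<in> S" and "e > 0"
    and L: "\<And>z. z \<in> L \<Longrightarrow> 2 * e \<le> d x z"
  shows "2 * ball_sup u e x \<le> u x + ball_sup u (2 * e) x"
proof -
  have as: "attains_sup u" using u by (rule attains_sup_continuous)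
  define m where "m = ball_sup u (2 * e) x"
  have "ball_sup u e x \<le> (u x + m) / 2"
  proof (rule ball_sup_le[OF as x])
    fix y assume y: "y \<in> S" "d x y \<le> e"
    have "u y \<le> u x + (m - u x) / (2 * e) * d x y"
      unfolding m_def using y L \<open>e > 0\<close> by (intro cone_in_ball[OF cc u x]) auto
    also have "(m - u x) / (2 * e) * d x y \<le> (m - u x) / (2 * e) * e"
      using ball_sup_centre[OF as x, of "2 * e"] \<open>e > 0\<close> y by (intro mult_left_mono) (auto simp: m_def)
    also have "u x + (m - u x) / (2 * e) * e = (u x + m) / 2" using \<open>e > 0\<close> by (simp add: field_simps)
    finally show "u y \<le> (u x + m) / 2" by simp
  qed (use \<open>e > 0\<close> in simp)
  then show ?thesis by (simp add: m_def)
qed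

end

section \<open>The weighted graph\<close>

lemma kernel_facts:
  assumes "kernel_assumption \<eta> t0"
  shows kernel_support: "t > 1 \<Longrightarrow> \<eta> t = 0"
    and kernel_bound: "t > 0 \<Longrightarrow> t * \<eta> t \<le> \<sigma>_eta \<eta>"
    and kernel_peak: "0 < t \<Longrightarrow> t \<le> t0 \<Longrightarrow> \<sigma>_eta \<eta> / t0 \<le> \<eta> t"
    and kernel_nonneg: "t > 0 \<Longrightarrow> \<eta> t \<ge> 0"
    and kernel_pos: "\<sigma>_eta \<eta> > 0" "t0 > 0" "t0 \<le> 1"
proof -
  have k: "\<forall>t>0. \<eta> t \<ge> 0" "antimono_on {0<..} \<eta>" "closure {t. t > 0 \<and> \<eta> t \<noteq> 0} \<subseteq> {0..1}"
     "bdd_above ((\<lambda>t. t * \<eta> t) ` {0<..})" "\<sigma>_eta \<eta> > 0" "t0 \<in> {0<..1}" "\<sigma>_eta \<eta> = t0 * \<eta> t0"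
    using assms by (auto simp: kernel_assumption_def)
  show "\<eta> t = 0" if "t > 1"
  proof (rule ccontr)
    assume "\<eta> t \<noteq> 0"
    then have "t \<in> {t. t > 0 \<and> \<eta> t \<noteq> 0}" using that by simp
    then have "t \<in> {0..1}" by (rule subsetD[OF k(3) subsetD[OF closure_subset]])
    then show False using that by simp
  qed
  show "t * \<eta> t \<le> \<sigma>_eta \<eta>" if "t > 0"
    unfolding \<sigma>_eta_def using that k(4) by (intro cSUP_upper) auto
  show "\<sigma>_eta \<eta> / t0 \<le> \<eta> t" if "0 < t" "t \<le> t0"
  proof -
    have "\<eta> t0 \<le> \<eta> t" using k(2,6) that by (auto simp: monotone_on_def)
    then show ?thesis using k(6,7) by simp
  qed
qed (use assms in \<open>auto simp: kernel_assumption_def\<close>)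

lemma scaled_kernel_facts:
  assumes \<eta>: "kernel_assumption \<eta> t0" and "h > 0" "s > 0"
  shows scaled_kernel_support: "\<eta>_scaled \<eta> h s > 0 \<Longrightarrow> s \<le> h"
    and scaled_kernel_bound: "\<eta>_scaled \<eta> h s > 0 \<Longrightarrow> s \<le> 1 / \<eta>_scaled \<eta> h s"
    and scaled_kernel_peak: "s \<le> t0 * h \<Longrightarrow> \<eta>_scaled \<eta> h s > 0 \<and> 1 / \<eta>_scaled \<eta> h s \<le> t0 * h"
    and scaled_kernel_nonneg: "\<eta>_scaled \<eta> h s \<ge> 0"
proof -
  note pos = kernel_pos[OF \<eta>]
  have sh: "s / h > 0" using assms by simp
  show "s \<le> h" if "\<eta>_scaled \<eta> h s > 0"
  proof (rule ccontr)
    assume "\<not> s \<le> h"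
    then have "\<eta> (s / h) = 0" using kernel_support[OF \<eta>, of "s / h"] \<open>h > 0\<close> by simp
    then show False using that by (simp add: \<eta>_scaled_def)
  qed
  have "s / h * \<eta> (s / h) \<le> \<sigma>_eta \<eta>" by (rule kernel_bound[OF \<eta> sh])
  then have "s * \<eta>_scaled \<eta> h s \<le> 1"
    using pos \<open>h > 0\<close> by (simp add: \<eta>_scaled_def field_simps)
  then show "s \<le> 1 / \<eta>_scaled \<eta> h s" if "\<eta>_scaled \<eta> h s > 0"
    using that by (simp add: field_simps)
  show "\<eta>_scaled \<eta> h s \<ge> 0"
    using kernel_nonneg[OF \<eta> sh] pos \<open>h > 0\<close> by (simp add: \<eta>_scaled_def)
  assume "s \<le> t0 * h"
  then have "s / h \<le> t0" using \<open>h > 0\<close> by (simp add: field_simps)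
  then have "\<sigma>_eta \<eta> / t0 \<le> \<eta> (s / h)" by (rule kernel_peak[OF \<eta> sh])
  then have "\<sigma>_eta \<eta> / t0 / (\<sigma>_eta \<eta> * h) \<le> \<eta>_scaled \<eta> h s"
    unfolding \<eta>_scaled_def using pos \<open>h > 0\<close> by (intro divide_right_mono) auto
  then have le: "1 / (t0 * h) \<le> \<eta>_scaled \<eta> h s" using pos by (simp add: field_simps)
  moreover have "0 < 1 / (t0 * h)" using pos \<open>h > 0\<close> by simp
  ultimately have "\<eta>_scaled \<eta> h s > 0" by linarith
  then show "\<eta>_scaled \<eta> h s > 0 \<and> 1 / \<eta>_scaled \<eta> h s \<le> t0 * h"
    using le pos \<open>h > 0\<close> by (simp add: field_simps)
qed

abbreviation path_cost :: "(real \<Rightarrow> real) \<Rightarrow> real \<Rightarrow> (nat \<Rightarrow> 'a::euclidean_space) \<Rightarrow> nat \<Rightarrow> ennreal" where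
  "path_cost \<eta> h p N \<equiv> \<Sum>i=1..N. inverse (ennreal (graph_weight \<eta> h (p (i - 1)) (p i)))"

lemma graph_dist_le_path:
  assumes "p ` {0..N} \<subseteq> X" "p 0 = x" "p N = y"
  shows "graph_dist \<eta> h X x y \<le> path_cost \<eta> h p N"
proof (cases "x = y")
  case False
  then have "graph_dist \<eta> h X x y = Inf {path_cost \<eta> h p N | p N. p ` {0..N} \<subseteq> X \<and> p 0 = x \<and> p N = y}"
    by (simp add: graph_dist_def)
  also have "\<dots> \<le> path_cost \<eta> h p N" by (rule Inf_lower) (use assms in blast)
  finally show ?thesis .
qed (simp add: graph_dist_def)

lemma graph_dist_greatest:
  assumes "x \<in> X" "\<And>p N. p ` {0..N} \<subseteq> X \<Longrightarrow> p 0 = x \<Longrightarrow> p N = y \<Longrightarrow> c \<le> path_cost \<eta> h p N"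
  shows "c \<le> graph_dist \<eta> h X x y"
proof (cases "x = y")
  case True
  then show ?thesis using assms(2)[of "\<lambda>_. x" 0] assms(1) by (simp add: graph_dist_def)
next
  case False
  then have "graph_dist \<eta> h X x y = Inf {path_cost \<eta> h p N | p N. p ` {0..N} \<subseteq> X \<and> p 0 = x \<and> p N = y}"
    by (simp add: graph_dist_def)
  moreover have "c \<le> \<dots>" by (rule Inf_greatest) (use assms(2) in blast)
  ultimately show ?thesis by simp
qed

lemma graph_weight_sym: "graph_weight \<eta> h x y = graph_weight \<eta> h y x"
  by (simp add: graph_weight_def dist_commute)

lemma graph_dist_sym:
  assumes "x \<in> X" "y \<in> X"
  shows "graph_dist \<eta> h X x y = graph_dist \<eta> h X y x"
proof -
  have "graph_dist \<eta> h X x y \<le> graph_dist \<eta> h X y x" if "x \<in> X" "y \<in> X" for x y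
  proof (rule graph_dist_greatest[OF that(2)])
    fix p and N :: nat assume p: "p ` {0..N} \<subseteq> X" "p 0 = y" "p N = x"
    define p' where "p' i = p (N - i)" for i
    have "path_cost \<eta> h p N =
        (\<Sum>i=1..N. inverse (ennreal (graph_weight \<eta> h (p (N + 1 - i - 1)) (p (N + 1 - i)))))"
      by (rule sum.atLeastAtMost_rev)
    also have "\<dots> = path_cost \<eta> h p' N"
    proof (rule sum.cong)
      fix i assume i: "i \<in> {1..N}"
      then have "N + 1 - i = N - (i - 1)" "N + 1 - i - 1 = N - i" by auto
      then have "p (N + 1 - i) = p' (i - 1)" "p (N + 1 - i - 1) = p' i" by (simp_all only: p'_def)
      then show "inverse (ennreal (graph_weight \<eta> h (p (N + 1 - i - 1)) (p (N + 1 - i)))) =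
          inverse (ennreal (graph_weight \<eta> h (p' (i - 1)) (p' i)))"
        by (simp only: graph_weight_sym[of \<eta> h "p' i"])
    qed simp
    finally have eq: "path_cost \<eta> h p N = path_cost \<eta> h p' N" .
    have "p' ` {0..N} \<subseteq> X" using p(1) by (force simp: p'_def)
    then show "graph_dist \<eta> h X x y \<le> path_cost \<eta> h p N"
      unfolding eq by (rule graph_dist_le_path) (use p in \<open>auto simp: p'_def\<close>)
  qed
  then show ?thesis using assms by (intro antisym) auto
qed

text \<open>A path to \<open>x\<close> that is prolonged by the edge to \<open>y\<close> competes in the infimum for \<open>y\<close>.\<close>

lemma graph_dist_step:
  assumes X: "z \<in> X" "x \<in> X" "y \<in> X" and e: "inverse (ennreal (graph_weight \<eta> h x y)) = ennreal e"
  shows "graph_dist \<eta> h X z y \<le> graph_dist \<eta> h X z x + ennreal e"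
proof -
  have "graph_dist \<eta> h X z y - ennreal e \<le> graph_dist \<eta> h X z x"
  proof (rule graph_dist_greatest[OF X(1)])
    fix p and N :: nat assume p: "p ` {0..N} \<subseteq> X" "p 0 = z" "p N = x"
    define p' where "p' = p(Suc N := y)"
    have "p' ` {0..Suc N} \<subseteq> X"
    proof
      fix a assume "a \<in> p' ` {0..Suc N}"
      then obtain i where "i \<le> Suc N" "a = p' i" by auto
      then show "a \<in> X" using p(1) X(3) by (cases "i = Suc N") (auto simp: p'_def)
    qed
    then have "graph_dist \<eta> h X z y \<le> path_cost \<eta> h p' (Suc N)"
      by (rule graph_dist_le_path) (use p in \<open>auto simp: p'_def\<close>)
    also have "\<dots> = path_cost \<eta> h p' N + inverse (ennreal (graph_weight \<eta> h (p' N) (p' (Suc N))))"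
      by simp
    also have "path_cost \<eta> h p' N = path_cost \<eta> h p N"
      by (rule sum.cong) (auto simp: p'_def)
    also have "inverse (ennreal (graph_weight \<eta> h (p' N) (p' (Suc N)))) = ennreal e"
      using p(3) e by (simp add: p'_def)
    finally show "graph_dist \<eta> h X z y - ennreal e \<le> path_cost \<eta> h p N"
      by (simp add: ennreal_minus_le_iff add.commute)
  qed
  then show ?thesis by (simp add: ennreal_minus_le_iff add.commute)
qed

text \<open>On a finite graph the infimum over all paths is reached through one of finitely many last edges.\<close>

lemma graph_dist_last_edge:
  assumes X: "finite X" "x \<in> X" "y \<in> X" "x \<noteq> y" and fin: "graph_dist \<eta> h X x y < \<infinity>"
    and nn: "\<And>z. z \<in> X \<Longrightarrow> graph_weight \<eta> h z y \<ge> 0"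
  shows "\<exists>z\<in>X. z \<noteq> y \<and> graph_weight \<eta> h z y > 0 \<and>
    graph_dist \<eta> h X x z + ennreal (1 / graph_weight \<eta> h z y) \<le> graph_dist \<eta> h X x y"
proof -
  define F where "F z = graph_dist \<eta> h X x z + inverse (ennreal (graph_weight \<eta> h z y))" for z
  have "Min (F ` X) \<le> graph_dist \<eta> h X x y"
  proof (rule graph_dist_greatest[OF X(2)])
    fix p and N :: nat assume p: "p ` {0..N} \<subseteq> X" "p 0 = x" "p N = y"
    then obtain K where K: "N = Suc K" using X(4) by (cases N) auto
    have pK: "p K \<in> X" using p(1) K by auto
    then have "Min (F ` X) \<le> F (p K)" using X(1) by simp
    also have "\<dots> \<le> path_cost \<eta> h p K + inverse (ennreal (graph_weight \<eta> h (p K) (p (Suc K))))"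
      unfolding F_def using p K by (intro add_mono graph_dist_le_path) auto
    also have "\<dots> = path_cost \<eta> h p N" using K by simp
    finally show "Min (F ` X) \<le> path_cost \<eta> h p N" .
  qed
  moreover have "Min (F ` X) \<in> F ` X" using X by (intro Min_in) auto
  ultimately obtain z where z: "z \<in> X" "F z \<le> graph_dist \<eta> h X x y" by auto
  have "inverse (ennreal (graph_weight \<eta> h z y)) \<le> F z" by (simp add: F_def)
  then have "inverse (ennreal (graph_weight \<eta> h z y)) < \<infinity>" using z(2) fin by (meson order.strict_trans1 order_trans)
  then have pos: "graph_weight \<eta> h z y > 0"
    using nn[OF z(1)] by (cases "graph_weight \<eta> h z y = 0") auto
  then have "z \<noteq> y" by (auto simp: graph_weight_def)
  moreover have "F z = graph_dist \<eta> h X x z + ennreal (1 / graph_weight \<eta> h z y)"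
    using pos by (simp add: F_def inverse_ennreal inverse_eq_divide)
  ultimately show ?thesis using z pos by auto
qed

text \<open>A point cloud together with the projection \<open>\<pi>\<close> onto it; \<open>\<delta>\<close> bounds the resolution, and the last
  assumption says that steps of length \<open>t0 h\<close>, at which the edges are as cheap as their Euclidean
  length, are long in comparison.\<close>

locale graph_on_domain = intrinsic_domain S d B
  for S :: "'a::euclidean_space set" and d B +
  fixes X L :: "'a set" and \<eta> :: "real \<Rightarrow> real" and t0 h \<delta> :: real and \<pi> :: "'a \<Rightarrow> 'a"
  assumes finite_X: "finite X" and X_sub: "X \<subseteq> S" and L_sub: "L \<subseteq> X" and L_ne: "L \<noteq> {}"
    and kernel: "kernel_assumption \<eta> t0" and h_pos: "h > 0"
    and \<pi>_mem: "\<And>x. x \<in> S \<Longrightarrow> \<pi> x \<in> X" and \<pi>_dist: "\<And>x. x \<in> S \<Longrightarrow> dist x (\<pi> x) \<le> \<delta>"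
    and \<pi>_id: "\<And>x. x \<in> X \<Longrightarrow> \<pi> x = x"
    and resolved: "4 * \<delta> \<le> t0 * h"
begin

abbreviation wt :: "'a \<Rightarrow> 'a \<Rightarrow> real" where "wt x y \<equiv> \<eta>_scaled \<eta> h (dist x y)"

definition \<rho> :: "'a \<Rightarrow> 'a \<Rightarrow> real" where "\<rho> x y = enn2real (graph_dist \<eta> h X x y)"

text \<open>The relative difference between intrinsic and Euclidean length along a single edge.\<close>

definition distortion :: real where "distortion = B * h powr (4/5)"

lemma distortion_nonneg: "distortion \<ge> 0"
  using B_nonneg by (simp add: distortion_def)

lemma \<delta>_nonneg: "\<delta> \<ge> 0"
proof -
  obtain z where "z \<in> L" using L_ne by blast
  then have "dist z (\<pi> z) \<le> \<delta>" using \<pi>_dist L_sub X_sub by blast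
  with zero_le_dist show ?thesis by (rule order_trans)
qed

lemma step_bounds: "0 < t0 * h" "t0 * h \<le> h" "4 * \<delta> \<le> h"
proof -
  have k: "0 < t0" "t0 \<le> 1" using kernel_pos[OF kernel] by auto
  then show "0 < t0 * h" using h_pos by simp
  have "t0 * h \<le> 1 * h" using k h_pos by (intro mult_right_mono) auto
  then show "t0 * h \<le> h" "4 * \<delta> \<le> h" using resolved by simp_all
qed

lemma wt_facts:
  fixes x y :: 'a
  assumes "x \<noteq> y"
  shows wt_support: "wt x y > 0 \<Longrightarrow> dist x y \<le> h"
    and wt_bound: "wt x y > 0 \<Longrightarrow> dist x y \<le> 1 / wt x y"
    and wt_peak: "dist x y \<le> t0 * h \<Longrightarrow> wt x y > 0 \<and> 1 / wt x y \<le> t0 * h"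
    and wt_nonneg: "wt x y \<ge> 0"
  using scaled_kernel_facts[OF kernel h_pos, of "dist x y"] assms by auto

lemma weight_nonneg: "graph_weight \<eta> h x y \<ge> 0" for x y :: 'a
  using wt_nonneg[of x y] by (simp add: graph_weight_def)

lemma graph_dist_self: "graph_dist \<eta> h X x x = 0"
  by (simp add: graph_dist_def)

lemma graph_dist_edge:
  assumes "z \<in> X" "x \<in> X" "y \<in> X" "x \<noteq> y" "wt x y > 0"
  shows "graph_dist \<eta> h X z y \<le> graph_dist \<eta> h X z x + ennreal (1 / wt x y)"
  by (rule graph_dist_step[OF assms(1-3)])
    (use assms in \<open>simp add: graph_weight_def inverse_ennreal inverse_eq_divide\<close>)

lemma graph_dist_short_edge:
  assumes "z \<in> X" "x \<in> X" "y \<in> X" "dist x y \<le> t0 * h"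
  shows "graph_dist \<eta> h X z y \<le> graph_dist \<eta> h X z x + ennreal (t0 * h)"
proof (cases "x = y")
  case False
  then have "wt x y > 0" "1 / wt x y \<le> t0 * h" using wt_peak assms(4) by auto
  then have "graph_dist \<eta> h X z y \<le> graph_dist \<eta> h X z x + ennreal (1 / wt x y)"
    using graph_dist_edge assms False by blast
  also have "\<dots> \<le> graph_dist \<eta> h X z x + ennreal (t0 * h)"
    using \<open>1 / wt x y \<le> t0 * h\<close> by (intro add_left_mono ennreal_leI)
  finally show ?thesis .
qed simp

text \<open>The points of the cloud shadow a geodesic that is walked in steps of length \<open>t0 h - 2 \<delta>\<close>.\<close>

lemma graph_dist_le_steps:
  assumes "y \<in> X" "x \<in> X" "x' \<in> S" "dist x x' \<le> \<delta>" "d x' y \<le> real N * (t0 * h - 2 * \<delta>)"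
  shows "graph_dist \<eta> h X y x \<le> ennreal (real (N + 1) * (t0 * h))"
  using assms(2-5)
proof (induction N arbitrary: x x')
  case 0
  have yS: "y \<in> S" using X_sub \<open>y \<in> X\<close> by blast
  have "d x' y = 0" using 0 nonneg[of x' y] by simp
  then have "x' = y" using zero[OF 0(2) yS] by simp
  then have "dist y x \<le> t0 * h" using 0(3) resolved \<delta>_nonneg by (simp add: dist_commute)
  then show ?case using graph_dist_short_edge[OF \<open>y \<in> X\<close> \<open>y \<in> X\<close> 0(1)] by (simp add: graph_dist_self)
next
  case (Suc N)
  have yS: "y \<in> S" using X_sub \<open>y \<in> X\<close> by blast
  have step: "0 \<le> t0 * h - 2 * \<delta>" using resolved \<delta>_nonneg by simp
  then have "0 \<le> real N * (t0 * h - 2 * \<delta>)" by simp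
  moreover have "d x' y \<le> (t0 * h - 2 * \<delta>) + real N * (t0 * h - 2 * \<delta>)"
    using Suc.prems(4) by (simp add: algebra_simps)
  ultimately obtain z where z: "z \<in> S" "d x' z \<le> t0 * h - 2 * \<delta>" "d z y \<le> real N * (t0 * h - 2 * \<delta>)"
    using between_point[OF Suc.prems(2) yS step] by blast
  have \<pi>z: "\<pi> z \<in> X" "dist (\<pi> z) z \<le> \<delta>" using \<pi>_mem \<pi>_dist z(1) by (auto simp: dist_commute)
  have "graph_dist \<eta> h X y (\<pi> z) \<le> ennreal (real (N + 1) * (t0 * h))"
    by (rule Suc.IH[OF \<pi>z(1) z(1) \<pi>z(2) z(3)])
  moreover have "dist (\<pi> z) x \<le> t0 * h"
  proof -
    have "dist x' z \<le> t0 * h - 2 * \<delta>" using dist_le_d[OF Suc.prems(2) z(1)] z(2) by simp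
    then show ?thesis
      using dist_triangle[of "\<pi> z" x z] dist_triangle[of z x x'] \<pi>z(2) Suc.prems(3)
      by (simp add: dist_commute)
  qed
  then have "graph_dist \<eta> h X y x \<le> graph_dist \<eta> h X y (\<pi> z) + ennreal (t0 * h)"
    by (rule graph_dist_short_edge[OF \<open>y \<in> X\<close> \<pi>z(1) Suc.prems(1)])
  ultimately have "graph_dist \<eta> h X y x \<le> ennreal (real (N + 1) * (t0 * h)) + ennreal (t0 * h)"
    by (meson add_right_mono order_trans)
  also have "\<dots> = ennreal (real (N + 1) * (t0 * h) + t0 * h)"
    using step_bounds by (intro ennreal_plus[symmetric]) auto
  also have "real (N + 1) * (t0 * h) + t0 * h = real (Suc N + 1) * (t0 * h)" by (simp add: algebra_simps)
  finally show ?case .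
qed

text \<open>Rounding up the number of steps and the final step cost at most \<open>h\<close> each.\<close>

lemma graph_dist_upper:
  assumes "x \<in> X" "y \<in> X"
  shows "graph_dist \<eta> h X x y \<le> ennreal ((1 + 4 * \<delta> / (t0 * h)) * d x y + 2 * h)"
proof -
  define T where "T = t0 * h"
  have T: "T > 0" "T \<le> h" "4 * \<delta> \<le> T" using step_bounds resolved by (auto simp: T_def)
  have T2: "T - 2 * \<delta> > 0" using T \<delta>_nonneg by linarith
  define N where "N = nat \<lceil>d x y / (T - 2 * \<delta>)\<rceil>"
  have "d y x / (T - 2 * \<delta>) \<le> real N" using commute[of x y] by (simp add: N_def real_nat_ceiling_ge)
  then have "d y x \<le> real N * (T - 2 * \<delta>)" using T2 by (simp add: field_simps)
  then have "graph_dist \<eta> h X x y \<le> ennreal (real (N + 1) * T)"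
    unfolding T_def using assms X_sub \<delta>_nonneg by (intro graph_dist_le_steps[of x y y]) auto
  also have "real (N + 1) * T \<le> (1 + 4 * \<delta> / T) * d x y + 2 * h"
  proof -
    have "real N \<le> d x y / (T - 2 * \<delta>) + 1"
    proof -
      have "0 \<le> d x y / (T - 2 * \<delta>)" using T2 nonneg[of x y] by simp
      then have "real N = of_int \<lceil>d x y / (T - 2 * \<delta>)\<rceil>" by (simp add: N_def)
      then show ?thesis using of_int_ceiling_le_add_one[of "d x y / (T - 2 * \<delta>)"] by linarith
    qed
    then have "real (N + 1) * T \<le> (d x y / (T - 2 * \<delta>) + 2) * T"
      using T by (intro mult_right_mono) auto
    also have "\<dots> = T / (T - 2 * \<delta>) * d x y + 2 * T" by (simp add: algebra_simps)
    also have "T / (T - 2 * \<delta>) \<le> 1 + 4 * \<delta> / T"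
    proof -
      have "\<delta> * (4 * \<delta>) \<le> \<delta> * T" using T \<delta>_nonneg by (intro mult_left_mono) auto
      then have "T * T \<le> (T + 4 * \<delta>) * (T - 2 * \<delta>)" by (simp add: algebra_simps)
      then have "T \<le> (T + 4 * \<delta>) / T * (T - 2 * \<delta>)" using T by (simp add: field_simps)
      then show ?thesis using T T2 by (simp add: field_simps)
    qed
    finally show ?thesis using T nonneg[of x y] by (simp add: mult_right_mono)
  qed
  finally show ?thesis by (simp add: T_def ennreal_leI)
qed

lemma graph_dist_finite: "x \<in> X \<Longrightarrow> y \<in> X \<Longrightarrow> graph_dist \<eta> h X x y < \<infinity>"
  by (rule order.strict_trans1[OF graph_dist_upper]) simp_all

lemma ennreal_\<rho>: "x \<in> X \<Longrightarrow> y \<in> X \<Longrightarrow> ennreal (\<rho> x y) = graph_dist \<eta> h X x y"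
  using graph_dist_finite by (simp add: \<rho>_def)

lemma \<rho>_nonneg: "\<rho> x y \<ge> 0"
  by (simp add: \<rho>_def)

lemma \<rho>_self: "\<rho> x x = 0"
  by (simp add: \<rho>_def graph_dist_self)

lemma \<rho>_sym: "x \<in> X \<Longrightarrow> y \<in> X \<Longrightarrow> \<rho> x y = \<rho> y x"
  unfolding \<rho>_def by (simp only: graph_dist_sym[of x X y])

lemma \<rho>_upper:
  assumes "x \<in> X" "y \<in> X"
  shows "\<rho> x y \<le> (1 + 4 * \<delta> / (t0 * h)) * d x y + 2 * h"
proof -
  have "0 \<le> (1 + 4 * \<delta> / (t0 * h)) * d x y + 2 * h"
    using \<delta>_nonneg step_bounds h_pos nonneg[of x y] by (intro add_nonneg_nonneg mult_nonneg_nonneg) auto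
  then show ?thesis
    using graph_dist_upper[OF assms] ennreal_\<rho>[OF assms] by (metis ennreal_le_iff)
qed

lemma \<rho>_upper_crude:
  assumes "x \<in> X" "y \<in> X"
  shows "\<rho> x y \<le> 2 * d x y + 2 * h"
proof -
  have "1 + 4 * \<delta> / (t0 * h) \<le> 2" using resolved step_bounds by simp
  then have "(1 + 4 * \<delta> / (t0 * h)) * d x y \<le> 2 * d x y" using nonneg[of x y] by (rule mult_right_mono)
  then show ?thesis using \<rho>_upper[OF assms] by linarith
qed

lemma \<rho>_edge:
  assumes "z \<in> X" "x \<in> X" "y \<in> X" "x \<noteq> y" "wt x y > 0"
  shows "\<rho> z y \<le> \<rho> z x + 1 / wt x y"
proof -
  have "ennreal (\<rho> z y) \<le> ennreal (\<rho> z x) + ennreal (1 / wt x y)"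
    using graph_dist_edge[OF assms] by (simp add: ennreal_\<rho> assms)
  also have "\<dots> = ennreal (\<rho> z x + 1 / wt x y)"
    using \<rho>_nonneg assms(5) by (intro ennreal_plus[symmetric]) auto
  finally have "ennreal (\<rho> z y) \<le> ennreal (\<rho> z x + 1 / wt x y)" .
  moreover have "0 \<le> \<rho> z x + 1 / wt x y" using \<rho>_nonneg assms(5) by simp
  ultimately show ?thesis by (metis ennreal_le_iff)
qed

lemma \<rho>_last_edge:
  assumes "x \<in> X" "y \<in> X" "x \<noteq> y"
  shows "\<exists>z\<in>X. z \<noteq> y \<and> wt z y > 0 \<and> \<rho> x z + 1 / wt z y \<le> \<rho> x y"
proof -
  obtain z where z: "z \<in> X" "z \<noteq> y" "graph_weight \<eta> h z y > 0"
      "graph_dist \<eta> h X x z + ennreal (1 / graph_weight \<eta> h z y) \<le> graph_dist \<eta> h X x y"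
    using graph_dist_last_edge[OF finite_X assms graph_dist_finite[OF assms(1,2)] weight_nonneg] by blast
  have w: "graph_weight \<eta> h z y = wt z y" using z(2) by (simp add: graph_weight_def)
  have "ennreal (\<rho> x z + 1 / wt z y) = ennreal (\<rho> x z) + ennreal (1 / wt z y)"
    using \<rho>_nonneg z(3) w by (intro ennreal_plus) auto
  also have "\<dots> \<le> ennreal (\<rho> x y)" using z(4) w by (simp add: ennreal_\<rho> assms z)
  finally have "\<rho> x z + 1 / wt z y \<le> \<rho> x y" using \<rho>_nonneg by (simp add: ennreal_le_iff)
  then show ?thesis using z w by auto
qed

text \<open>Conversely no edge is cheaper than its Euclidean length, and edges are so short that Euclidean
  and intrinsic length nearly agree.\<close>

lemma d_le_\<rho>:
  assumes "x \<in> X" "y \<in> X"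
  shows "d x y \<le> (1 + distortion) * \<rho> x y"
proof -
  have path: "ennreal (d (p 0) (p N)) \<le> ennreal (1 + distortion) * path_cost \<eta> h p N"
    if "p ` {0..N} \<subseteq> X" for p N
    using that
  proof (induction N)
    case 0
    then show ?case using X_sub d_self by auto
  next
    case (Suc N)
    have mem: "p i \<in> X" "p i \<in> S" if "i \<le> Suc N" for i
    proof -
      show "p i \<in> X" using Suc.prems that by auto
      then show "p i \<in> S" using X_sub by blast
    qed
    have IH: "ennreal (d (p 0) (p N)) \<le> ennreal (1 + distortion) * path_cost \<eta> h p N"
      using Suc by (simp add: image_subset_iff)
    have edge: "ennreal (d (p N) (p (Suc N))) \<le>
        ennreal (1 + distortion) * inverse (ennreal (graph_weight \<eta> h (p N) (p (Suc N))))"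
    proof (cases "graph_weight \<eta> h (p N) (p (Suc N)) > 0")
      case True
      then have ne: "p N \<noteq> p (Suc N)" and w: "graph_weight \<eta> h (p N) (p (Suc N)) = wt (p N) (p (Suc N))"
        by (auto simp: graph_weight_def split: if_splits)
      have "d (p N) (p (Suc N)) \<le> (1 + distortion) * dist (p N) (p (Suc N))"
        unfolding distortion_def using wt_support[OF ne] True w mem by (intro d_le_expansion) auto
      also have "\<dots> \<le> (1 + distortion) * (1 / wt (p N) (p (Suc N)))"
        using wt_bound[OF ne] True w distortion_nonneg by (intro mult_left_mono) auto
      finally have "ennreal (d (p N) (p (Suc N))) \<le> ennreal ((1 + distortion) * (1 / wt (p N) (p (Suc N))))"
        by (rule ennreal_leI)
      also have "\<dots> = ennreal (1 + distortion) * ennreal (1 / wt (p N) (p (Suc N)))"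
        using distortion_nonneg True w by (intro ennreal_mult) auto
      finally show ?thesis using True w by (simp add: inverse_ennreal inverse_eq_divide)
    next
      case False
      then have "graph_weight \<eta> h (p N) (p (Suc N)) = 0" using weight_nonneg by (simp add: antisym not_less)
      then show ?thesis using distortion_nonneg by (simp add: ennreal_mult_top)
    qed
    have "ennreal (d (p 0) (p (Suc N))) \<le> ennreal (d (p 0) (p N) + d (p N) (p (Suc N)))"
      by (rule ennreal_leI[OF triangle]) (use mem in auto)
    also have "\<dots> = ennreal (d (p 0) (p N)) + ennreal (d (p N) (p (Suc N)))"
      by (rule ennreal_plus) auto
    also have "\<dots> \<le> ennreal (1 + distortion) * path_cost \<eta> h p N +
        ennreal (1 + distortion) * inverse (ennreal (graph_weight \<eta> h (p N) (p (Suc N))))"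
      by (rule add_mono[OF IH edge])
    also have "\<dots> = ennreal (1 + distortion) * path_cost \<eta> h p (Suc N)"
      by (simp add: distrib_left)
    finally show ?case .
  qed
  have c: "1 + distortion > 0" using distortion_nonneg by simp
  have "ennreal (d x y / (1 + distortion)) \<le> graph_dist \<eta> h X x y"
  proof (rule graph_dist_greatest[OF assms(1)])
    fix p :: "nat \<Rightarrow> 'a" and N assume "p ` {0..N} \<subseteq> X" "p 0 = x" "p N = y"
    then have le: "ennreal (d x y) \<le> ennreal (1 + distortion) * path_cost \<eta> h p N" using path by blast
    show "ennreal (d x y / (1 + distortion)) \<le> path_cost \<eta> h p N"
    proof (cases "path_cost \<eta> h p N" rule: ennreal_cases)
      case (real r)
      then have "ennreal (d x y) \<le> ennreal ((1 + distortion) * r)"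
        using le c by (simp add: ennreal_mult)
      then have "d x y \<le> (1 + distortion) * r" using real c by (simp add: ennreal_le_iff)
      then have "d x y / (1 + distortion) \<le> r" using c by (simp add: field_simps)
      then show ?thesis using real by (simp add: ennreal_leI)
    next
      case top
      then show ?thesis by (simp only: top_greatest)
    qed
  qed
  then have "d x y / (1 + distortion) \<le> \<rho> x y"
    using ennreal_\<rho>[OF assms] \<rho>_nonneg by (metis ennreal_le_iff)
  then show ?thesis using c by (simp add: field_simps)
qed

subsection \<open>Comparison with graph cones\<close>

text \<open>Half of the graph equation: the minimum plus the maximum of the weighted differences is
  nonnegative, expressed without the extrema.\<close>

definition balanced :: "('a \<Rightarrow> real) \<Rightarrow> bool" where
  "balanced v \<longleftrightarrow> (\<forall>x\<in>X - L. \<forall>a. (\<exists>z\<in>X. wt x z * (v z - v x) \<le> - a) \<longrightarrow>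
     (\<exists>z\<in>X. a \<le> wt x z * (v z - v x)))"

lemma balanced_if_solves:
  assumes "solves_graph_infinity_laplace \<eta> h X L \<gamma> v"
  shows "balanced v" "balanced (\<lambda>x. - v x)"
proof -
  have main: "(\<exists>z\<in>X. F z \<le> - a) \<longleftrightarrow> (\<exists>z\<in>X. a \<le> F z)"
    if "(MIN y\<in>X. F y) + (MAX y\<in>X. F y) = 0" "X \<noteq> {}" for F :: "'a \<Rightarrow> real" and a
  proof -
    have "(MIN y\<in>X. F y) \<le> - a \<longleftrightarrow> (\<exists>z\<in>X. F z \<le> - a)"
      using finite_X that(2) by (subst Min_le_iff) auto
    moreover have "a \<le> (MAX y\<in>X. F y) \<longleftrightarrow> (\<exists>z\<in>X. a \<le> F z)"
      using finite_X that(2) by (subst Max_ge_iff) auto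
    ultimately show ?thesis using that(1) by linarith
  qed
  have eq: "(\<exists>z\<in>X. wt x z * (v z - v x) \<le> - a) \<longleftrightarrow> (\<exists>z\<in>X. a \<le> wt x z * (v z - v x))"
    if "x \<in> X - L" for x a
    by (rule main) (use assms that in \<open>auto simp: solves_graph_infinity_laplace_def\<close>)
  show "balanced v" unfolding balanced_def using eq by blast
  have neg: "wt x z * (- v z - - v x) = - (wt x z * (v z - v x))" for x z by (simp add: algebra_simps)
  have "(\<exists>z\<in>X. a \<le> - (wt x z * (v z - v x)))" if "x \<in> X - L" "\<exists>z\<in>X. - (wt x z * (v z - v x)) \<le> - a" for x a
  proof -
    have "\<exists>z\<in>X. a \<le> wt x z * (v z - v x)" using that(2) by auto
    then have "\<exists>z\<in>X. wt x z * (v z - v x) \<le> - a" using eq[OF that(1)] by blast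
    then show ?thesis by (auto simp: le_minus_iff)
  qed
  then show "balanced (\<lambda>x. - v x)" unfolding balanced_def neg by blast
qed

text \<open>Among the maximisers of \<open>v\<close> minus the cone take one that is farthest from the vertex: walking
  down the cone costs slope \<open>a\<close>, so balance forces an equal gain upwards, to a maximiser that is
  farther still. For this the slope has to be positive, whence the detour through \<open>a' > a\<close>.\<close>

lemma graph_cone_comparison:
  assumes v: "balanced v" and A: "A \<subseteq> X - L" "x0 \<in> X" "x0 \<notin> A" and "a \<ge> 0"
    and bd: "\<And>y z. y \<in> X - A \<Longrightarrow> z \<in> A \<Longrightarrow> dist z y \<le> h \<Longrightarrow> v y \<le> b + a * \<rho> x0 y"
    and "y \<in> A"
  shows "v y \<le> b + a * \<rho> x0 y"
proof -
  have strict: "v y \<le> b + a' * \<rho> x0 y" if "a' > a" "y \<in> A" for a' y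
  proof (rule ccontr)
    define f where "f y = v y - (b + a' * \<rho> x0 y)" for y
    have "a' > 0" using that(1) \<open>a \<ge> 0\<close> by simp
    assume "\<not> v y \<le> b + a' * \<rho> x0 y"
    then have "f y > 0" by (simp add: f_def)
    have fin: "finite A" using A(1) finite_X finite_subset by blast
    define m where "m = Max (f ` A)"
    have m: "\<And>z. z \<in> A \<Longrightarrow> f z \<le> m" using fin by (simp add: m_def)
    have "m > 0" using m[OF that(2)] \<open>f y > 0\<close> by simp
    define E where "E = {z \<in> A. f z = m}"
    have "m \<in> f ` A" unfolding m_def using fin that(2) by (intro Max_in) auto
    then have "E \<noteq> {}" "finite E" using fin by (auto simp: E_def)
    then have "Max (\<rho> x0 ` E) \<in> \<rho> x0 ` E" by (intro Max_in) auto
    then obtain w where w: "w \<in> E" "\<rho> x0 w = Max (\<rho> x0 ` E)" by auto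
    have w_max: "\<rho> x0 z \<le> \<rho> x0 w" if "z \<in> E" for z
      unfolding w(2) using \<open>finite E\<close> that by simp
    have wA: "w \<in> A" "f w = m" using w(1) by (auto simp: E_def)
    then have wX: "w \<in> X" "w \<in> X - L" "w \<noteq> x0" using A by auto
    have nbr: "f z \<le> m \<and> (f z = m \<longrightarrow> z \<in> E)" if z: "z \<in> X" "dist w z \<le> h" for z
    proof (cases "z \<in> A")
      case True
      then show ?thesis using m by (auto simp: E_def)
    next
      case False
      then have "v z \<le> b + a * \<rho> x0 z" using bd[of z w] z wA by simp
      also have "\<dots> \<le> b + a' * \<rho> x0 z" using \<open>a' > a\<close> \<rho>_nonneg by (simp add: mult_right_mono)
      finally have "f z \<le> 0" by (simp add: f_def)
      then show ?thesis using \<open>m > 0\<close> by simp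
    qed
    obtain z1 where z1: "z1 \<in> X" "z1 \<noteq> w" "wt z1 w > 0" "\<rho> x0 z1 + 1 / wt z1 w \<le> \<rho> x0 w"
      using \<rho>_last_edge[OF A(2) wX(1)] wX(3) by auto
    have w1: "wt w z1 = wt z1 w" by (simp add: dist_commute)
    have "dist w z1 \<le> h" using wt_support[OF z1(2,3)] by (simp add: dist_commute)
    then have "f z1 \<le> f w" using nbr[OF z1(1)] wA by simp
    then have "v z1 - v w \<le> a' * (\<rho> x0 z1 - \<rho> x0 w)" by (simp add: f_def algebra_simps)
    also have "\<dots> \<le> a' * (- (1 / wt z1 w))" using z1(4) \<open>a' > 0\<close> by (intro mult_left_mono) auto
    finally have "wt w z1 * (v z1 - v w) \<le> wt w z1 * (a' * (- (1 / wt z1 w)))"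
      using z1(3) w1 by (intro mult_left_mono) auto
    also have "\<dots> = - a'" using z1(3) w1 by simp
    finally have "wt w z1 * (v z1 - v w) \<le> - a'" .
    then obtain z2 where z2: "z2 \<in> X" "a' \<le> wt w z2 * (v z2 - v w)"
      using v wX(2) z1(1) unfolding balanced_def by blast
    have "z2 \<noteq> w" using z2(2) \<open>a' > 0\<close> by auto
    moreover have "wt w z2 \<noteq> 0" using z2(2) \<open>a' > 0\<close> by auto
    ultimately have pos: "wt w z2 > 0" using wt_nonneg[of w z2] by simp
    have up: "\<rho> x0 z2 \<le> \<rho> x0 w + 1 / wt w z2"
      by (rule \<rho>_edge[OF A(2) wX(1) z2(1)]) (use \<open>z2 \<noteq> w\<close> pos in auto)
    have "a' * (1 / wt w z2) \<le> v z2 - v w" using z2(2) pos by (simp add: field_simps)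
    moreover have "a' * (\<rho> x0 z2 - \<rho> x0 w) \<le> a' * (1 / wt w z2)"
      using up \<open>a' > 0\<close> by (intro mult_left_mono) auto
    moreover have "f z2 - f w = (v z2 - v w) - a' * (\<rho> x0 z2 - \<rho> x0 w)" by (simp add: f_def algebra_simps)
    moreover have "f z2 \<le> m \<and> (f z2 = m \<longrightarrow> z2 \<in> E)"
      using nbr[OF z2(1)] wt_support[of w z2] \<open>z2 \<noteq> w\<close> pos by auto
    ultimately have "z2 \<in> E" "a' * (\<rho> x0 z2 - \<rho> x0 w) = a' * (1 / wt w z2)" using wA(2) by linarith+
    moreover have "0 < a' * (1 / wt w z2)" using \<open>a' > 0\<close> pos by simp
    moreover have "a' * (\<rho> x0 z2 - \<rho> x0 w) \<le> 0"
      using w_max[OF \<open>z2 \<in> E\<close>] \<open>a' > 0\<close> by (simp add: mult_nonneg_nonpos)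
    ultimately show False by linarith
  qed
  show ?thesis
  proof (rule field_le_epsilon)
    fix e :: real assume "e > 0"
    define a' where "a' = a + e / (\<rho> x0 y + 1)"
    have p: "\<rho> x0 y + 1 > 0" using \<rho>_nonneg[of x0 y] by simp
    then have "a' > a" using \<open>e > 0\<close> by (simp add: a'_def)
    then have "v y \<le> b + a' * \<rho> x0 y" using strict \<open>y \<in> A\<close> by blast
    also have "\<dots> = b + a * \<rho> x0 y + e * (\<rho> x0 y / (\<rho> x0 y + 1))" by (simp add: a'_def algebra_simps)
    also have "\<dots> \<le> b + a * \<rho> x0 y + e * 1"
      using \<open>e > 0\<close> p by (intro add_left_mono mult_left_mono) auto
    finally show "v y \<le> b + a * \<rho> x0 y + e" by simp
  qed
qed

text \<open>The argument for functions on the domain with comparison with cones carries over, with the graph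
  distance in place of the intrinsic one.\<close>

lemma graph_lipschitz:
  assumes v: "balanced v" "balanced (\<lambda>x. - v x)" and "M \<ge> 0"
    and L: "\<And>x y. x \<in> L \<Longrightarrow> y \<in> L \<Longrightarrow> \<bar>v x - v y\<bar> \<le> M * \<rho> x y"
    and xy: "x \<in> X" "y \<in> X"
  shows "\<bar>v x - v y\<bar> \<le> M * \<rho> x y"
proof -
  have one: "f x \<le> f z + M * \<rho> z x"
    if f: "balanced f" "\<And>x y. x \<in> L \<Longrightarrow> y \<in> L \<Longrightarrow> f x - f y \<le> M * \<rho> x y"
      and xz: "x \<in> X" "z \<in> L" for f x z
  proof -
    have zX: "z \<in> X" using xz L_sub by blast
    have lab: "f y \<le> f z + M * \<rho> z y" if y: "y \<in> L" for y
    proof -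
      have "y \<in> X" using y L_sub by blast
      then show ?thesis using f(2)[OF y xz(2)] \<rho>_sym[OF zX] by simp
    qed
    show ?thesis
    proof (cases "x \<in> L")
      case False
      show ?thesis
        by (rule graph_cone_comparison[OF f(1), of "X - L"]) (use False xz zX lab \<open>M \<ge> 0\<close> in auto)
    qed (rule lab)
  qed
  have half: "f x \<le> f y + M * \<rho> x y"
    if f: "balanced f" "balanced (\<lambda>x. - f x)" "\<And>x y. x \<in> L \<Longrightarrow> y \<in> L \<Longrightarrow> f x - f y \<le> M * \<rho> x y"
      and xy: "x \<in> X" "y \<in> X" for f x y
  proof -
    have neg: "- f x - - f y \<le> M * \<rho> x y" if "x \<in> L" "y \<in> L" for x y
    proof -
      have "x \<in> X" "y \<in> X" using that L_sub by auto
      then show ?thesis using f(3)[OF that(2,1)] \<rho>_sym[of x y] by simp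
    qed
    have lab: "f p \<le> f q + M * \<rho> p q" if "p \<in> L" "q \<in> X" for p q
      using one[OF f(2) neg that(2,1)] by simp
    have lab': "f p \<le> f y + M * \<rho> y p" if "p \<in> L \<or> p = y" for p
    proof (cases "p = y")
      case True
      then show ?thesis using \<rho>_self by simp
    next
      case False
      then have p: "p \<in> L" using that by simp
      then have "p \<in> X" using L_sub by blast
      then show ?thesis using lab[OF p xy(2)] \<rho>_sym[of p y] xy(2) by simp
    qed
    have "f x \<le> f y + M * \<rho> y x"
    proof (cases "x \<in> L \<or> x = y")
      case False
      show ?thesis
        by (rule graph_cone_comparison[OF f(1), of "X - L - {y}"]) (use False xy lab' \<open>M \<ge> 0\<close> in auto)
    qed (rule lab')
    then show ?thesis using \<rho>_sym[OF xy] by simp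
  qed
  have g: "v x - v y \<le> M * \<rho> x y" "- v x - - v y \<le> M * \<rho> x y" if "x \<in> L" "y \<in> L" for x y
    using L[OF that] by auto
  have vv: "balanced (\<lambda>x. - (- v x))" using v(1) by simp
  have "v x \<le> v y + M * \<rho> x y" by (rule half[OF v g(1) xy])
  moreover have "- v x \<le> - v y + M * \<rho> x y" by (rule half[OF v(2) vv g(2) xy])
  ultimately show ?thesis by (simp add: abs_le_iff)
qed

lemma cloud_lipschitz:
  assumes M: "M \<ge> 0" "\<And>x y. x \<in> X \<Longrightarrow> y \<in> X \<Longrightarrow> \<bar>v x - v y\<bar> \<le> M * \<rho> x y"
    and xy: "x \<in> S" "y \<in> S"
  shows "\<bar>v (\<pi> x) - v (\<pi> y)\<bar> \<le> M * (2 * d x y + 3 * \<kappa> * h)"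
proof -
  have \<pi>: "\<pi> x \<in> X" "\<pi> y \<in> X" "\<pi> x \<in> S" "\<pi> y \<in> S" using \<pi>_mem X_sub xy by auto
  have near: "d x (\<pi> x) \<le> \<kappa> * \<delta>" if "x \<in> S" for x
  proof -
    have "\<pi> x \<in> S" using that \<pi>_mem X_sub by blast
    then have "d x (\<pi> x) \<le> \<kappa> * dist x (\<pi> x)" by (rule d_le_\<kappa>[OF that])
    also have "\<dots> \<le> \<kappa> * \<delta>" using \<pi>_dist[OF that] \<kappa>_ge_1 by (intro mult_left_mono) auto
    finally show ?thesis .
  qed
  have "d (\<pi> x) (\<pi> y) \<le> d (\<pi> x) x + (d x y + d y (\<pi> y))"
    using triangle[OF \<pi>(3) xy(1) \<pi>(4)] triangle[OF xy \<pi>(4)] by linarith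
  then have "d (\<pi> x) (\<pi> y) \<le> d x y + 2 * (\<kappa> * \<delta>)"
    using near[OF xy(1)] near[OF xy(2)] commute[of x "\<pi> x"] by linarith
  moreover have "\<kappa> * (4 * \<delta>) \<le> \<kappa> * h" using step_bounds \<kappa>_ge_1 by (intro mult_left_mono) auto
  moreover have "1 * h \<le> \<kappa> * h" using \<kappa>_ge_1 h_pos by (intro mult_right_mono) auto
  moreover have "\<rho> (\<pi> x) (\<pi> y) \<le> 2 * d (\<pi> x) (\<pi> y) + 2 * h" by (rule \<rho>_upper_crude[OF \<pi>(1,2)])
  ultimately have "\<rho> (\<pi> x) (\<pi> y) \<le> 2 * d x y + 3 * \<kappa> * h" by simp
  then have "M * \<rho> (\<pi> x) (\<pi> y) \<le> M * (2 * d x y + 3 * \<kappa> * h)" using M(1) by (rule mult_left_mono)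
  then show ?thesis using M(2)[OF \<pi>(1,2)] by linarith
qed

lemma attains_sup_cloud: "attains_sup (\<lambda>x. v (\<pi> x))"
proof (rule attains_sup_finite)
  have "(\<lambda>x. v (\<pi> x)) ` S \<subseteq> v ` X" using \<pi>_mem by auto
  then show "finite ((\<lambda>x. v (\<pi> x)) ` S)" using finite_X finite_subset by blast
qed

text \<open>The ratio of the graph distance of a point in the \<open>\<epsilon>\<close>-ball to the radius of the cone in the next
  lemma is 1/2 up to the relative errors \<open>x = \<kappa> h/\<epsilon>\<close>, \<open>b = 4 \<delta>/(t0 h)\<close>, \<open>s\<close> (distortion) and
  \<open>c = 2 h/\<epsilon>\<close>.\<close>

lemma half_quotient_bound:
  fixes x b s c :: real
  assumes "0 \<le> x" "x \<le> 1/4" "0 \<le> b" "b \<le> 1" "0 \<le> s" "0 \<le> c" "c \<le> 2 * x"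
  shows "(1 + s) * ((1 + x) * (1 + b) + c) / (2 * (1 - x)) \<le> (1 + 10 * x + b + 5 * s) / 2"
proof -
  have xb: "x * b \<le> x" "x * b \<ge> 0" "x * b \<le> 1/4 * b"
    using assms mult_right_mono[of x "1/4" b] by (auto simp: mult_left_le)
  have xx: "x * x \<le> x / 4" "0 \<le> x * x" using mult_left_mono[of x "1/4" x] assms by auto
  have sx: "0 \<le> s * x" "s * x \<le> s / 4" "0 \<le> s * b" "s * b \<le> s"
    using assms mult_left_mono[of x "1/4" s] mult_left_mono[of b 1 s] by auto
  have "(1 + x) * (1 + b) + c \<le> 1 + 4 * x + b" using xb assms by (simp add: algebra_simps)
  then have "(1 + s) * ((1 + x) * (1 + b) + c) \<le> (1 + s) * (1 + 4 * x + b)"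
    using assms by (intro mult_left_mono) auto
  also have "\<dots> = 1 + 4 * x + b + s + 4 * (s * x) + s * b" by (simp add: algebra_simps)
  also have "\<dots> \<le> (1 + 10 * x + b + 5 * s) * (1 - x)"
  proof -
    have "(1 + 10 * x + b + 5 * s) * (1 - x) = 1 + 9 * x + b + 5 * s - 10 * (x * x) - x * b - 5 * (s * x)"
      by (simp add: algebra_simps)
    moreover have "10 * (x * x) \<le> 2.5 * x" using xx by simp
    ultimately show ?thesis using xb sx assms by linarith
  qed
  finally show ?thesis using assms(2) by (simp add: field_simps)
qed

text \<open>The radius \<open>R\<close> of the cone in graph distance is chosen such that all neighbours of the graph
  ball lie in the intrinsic ball of radius \<open>2 \<epsilon>\<close>, where the values are at most \<open>m\<close>. The cone has
  height \<open>m - v x0\<close>, at most of order \<open>\<epsilon>\<close> by Lipschitz continuity, and this factor turns the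
  relative errors of the graph distance into absolute ones. If \<open>h\<close> is comparable to \<open>\<epsilon>\<close>, the error
  term exceeds the oscillation of \<open>v\<close> over the ball.\<close>

lemma cloud_ball_sup_doubling:
  assumes v: "balanced v" and M: "M \<ge> 0" "\<And>x y. x \<in> X \<Longrightarrow> y \<in> X \<Longrightarrow> \<bar>v x - v y\<bar> \<le> M * \<rho> x y"
    and \<epsilon>: "2 * h \<le> \<epsilon>" and x: "x \<in> S" and far: "\<And>l. l \<in> L \<Longrightarrow> 2 * \<epsilon> - \<kappa> * \<delta> \<le> d x l"
  shows "2 * ball_sup (\<lambda>x. v (\<pi> x)) \<epsilon> x \<le> v (\<pi> x) + ball_sup (\<lambda>x. v (\<pi> x)) (2 * \<epsilon>) x +
    6 * M * (10 * \<kappa> * h + 4 * (\<epsilon> * \<delta>) / (t0 * h) + 5 * \<epsilon> * distortion)"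
proof -
  define Z where "Z x = v (\<pi> x)" for x
  define m where "m = ball_sup Z (2 * \<epsilon>) x"
  define b where "b = 4 * \<delta> / (t0 * h)"
  define Err where "Err = 6 * M * (10 * (\<kappa> * h) + \<epsilon> * b + 5 * (\<epsilon> * distortion))"
  have as: "attains_sup Z" unfolding Z_def[abs_def] by (rule attains_sup_cloud)
  have \<epsilon>0: "\<epsilon> > 0" using \<epsilon> h_pos by simp
  have T: "0 < t0 * h" "t0 * h \<le> h" using step_bounds by auto
  have b: "0 \<le> b" "b \<le> 1" using resolved T \<delta>_nonneg by (auto simp: b_def)
  have \<kappa>\<delta>: "4 * (\<kappa> * \<delta>) \<le> \<kappa> * h" "0 \<le> \<kappa> * \<delta>"
    using mult_left_mono[OF step_bounds(3), of \<kappa>] \<kappa>_ge_1 \<delta>_nonneg by auto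
  have h\<kappa>: "h \<le> \<kappa> * h" using mult_right_mono[OF \<kappa>_ge_1, of h] h_pos by simp
  have near: "d y (\<pi> y) \<le> \<kappa> * \<delta>" "\<pi> y \<in> X" "\<pi> y \<in> S" if "y \<in> S" for y
  proof -
    show "\<pi> y \<in> X" using that by (rule \<pi>_mem)
    then show "\<pi> y \<in> S" using X_sub by blast
    then have "d y (\<pi> y) \<le> \<kappa> * dist y (\<pi> y)" by (rule d_le_\<kappa>[OF that])
    also have "\<dots> \<le> \<kappa> * \<delta>" using \<pi>_dist[OF that] \<kappa>_ge_1 by (intro mult_left_mono) auto
    finally show "d y (\<pi> y) \<le> \<kappa> * \<delta>" .
  qed
  define x0 where "x0 = \<pi> x"
  have x0: "x0 \<in> X" "x0 \<in> S" "d x x0 \<le> \<kappa> * \<delta>" using near[OF x] by (auto simp: x0_def)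
  have m_ge: "Z y \<le> m" if "y \<in> S" "d x y \<le> 2 * \<epsilon>" for y
    unfolding m_def using ball_sup_upper[OF as x _ that] \<epsilon>0 by simp
  have m0: "v x0 \<le> m" using m_ge[OF x] d_self[OF x] \<epsilon>0 by (simp add: Z_def x0_def)
  have err_nonneg: "0 \<le> \<epsilon> * b" "0 \<le> \<epsilon> * distortion" using \<epsilon>0 b distortion_nonneg by auto
  have vZ: "v y = Z y" if "y \<in> X" for y using \<pi>_id[OF that] by (simp add: Z_def)
  have "2 * Z p \<le> v x0 + m + Err" if p: "p \<in> S" "d x p \<le> \<epsilon>" for p
  proof -
    define y where "y = \<pi> p"
    have y: "y \<in> X" "y \<in> S" "d p y \<le> \<kappa> * \<delta>" using near[OF p(1)] by (auto simp: y_def)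
    have dy: "d x0 y \<le> \<epsilon> + 2 * (\<kappa> * \<delta>)"
      using triangle[OF x0(2) x y(2)] triangle[OF x p(1) y(2)] commute[of x x0] x0(3) y(3) p(2) by linarith
    have Zp: "Z p = v y" by (simp add: Z_def y_def)
    have Zm: "Z p \<le> m" using m_ge[OF p(1)] p(2) \<epsilon>0 by simp
    show ?thesis
    proof (cases "4 * (\<kappa> * h) \<le> \<epsilon>")
      case False
      have "v y - v x0 \<le> M * \<rho> x0 y" using M(2)[OF y(1) x0(1)] \<rho>_sym[OF y(1) x0(1)] by (simp add: abs_le_iff)
      moreover have "\<rho> x0 y \<le> 12 * (\<kappa> * h)"
        using \<rho>_upper_crude[OF x0(1) y(1)] dy False \<kappa>\<delta> h\<kappa> by linarith
      then have "M * \<rho> x0 y \<le> M * (12 * (\<kappa> * h))" using M(1) by (rule mult_left_mono)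
      moreover have "M * (12 * (\<kappa> * h)) \<le> Err"
      proof -
        have "12 * (\<kappa> * h) \<le> 6 * (10 * (\<kappa> * h) + \<epsilon> * b + 5 * (\<epsilon> * distortion))"
          using err_nonneg h\<kappa> h_pos by argo
        then have "M * (12 * (\<kappa> * h)) \<le> M * (6 * (10 * (\<kappa> * h) + \<epsilon> * b + 5 * (\<epsilon> * distortion)))"
          using M(1) by (rule mult_left_mono)
        also have "M * (6 * (10 * (\<kappa> * h) + \<epsilon> * b + 5 * (\<epsilon> * distortion))) = Err"
          by (simp only: Err_def mult.assoc mult.left_commute)
        finally show ?thesis .
      qed
      ultimately show ?thesis using Zp Zm by linarith
    next
      case True
      have q: "1 + distortion > 0" "distortion \<ge> 0" using distortion_nonneg by auto
      have small: "2 * \<epsilon> - 2 * (\<kappa> * h) > 0" using True \<epsilon>0 h\<kappa> h_pos by linarith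
      define R where "R = (2 * \<epsilon> - 2 * (\<kappa> * h)) / (1 + distortion)"
      have R: "R > 0" "(1 + distortion) * R = 2 * \<epsilon> - 2 * (\<kappa> * h)" using small q by (auto simp: R_def)
      define a where "a = (m - v x0) / R"
      have a: "a \<ge> 0" "v x0 + a * R = m" using m0 R by (auto simp: a_def)
      define A where "A = {y \<in> X. y \<noteq> x0 \<and> \<rho> x0 y < R}"
      have inA: "d x z \<le> \<kappa> * \<delta> + (2 * \<epsilon> - 2 * (\<kappa> * h))" "z \<in> S" if z: "z \<in> A" for z
      proof -
        have zX: "z \<in> X" "\<rho> x0 z < R" using z by (auto simp: A_def)
        show zS: "z \<in> S" using zX X_sub by blast
        have "d x0 z \<le> (1 + distortion) * \<rho> x0 z" by (rule d_le_\<rho>[OF x0(1) zX(1)])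
        also have "\<dots> \<le> (1 + distortion) * R" using zX(2) q by (intro mult_left_mono) auto
        finally show "d x z \<le> \<kappa> * \<delta> + (2 * \<epsilon> - 2 * (\<kappa> * h))"
          using R(2) triangle[OF x x0(2) zS] x0(3) by linarith
      qed
      have outer: "v z \<le> v x0 + a * \<rho> x0 z" if z: "z \<in> X - A" "d x z \<le> 2 * \<epsilon>" for z
      proof (cases "z = x0")
        case True
        then show ?thesis by (simp add: \<rho>_self)
      next
        case False
        then have "R \<le> \<rho> x0 z" using z(1) by (auto simp: A_def)
        then have "a * R \<le> a * \<rho> x0 z" using a(1) by (intro mult_left_mono)
        moreover have "v z \<le> m" using m_ge[of z] vZ z X_sub by auto
        ultimately show ?thesis using a(2) by linarith
      qed
      have cone: "v y \<le> v x0 + a * \<rho> x0 y"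
      proof (cases "y \<in> A")
        case False
        have "d x y \<le> 2 * \<epsilon>" using triangle[OF x p(1) y(2)] p(2) y(3) \<kappa>\<delta> True \<epsilon>0 by linarith
        then show ?thesis using outer y(1) False by blast
      next
        case inside: True
        show ?thesis
        proof (rule graph_cone_comparison[OF v _ x0(1) _ a(1) _ inside])
          show "A \<subseteq> X - L"
          proof
            fix z assume z: "z \<in> A"
            have "z \<notin> L"
            proof
              assume "z \<in> L"
              then show False using far[of z] inA(1)[OF z] \<kappa>\<delta> h\<kappa> h_pos by linarith
            qed
            then show "z \<in> X - L" using z by (simp add: A_def)
          qed
          show "x0 \<notin> A" by (simp add: A_def)
          fix z w assume z: "z \<in> X - A" and w: "w \<in> A" "dist w z \<le> h"
          have zS: "z \<in> S" using z X_sub by blast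
          have "d w z \<le> \<kappa> * dist w z" by (rule d_le_\<kappa>[OF inA(2)[OF w(1)] zS])
          also have "\<dots> \<le> \<kappa> * h" using w(2) \<kappa>_ge_1 by (intro mult_left_mono) auto
          finally have "d x z \<le> 2 * \<epsilon>"
            using triangle[OF x inA(2)[OF w(1)] zS] inA(1)[OF w(1)] \<kappa>\<delta> h\<kappa> h_pos by linarith
          then show "v z \<le> v x0 + a * \<rho> x0 z" using outer z by blast
        qed
      qed
      define x' where "x' = \<kappa> * h / \<epsilon>"
      have "0 < \<kappa> * h" using h\<kappa> h_pos by linarith
      then have x': "0 \<le> x'" "x' \<le> 1/4" "\<epsilon> * x' = \<kappa> * h"
        using True \<epsilon>0 by (simp_all add: x'_def divide_le_eq)
      have c: "0 \<le> 2 * h / \<epsilon>" "2 * h / \<epsilon> \<le> 2 * x'" using h\<kappa> h_pos \<epsilon>0 by (auto simp: x'_def divide_right_mono)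
      have "\<rho> x0 y \<le> (1 + b) * d x0 y + 2 * h" using \<rho>_upper[OF x0(1) y(1)] by (simp add: b_def)
      also have "(1 + b) * d x0 y \<le> (1 + b) * (\<epsilon> * (1 + x'))"
        using dy \<kappa>\<delta> x'(3) b by (intro mult_left_mono) (auto simp: algebra_simps)
      finally have \<rho>y: "\<rho> x0 y \<le> \<epsilon> * ((1 + x') * (1 + b) + 2 * h / \<epsilon>)"
        using \<epsilon>0 by (simp add: algebra_simps)
      have "\<rho> x0 y / R \<le> (1 + distortion) * ((1 + x') * (1 + b) + 2 * h / \<epsilon>) / (2 * (1 - x'))"
      proof -
        have "\<rho> x0 y / R \<le> \<epsilon> * ((1 + x') * (1 + b) + 2 * h / \<epsilon>) / R"
          using \<rho>y R(1) by (intro divide_right_mono) auto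
        also have "\<epsilon> * ((1 + x') * (1 + b) + 2 * h / \<epsilon>) / R =
            (1 + distortion) * ((1 + x') * (1 + b) + 2 * h / \<epsilon>) / (2 * (1 - x'))"
        proof -
          have "R = 2 * \<epsilon> * (1 - x') / (1 + distortion)" using x'(3) by (simp add: R_def algebra_simps)
          moreover
          have "e * k / (2 * e * l / q) = q * k / (2 * l)" if "e > 0" for e k l q :: real
            using that by (simp add: field_simps)
          ultimately show ?thesis using \<epsilon>0 by metis
        qed
        finally show ?thesis .
      qed
      also have "\<dots> \<le> (1 + 10 * x' + b + 5 * distortion) / 2"
        by (rule half_quotient_bound[OF x'(1,2) b q(2) c])
      finally have quot: "\<rho> x0 y / R \<le> (1 + 10 * x' + b + 5 * distortion) / 2" .
      have gap: "m - v x0 \<le> 6 * M * \<epsilon>"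
      proof -
        obtain z where z: "z \<in> S" "d x z \<le> 2 * \<epsilon>" "Z z = m"
          using ball_sup_attained[OF as x, of "2 * \<epsilon>"] \<epsilon>0 unfolding m_def by auto
        have \<pi>z: "\<pi> z \<in> X" "\<pi> z \<in> S" "d z (\<pi> z) \<le> \<kappa> * \<delta>" using near[OF z(1)] by auto
        have "d x0 (\<pi> z) \<le> 2 * \<epsilon> + 2 * (\<kappa> * \<delta>)"
          using triangle[OF x0(2) x \<pi>z(2)] triangle[OF x z(1) \<pi>z(2)] commute[of x x0] x0(3) \<pi>z(3) z(2) by linarith
        then have "\<rho> x0 (\<pi> z) \<le> 6 * \<epsilon>"
          using \<rho>_upper_crude[OF x0(1) \<pi>z(1)] True \<kappa>\<delta> \<epsilon> h\<kappa> by linarith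
        then have "M * \<rho> x0 (\<pi> z) \<le> M * (6 * \<epsilon>)" using M(1) by (rule mult_left_mono)
        moreover have "m - v x0 \<le> M * \<rho> x0 (\<pi> z)"
          using M(2)[OF x0(1) \<pi>z(1)] z(3) by (simp add: Z_def abs_le_iff)
        ultimately show ?thesis by simp
      qed
      have "a * \<rho> x0 y = (m - v x0) * (\<rho> x0 y / R)" by (simp add: a_def)
      also have "\<dots> \<le> (m - v x0) * ((1 + 10 * x' + b + 5 * distortion) / 2)"
        using quot m0 by (intro mult_left_mono) auto
      finally have "a * \<rho> x0 y \<le> (m - v x0) * ((1 + 10 * x' + b + 5 * distortion) / 2)" .
      then have "2 * v y \<le> v x0 + m + (m - v x0) * (10 * x' + b + 5 * distortion)"
        using cone by (simp add: field_simps)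
      moreover have "(m - v x0) * (10 * x' + b + 5 * distortion) \<le> 6 * M * \<epsilon> * (10 * x' + b + 5 * distortion)"
        using gap x' b q by (intro mult_right_mono) auto
      moreover have "6 * M * \<epsilon> * (10 * x' + b + 5 * distortion) = Err"
        unfolding Err_def x'(3)[symmetric] by (simp add: algebra_simps)
      ultimately show ?thesis using Zp by linarith
    qed
  qed
  moreover obtain p where "p \<in> S" "d x p \<le> \<epsilon>" "Z p = ball_sup Z \<epsilon> x"
    using ball_sup_attained[OF as x less_imp_le[OF \<epsilon>0]] by blast
  ultimately have "2 * ball_sup Z \<epsilon> x \<le> v x0 + m + Err" by metis
  moreover have "Err = 6 * M * (10 * \<kappa> * h + 4 * (\<epsilon> * \<delta>) / (t0 * h) + 5 * \<epsilon> * distortion)"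
    by (simp add: Err_def b_def mult.assoc mult.left_commute)
  ultimately show ?thesis unfolding Z_def[abs_def] m_def x0_def by simp
qed

end

section \<open>One-sided error estimates\<close>

context intrinsic_domain
begin

definition core_of :: "'a set \<Rightarrow> real \<Rightarrow> 'a set" where
  "core_of lab \<epsilon> = {x \<in> S. \<forall>z\<in>lab. 2 * \<epsilon> \<le> d x z}"

definition boundary_error :: "real \<Rightarrow> real \<Rightarrow> real \<Rightarrow> real" where
  "boundary_error \<Lambda> M K = 3 * \<Lambda> + 6 * M + 4 * M * \<kappa> + K"

definition consistency_error :: "real \<Rightarrow> real \<Rightarrow> real \<Rightarrow> real" where
  "consistency_error M C1 t0 = 6 * M * (10 * \<kappa> + 4 * C1 / t0 + 5 * B)"

end

text \<open>The hypotheses are one-sided, so that they hold for the pair \<open>u\<close>, \<open>v\<close> as well as for \<open>-u\<close>, \<open>-v\<close>.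
  The last two assumptions say that the relative errors of the graph distance amount to at most a
  multiple of \<open>h\<close> over the distance \<open>\<epsilon>\<close>.\<close>

locale comparison_setting = graph_on_domain S d B X L \<eta> t0 h \<delta> \<pi>
  for S :: "'a::euclidean_space set" and d B X L \<eta> t0 h \<delta> \<pi> +
  fixes lab :: "'a set" and u v :: "'a \<Rightarrow> real" and \<Lambda> M K \<epsilon> C1 U\<^sub>m :: real
  assumes lab: "lab \<subseteq> S"
    and L_near_lab: "\<And>l. l \<in> L \<Longrightarrow> \<exists>z\<in>lab. dist l z \<le> \<delta>"
    and lab_data: "\<And>z. z \<in> lab \<Longrightarrow> \<exists>l\<in>L. dist z l \<le> \<delta> \<and> u z \<le> v l + K * \<delta>"
    and u_cc: "cone_comparison lab u"
    and u_lip: "\<And>x y. x \<in> S \<Longrightarrow> y \<in> S \<Longrightarrow> u x - u y \<le> \<Lambda> * d x y"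
    and u_bound: "\<And>x. x \<in> S \<Longrightarrow> \<bar>u x\<bar> \<le> U\<^sub>m"
    and v_balanced: "balanced (\<lambda>x. - v x)"
    and v_lip: "\<And>x y. x \<in> X \<Longrightarrow> y \<in> X \<Longrightarrow> \<bar>v x - v y\<bar> \<le> M * \<rho> x y"
    and nonneg_consts: "\<Lambda> \<ge> 0" "M \<ge> 0" "K \<ge> 0"
    and \<epsilon>_ge: "2 * h \<le> \<epsilon>" and \<epsilon>_le: "\<epsilon> \<le> 1"
    and scale1: "\<epsilon> * \<delta> \<le> C1 * h * h" and scale2: "\<epsilon> * h powr (4/5) \<le> h"
begin

abbreviation core :: "'a set" where
  "core \<equiv> core_of lab \<epsilon>"

abbreviation boundary_const :: real where
  "boundary_const \<equiv> boundary_error \<Lambda> M K"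

abbreviation consistency_const :: real where
  "consistency_const \<equiv> consistency_error M C1 t0"

definition lower_env :: "'a \<Rightarrow> real" where
  "lower_env x = - ball_sup (\<lambda>x. - v (\<pi> x)) \<epsilon> x"

lemma \<epsilon>_pos: "\<epsilon> > 0"
  using \<epsilon>_ge h_pos by simp

lemma u_continuous: "continuous_on S u"
  using u_lip nonneg_consts(1) by (rule continuous_on_if_lipschitz)

lemma u_attains: "attains_sup u"
  using u_continuous by (rule attains_sup_continuous)

lemma lower_env_le: "x \<in> S \<Longrightarrow> lower_env x \<le> v (\<pi> x)"
  using ball_sup_centre[OF attains_sup_cloud[of "\<lambda>x. - v x"], of x \<epsilon>] \<epsilon>_pos
  by (simp add: lower_env_def)

lemma lower_env_superharmonic:
  assumes "x \<in> core"
  shows "\<exists>w\<in>S. d x w \<le> \<epsilon> \<and> (\<forall>w'\<in>S. d x w' \<le> \<epsilon> \<longrightarrow>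
    lower_env w + lower_env w' \<le> 2 * lower_env x + consistency_const * h)"
proof -
  have x: "x \<in> S" and far: "\<And>z. z \<in> lab \<Longrightarrow> 2 * \<epsilon> \<le> d x z" using assms by (auto simp: core_of_def)
  let ?f = "\<lambda>x. - v (\<pi> x)"
  define Err where "Err = 6 * M * (10 * \<kappa> * h + 4 * (\<epsilon> * \<delta>) / (t0 * h) + 5 * \<epsilon> * distortion)"
  have "2 * ball_sup ?f \<epsilon> x \<le> ?f x + ball_sup ?f (2 * \<epsilon>) x + Err"
    unfolding Err_def
  proof (rule cloud_ball_sup_doubling[OF v_balanced nonneg_consts(2) _ \<epsilon>_ge x])
    show "\<bar>- v x - - v y\<bar> \<le> M * \<rho> x y" if "x \<in> X" "y \<in> X" for x y
      using v_lip[OF that] by simp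
    fix l assume l: "l \<in> L"
    then obtain z where z: "z \<in> lab" "dist l z \<le> \<delta>" using L_near_lab by blast
    have S: "l \<in> S" "z \<in> S" using l z lab L_sub X_sub by auto
    have "d l z \<le> \<kappa> * dist l z" by (rule d_le_\<kappa>[OF S])
    also have "\<dots> \<le> \<kappa> * \<delta>" using z(2) \<kappa>_ge_1 by (intro mult_left_mono) auto
    finally show "2 * \<epsilon> - \<kappa> * \<delta> \<le> d x l" using far[OF z(1)] triangle[OF x S] by linarith
  qed
  moreover have "Err \<le> consistency_const * h"
  proof -
    have t0: "t0 > 0" using kernel_pos[OF kernel] by simp
    have "4 * (\<epsilon> * \<delta>) / (t0 * h) \<le> 4 * (C1 * h * h) / (t0 * h)"
      using scale1 t0 h_pos by (intro divide_right_mono) auto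
    also have "\<dots> = 4 * C1 / t0 * h" using h_pos by simp
    finally have 1: "4 * (\<epsilon> * \<delta>) / (t0 * h) \<le> 4 * C1 / t0 * h" .
    have "5 * \<epsilon> * distortion = 5 * B * (\<epsilon> * h powr (4/5))" by (simp add: distortion_def)
    also have "\<dots> \<le> 5 * B * h" using scale2 B_nonneg by (intro mult_left_mono) auto
    finally have "10 * \<kappa> * h + 4 * (\<epsilon> * \<delta>) / (t0 * h) + 5 * \<epsilon> * distortion \<le>
        (10 * \<kappa> + 4 * C1 / t0 + 5 * B) * h" using 1 by (simp add: algebra_simps)
    then have "Err \<le> 6 * M * ((10 * \<kappa> + 4 * C1 / t0 + 5 * B) * h)"
      unfolding Err_def using nonneg_consts(2) by (intro mult_left_mono) auto
    then show ?thesis by (simp add: consistency_error_def mult.assoc)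
  qed
  ultimately have "2 * ball_sup ?f \<epsilon> x \<le> ?f x + ball_sup ?f (2 * \<epsilon>) x + consistency_const * h" by linarith
  from ball_sup_subharmonic[OF attains_sup_cloud[of "\<lambda>x. - v x"] x less_imp_le[OF \<epsilon>_pos] this]
  obtain w where w: "w \<in> S" "d x w \<le> \<epsilon>" "\<And>w'. w' \<in> S \<Longrightarrow> d x w' \<le> \<epsilon> \<Longrightarrow>
      2 * ball_sup ?f \<epsilon> x - consistency_const * h \<le> ball_sup ?f \<epsilon> w + ball_sup ?f \<epsilon> w'"
    by blast
  show ?thesis
  proof (intro bexI[of _ w] conjI ballI impI)
    fix w' assume "w' \<in> S" "d x w' \<le> \<epsilon>"
    from w(3)[OF this] show "lower_env w + lower_env w' \<le> 2 * lower_env x + consistency_const * h"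
      by (simp add: lower_env_def)
  qed (use w in auto)
qed

text \<open>Outside the core there is a point of \<open>lab\<close> within \<open>2 \<epsilon>\<close>, and the points at which the supremum
  and the infimum are attained have distance at most \<open>3 \<epsilon>\<close> from it.\<close>

lemma boundary_estimate:
  assumes x: "x \<in> S" "x \<notin> core"
  shows "ball_sup u \<epsilon> x - lower_env x \<le> boundary_const * \<epsilon>"
proof -
  obtain z where z: "z \<in> lab" "d x z < 2 * \<epsilon>" using x by (auto simp: core_of_def not_le)
  have zS: "z \<in> S" using z lab by blast
  obtain l where l: "l \<in> L" "dist z l \<le> \<delta>" "u z \<le> v l + K * \<delta>" using lab_data[OF z(1)] by blast
  have lX: "l \<in> X" "l \<in> S" using l L_sub X_sub by auto
  have \<epsilon>h: "\<delta> \<le> \<epsilon>" "2 * h \<le> \<epsilon>" "4 * \<delta> \<le> h" using step_bounds \<epsilon>_ge h_pos by auto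
  obtain y where y: "y \<in> S" "d x y \<le> \<epsilon>" "u y = ball_sup u \<epsilon> x"
    using ball_sup_attained[OF u_attains x(1) less_imp_le[OF \<epsilon>_pos]] by blast
  have "d y z \<le> 3 * \<epsilon>" using triangle[OF y(1) x(1) zS] commute[of x y] y(2) z(2) by linarith
  then have "\<Lambda> * d y z \<le> \<Lambda> * (3 * \<epsilon>)" using nonneg_consts(1) by (rule mult_left_mono)
  then have 1: "ball_sup u \<epsilon> x \<le> u z + 3 * \<Lambda> * \<epsilon>" using u_lip[OF y(1) zS] y(3) by linarith
  obtain p where p: "p \<in> S" "d x p \<le> \<epsilon>" "- v (\<pi> p) = ball_sup (\<lambda>x. - v (\<pi> x)) \<epsilon> x"
    using ball_sup_attained[OF attains_sup_cloud[of "\<lambda>x. - v x"] x(1) less_imp_le[OF \<epsilon>_pos]] by blast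
  have W: "lower_env x = v (\<pi> p)" using p(3) by (simp add: lower_env_def)
  have "d l z \<le> \<kappa> * dist l z" by (rule d_le_\<kappa>[OF lX(2) zS])
  also have "\<dots> \<le> \<kappa> * \<delta>" using l(2) \<kappa>_ge_1 by (intro mult_left_mono) (auto simp: dist_commute)
  finally have "d l p \<le> \<kappa> * \<delta> + 3 * \<epsilon>"
    using triangle[OF lX(2) zS p(1)] triangle[OF zS x(1) p(1)] commute[of x z] z(2) p(2) by linarith
  moreover have "\<kappa> * (4 * \<delta>) \<le> \<kappa> * h" "\<kappa> * (2 * h) \<le> \<kappa> * \<epsilon>"
    using \<epsilon>h \<kappa>_ge_1 by (auto intro!: mult_left_mono)
  ultimately have "2 * d l p + 3 * \<kappa> * h \<le> 6 * \<epsilon> + 4 * (\<kappa> * \<epsilon>)"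
    using mult_pos_pos[of \<kappa> \<epsilon>] \<kappa>_ge_1 \<epsilon>_pos by linarith
  then have "M * (2 * d l p + 3 * \<kappa> * h) \<le> M * (6 * \<epsilon> + 4 * (\<kappa> * \<epsilon>))"
    using nonneg_consts(2) by (rule mult_left_mono)
  then have "\<bar>v (\<pi> l) - v (\<pi> p)\<bar> \<le> M * (6 * \<epsilon> + 4 * (\<kappa> * \<epsilon>))"
    using cloud_lipschitz[OF nonneg_consts(2) v_lip lX(2) p(1)] by simp
  then have 2: "v l - v (\<pi> p) \<le> (6 * M + 4 * M * \<kappa>) * \<epsilon>"
    using \<pi>_id[OF lX(1)] by (simp add: abs_le_iff algebra_simps)
  have "K * \<delta> \<le> K * \<epsilon>" using \<epsilon>h nonneg_consts(3) by (intro mult_left_mono)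
  then show ?thesis using 1 2 l(3) W by (simp add: boundary_error_def algebra_simps)
qed

text \<open>A subsolution with slope at least \<open>t\<close> per step becomes strict after composition with a
  quadratic, which makes up for the consistency error of the graph. The shift \<open>c\<close> makes the values
  nonnegative, where the square is increasing.\<close>

lemma estimate_from_slope:
  assumes t: "t > 0" and \<beta>: "\<beta> > 0" "2 * consistency_const * h < \<beta> * t\<^sup>2" and E: "E \<ge> 0"
    and sub: "\<And>\<eta>'. \<eta>' > 0 \<Longrightarrow> \<exists>U. (\<forall>x\<in>S. U x \<le> ball_sup u \<epsilon> x \<and> u x - E \<le> U x) \<and>
      (\<forall>x\<in>core. \<exists>w\<in>S. d x w \<le> \<epsilon> \<and> U x + t - \<eta>' \<le> U w \<and>
        (\<forall>w'\<in>S. d x w' \<le> \<epsilon> \<longrightarrow> 2 * U x - \<eta>' \<le> U w + U w'))"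
    and x: "x \<in> S"
  shows "u x - v (\<pi> x) \<le> E + \<beta> * (2 * U\<^sub>m + E)\<^sup>2 + boundary_const * \<epsilon>"
proof -
  define Q where "Q = 2 * U\<^sub>m + E"
  define c where "c = U\<^sub>m + E"
  have Um: "U\<^sub>m \<ge> 0" using u_bound[OF x] by (meson abs_ge_zero order_trans)
  have Q: "Q \<ge> 0" using Um E by (simp add: Q_def)
  define \<eta>' where "\<eta>' = min t (\<beta> * t\<^sup>2 / 2 / (2 * \<beta> * t + 1 + 2 * \<beta> * Q))"
  have den: "2 * \<beta> * t + 1 + 2 * \<beta> * Q > 0" using \<beta>(1) t Q by (simp add: add_pos_nonneg)
  have \<eta>': "\<eta>' > 0" "\<eta>' \<le> t" using t \<beta>(1) den by (auto simp: \<eta>'_def)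
  have "\<eta>' \<le> \<beta> * t\<^sup>2 / 2 / (2 * \<beta> * t + 1 + 2 * \<beta> * Q)" by (simp add: \<eta>'_def)
  then have small: "\<eta>' * (2 * \<beta> * t + 1 + 2 * \<beta> * Q) \<le> \<beta> * t\<^sup>2 / 2"
    unfolding le_divide_eq using den by simp
  obtain U where U: "\<And>x. x \<in> S \<Longrightarrow> U x \<le> ball_sup u \<epsilon> x" "\<And>x. x \<in> S \<Longrightarrow> u x - E \<le> U x"
      "\<And>x. x \<in> core \<Longrightarrow> \<exists>w\<in>S. d x w \<le> \<epsilon> \<and> U x + t - \<eta>' \<le> U w \<and>
        (\<forall>w'\<in>S. d x w' \<le> \<epsilon> \<longrightarrow> 2 * U x - \<eta>' \<le> U w + U w')"
    using sub[OF \<eta>'(1)] by blast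
  have q_le: "ball_sup u \<epsilon> y \<le> U\<^sub>m" if "y \<in> S" for y
    by (rule ball_sup_le[OF u_attains that]) (use u_bound \<epsilon>_pos in \<open>auto simp: abs_le_iff\<close>)
  have range: "0 \<le> U y + c" "U y + c \<le> Q" if "y \<in> S" for y
    using U(1,2)[OF that] q_le[OF that] u_bound[OF that] by (auto simp: c_def Q_def abs_le_iff)
  define V where "V y = U y + \<beta> * (U y + c)\<^sup>2" for y
  have V_ge: "U y \<le> V y" for y using \<beta>(1) by (simp add: V_def)
  have V_le: "V y \<le> ball_sup u \<epsilon> y + \<beta> * Q\<^sup>2" if "y \<in> S" for y
    unfolding V_def using U(1)[OF that] range[OF that] \<beta>(1)
    by (intro add_mono mult_left_mono power_mono) auto
  have strict: "\<exists>w\<in>S. d y w \<le> \<epsilon> \<and> (\<forall>w'\<in>S. d y w' \<le> \<epsilon> \<longrightarrow> 2 * V y + \<beta> * t\<^sup>2 / 2 \<le> V w + V w')"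
    if y: "y \<in> core" for y
  proof -
    have yS: "y \<in> S" using y by (simp add: core_of_def)
    obtain w where w: "w \<in> S" "d y w \<le> \<epsilon>" "U y + t - \<eta>' \<le> U w"
        "\<And>w'. w' \<in> S \<Longrightarrow> d y w' \<le> \<epsilon> \<Longrightarrow> 2 * U y - \<eta>' \<le> U w + U w'"
      using U(3)[OF y] by blast
    have "2 * V y + \<beta> * t\<^sup>2 / 2 \<le> V w + V w'" if w': "w' \<in> S" "d y w' \<le> \<epsilon>" for w'
    proof -
      define a where "a = U w - U y"
      define b where "b = U y - U w'"
      have "\<beta> * (t - \<eta>')\<^sup>2 - (1 + 2 * \<beta> * Q) * \<eta>' \<le>
          (a - b) + \<beta> * ((U y + c + a)\<^sup>2 + (U y + c - b)\<^sup>2 - 2 * (U y + c)\<^sup>2)"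
        by (rule convex_gain) (use w(3) w(4)[OF w'] \<eta>' range[OF yS] \<beta>(1) in \<open>auto simp: a_def b_def\<close>)
      also have "\<dots> = V w + V w' - 2 * V y" by (simp add: V_def a_def b_def algebra_simps)
      finally have "\<beta> * (t - \<eta>')\<^sup>2 - (1 + 2 * \<beta> * Q) * \<eta>' \<le> V w + V w' - 2 * V y" .
      moreover have "\<beta> * t\<^sup>2 - 2 * \<beta> * t * \<eta>' \<le> \<beta> * (t - \<eta>')\<^sup>2"
        using \<beta>(1) by (simp add: power2_eq_square algebra_simps)
      ultimately show ?thesis using small by (simp add: algebra_simps)
    qed
    then show ?thesis using w(1,2) by blast
  qed
  have "V x - lower_env x \<le> \<beta> * Q\<^sup>2 + boundary_const * \<epsilon>"
  proof (rule step_comparison_principle[where near = "\<lambda>x w. d x w \<le> \<epsilon>" and S = S and I = core, OF strict lower_env_superharmonic])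
    show "consistency_const * h < \<beta> * t\<^sup>2 / 2" using \<beta>(2) by simp
    show "V y - lower_env y \<le> \<beta> * Q\<^sup>2 + boundary_const * \<epsilon>" if "y \<in> S - core" for y
      using V_le[of y] boundary_estimate[of y] that by auto
    define Vl where "Vl = Min (v ` X)"
    show "V y - lower_env y \<le> U\<^sub>m + \<beta> * Q\<^sup>2 - Vl" if y: "y \<in> S" for y
    proof -
      obtain p where "p \<in> S" "- v (\<pi> p) = ball_sup (\<lambda>x. - v (\<pi> x)) \<epsilon> y"
        using ball_sup_attained[OF attains_sup_cloud[of "\<lambda>x. - v x"] y less_imp_le[OF \<epsilon>_pos]] by blast
      then have "lower_env y = v (\<pi> p)" "\<pi> p \<in> X" using \<pi>_mem by (auto simp: lower_env_def)
      moreover have "Vl \<le> v (\<pi> p)" unfolding Vl_def using finite_X \<open>\<pi> p \<in> X\<close> by simp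
      ultimately show ?thesis using V_le[OF y] q_le[OF y] by linarith
    qed
  qed (use x in auto)
  then show ?thesis
    using lower_env_le[OF x] U(2)[OF x] V_ge[of x] by (simp add: Q_def)
qed

lemma ball_sup_u_subharmonic:
  assumes "x \<in> core"
  shows "\<exists>w\<in>S. d x w \<le> \<epsilon> \<and> ball_sup u \<epsilon> w = ball_sup u (2 * \<epsilon>) x \<and>
    (\<forall>w'\<in>S. d x w' \<le> \<epsilon> \<longrightarrow> ball_sup u \<epsilon> w' \<le> ball_sup u \<epsilon> w \<and>
      2 * ball_sup u \<epsilon> x \<le> ball_sup u \<epsilon> w + ball_sup u \<epsilon> w')"
proof -
  have x: "x \<in> S" and far: "\<And>z. z \<in> lab \<Longrightarrow> 2 * \<epsilon> \<le> d x z" using assms by (auto simp: core_of_def)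
  have "2 * ball_sup u \<epsilon> x \<le> u x + ball_sup u (2 * \<epsilon>) x + 0"
    using ball_sup_doubling[OF u_cc u_continuous x \<epsilon>_pos far] by simp
  from ball_sup_subharmonic[OF u_attains x less_imp_le[OF \<epsilon>_pos] this] show ?thesis by simp
qed

lemma steps_to:
  assumes "x \<in> S" "z \<in> S" "d x z \<le> real N * \<epsilon>"
  shows "\<exists>p. (\<forall>i<N. p (Suc i) \<in> S \<and> d (p i) (p (Suc i)) \<le> \<epsilon>) \<and> p 0 = x \<and> p N = z"
  using assms(1,3)
proof (induction N arbitrary: x)
  case 0
  then have "x = z" using zero[OF 0(1) assms(2)] nonneg[of x z] by simp
  then show ?case by auto
next
  case (Suc N)
  have "d x z \<le> \<epsilon> + real N * \<epsilon>" "0 \<le> real N * \<epsilon>" "0 \<le> \<epsilon>"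
    using Suc.prems(2) \<epsilon>_pos by (auto simp: algebra_simps)
  then obtain y where y: "y \<in> S" "d x y \<le> \<epsilon>" "d y z \<le> real N * \<epsilon>"
    using between_point[OF Suc.prems(1) assms(2)] by blast
  obtain p where p: "\<forall>i<N. p (Suc i) \<in> S \<and> d (p i) (p (Suc i)) \<le> \<epsilon>" "p 0 = y" "p N = z"
    using Suc.IH[OF y(1,3)] by blast
  define p' where "p' i = (case i of 0 \<Rightarrow> x | Suc j \<Rightarrow> p j)" for i
  have "p' (Suc i) \<in> S \<and> d (p' i) (p' (Suc i)) \<le> \<epsilon>" if "i < Suc N" for i
    using that p y by (cases i) (auto simp: p'_def)
  then show ?case using p by (intro exI[of _ p']) (auto simp: p'_def)
qed

text \<open>Without a bound on the gradient, a slope of size \<open>\<epsilon>\<close>, that is \<open>\<epsilon>\<^sup>2\<close> per step, is created at the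
  price of an error of order \<open>\<epsilon>\<close>.\<close>

lemma general_estimate:
  assumes "lab \<noteq> {}" and C: "consistency_const \<ge> 0" and h: "h \<le> \<epsilon> ^ 5" and x: "x \<in> S"
  shows "u x - v (\<pi> x) \<le> \<epsilon> * ((2 * (\<kappa> * diameter S) + 2) +
    (2 * consistency_const + 2) * (2 * U\<^sub>m + (2 * (\<kappa> * diameter S) + 2))\<^sup>2 + boundary_const)"
proof -
  define D where "D = \<kappa> * diameter S"
  have D: "D \<ge> 0" using \<kappa>_ge_1 diameter_ge_0[OF compact_imp_bounded[OF compact_S]] by (simp add: D_def)
  have Um: "U\<^sub>m \<ge> 0" using u_bound[OF x] by (meson abs_ge_zero order_trans)
  \<comment> \<open>a label, and with it the complement of the core, is within reach of \<open>N\<close> steps from everywhere\<close>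
  define N where "N = nat \<lceil>D / \<epsilon>\<rceil>"
  define t where "t = \<epsilon> * \<epsilon>"
  have t: "t > 0" using \<epsilon>_pos by (simp add: t_def)
  have "D / \<epsilon> \<le> real N" by (simp add: N_def real_nat_ceiling_ge)
  then have N: "D \<le> real N * \<epsilon>" using \<epsilon>_pos by (simp add: field_simps)
  have "0 \<le> D / \<epsilon>" using D \<epsilon>_pos by simp
  then have "real N = of_int \<lceil>D / \<epsilon>\<rceil>" by (simp add: N_def)
  then have "real N \<le> D / \<epsilon> + 1" using of_int_ceiling_le_add_one[of "D / \<epsilon>"] by linarith
  then have "real N * \<epsilon> \<le> (D / \<epsilon> + 1) * \<epsilon>" using \<epsilon>_pos by (intro mult_right_mono) auto
  also have "\<dots> = D + \<epsilon>" using \<epsilon>_pos by (simp add: field_simps)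
  finally have N': "real N * \<epsilon> \<le> D + 1" using \<epsilon>_le by simp
  define E where "E = 2 * real N * t"
  have "E = 2 * (real N * \<epsilon>) * \<epsilon>" by (simp add: E_def t_def)
  also have "\<dots> \<le> 2 * (D + 1) * \<epsilon>" using N' \<epsilon>_pos by (intro mult_right_mono) auto
  finally have E: "E \<le> (2 * D + 2) * \<epsilon>" "E \<ge> 0" using t by (auto simp: E_def algebra_simps)
  \<comment> \<open>\<open>\<beta> t\<^sup>2\<close> with \<open>t = \<epsilon>\<^sup>2\<close> has to exceed twice the consistency error, which is a multiple of \<open>h \<le> \<epsilon>\<^sup>5\<close>\<close>
  define \<beta> where "\<beta> = (2 * consistency_const + 2) * \<epsilon>"
  have \<beta>: "\<beta> > 0" using C \<epsilon>_pos by (simp add: \<beta>_def add_nonneg_pos)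
  have "\<beta> * t\<^sup>2 = 2 * consistency_const * \<epsilon> ^ 5 + 2 * \<epsilon> ^ 5"
    by (simp add: \<beta>_def t_def power2_eq_square eval_nat_numeral algebra_simps)
  moreover have "2 * consistency_const * h \<le> 2 * consistency_const * \<epsilon> ^ 5"
    using h C by (intro mult_left_mono) auto
  moreover have "0 < \<epsilon> ^ 5" using \<epsilon>_pos by simp
  ultimately have gain: "2 * consistency_const * h < \<beta> * t\<^sup>2" by linarith
  have "u x - v (\<pi> x) \<le> E + \<beta> * (2 * U\<^sub>m + E)\<^sup>2 + boundary_const * \<epsilon>"
  proof (rule estimate_from_slope[OF t \<beta> gain E(2) _ x])
    fix \<eta>' :: real assume "\<eta>' > 0"
    let ?near = "\<lambda>x w. w \<in> S \<and> d x w \<le> \<epsilon>"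
    obtain z where z: "z \<in> lab" using assms(1) by blast
    have zS: "z \<in> S" using z lab by blast
    moreover have "d z z < 2 * \<epsilon>" using d_self[OF zS] \<epsilon>_pos by simp
    ultimately have zS: "z \<in> S" "z \<notin> core" using z by (force simp: core_of_def)+
    obtain U where U: "\<And>x. x \<in> S \<Longrightarrow> U x \<le> ball_sup u \<epsilon> x"
      "\<And>x. x \<in> S \<Longrightarrow> ball_sup u \<epsilon> x - 2 * real N * t \<le> U x"
      "\<And>x. x \<in> core \<Longrightarrow> \<exists>w. ?near x w \<and> U x + t - \<eta>' \<le> U w \<and>
        (\<forall>w'. ?near x w' \<longrightarrow> 2 * U x - \<eta>' \<le> U w + U w')"
    proof (rule slope_patching[where near = ?near and S = S and I = core and q = "ball_sup u \<epsilon>" and N = N and t = t and \<eta> = \<eta>'])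
      show "w \<in> S \<and> ?near w x" if "x \<in> S" "?near x w" for x w using that commute[of x w] by auto
      show "core \<subseteq> S" by (auto simp: core_of_def)
      show "\<exists>w. ?near x w \<and> (\<forall>w'. ?near x w' \<longrightarrow> ball_sup u \<epsilon> w' \<le> ball_sup u \<epsilon> w \<and>
          2 * ball_sup u \<epsilon> x \<le> ball_sup u \<epsilon> w + ball_sup u \<epsilon> w')" if "x \<in> core" for x
        using ball_sup_u_subharmonic[OF that] by blast
      show "\<exists>z p. (\<forall>i<N. ?near (p i) (p (Suc i))) \<and> p 0 = x \<and> p N = z \<and> z \<notin> core" if "x \<in> S" for x
      proof -
        have "d x z \<le> real N * \<epsilon>" using d_le_diameter[OF that zS(1)] N by (simp add: D_def)
        from steps_to[OF that zS(1) this] show ?thesis using zS(2) by blast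
      qed
    qed (use t \<open>\<eta>' > 0\<close> in blast)+
    show "\<exists>U. (\<forall>x\<in>S. U x \<le> ball_sup u \<epsilon> x \<and> u x - E \<le> U x) \<and>
      (\<forall>x\<in>core. \<exists>w\<in>S. d x w \<le> \<epsilon> \<and> U x + t - \<eta>' \<le> U w \<and>
        (\<forall>w'\<in>S. d x w' \<le> \<epsilon> \<longrightarrow> 2 * U x - \<eta>' \<le> U w + U w'))"
    proof (intro exI[of _ U] conjI ballI)
      fix y assume y: "y \<in> S"
      show "U y \<le> ball_sup u \<epsilon> y" by (rule U(1)[OF y])
      show "u y - E \<le> U y"
        using U(2)[OF y] ball_sup_centre[OF u_attains y less_imp_le[OF \<epsilon>_pos]] by (simp add: E_def)
    next
      fix y assume "y \<in> core"
      then show "\<exists>w\<in>S. d y w \<le> \<epsilon> \<and> U y + t - \<eta>' \<le> U w \<and>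
          (\<forall>w'\<in>S. d y w' \<le> \<epsilon> \<longrightarrow> 2 * U y - \<eta>' \<le> U w + U w')" using U(3) by blast
    qed
  qed
  also have "\<dots> \<le> (2 * D + 2) * \<epsilon> + \<beta> * (2 * U\<^sub>m + (2 * D + 2))\<^sup>2 + boundary_const * \<epsilon>"
  proof -
    have "(2 * D + 2) * \<epsilon> \<le> (2 * D + 2) * 1" using D \<epsilon>_le by (intro mult_left_mono) auto
    then have "(2 * U\<^sub>m + E)\<^sup>2 \<le> (2 * U\<^sub>m + (2 * D + 2))\<^sup>2"
      using E Um by (intro power_mono) auto
    then have "\<beta> * (2 * U\<^sub>m + E)\<^sup>2 \<le> \<beta> * (2 * U\<^sub>m + (2 * D + 2))\<^sup>2"
      using \<beta> by (intro mult_left_mono) auto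
    then show ?thesis using E(1) by linarith
  qed
  finally show ?thesis unfolding D_def[symmetric] by (simp add: \<beta>_def algebra_simps)
qed

text \<open>A slope that is present from the start need not be created.\<close>

lemma estimate_with_gradient_bound:
  assumes "\<alpha> > 0" and C: "consistency_const \<ge> 0" and h: "h \<le> \<epsilon> ^ 3"
    and slope: "\<And>x. x \<in> core \<Longrightarrow> u x + \<alpha> * (2 * \<epsilon>) \<le> ball_sup u (2 * \<epsilon>) x" and x: "x \<in> S"
  shows "u x - v (\<pi> x) \<le> \<epsilon> * ((2 * consistency_const + 2) / \<alpha>\<^sup>2 * (2 * U\<^sub>m)\<^sup>2 + boundary_const)"
proof -
  define \<beta> where "\<beta> = (2 * consistency_const + 2) * \<epsilon> / \<alpha>\<^sup>2"
  have t: "\<alpha> * \<epsilon> > 0" using assms(1) \<epsilon>_pos by simp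
  have \<beta>: "\<beta> > 0" using C \<epsilon>_pos assms(1) by (simp add: \<beta>_def add_nonneg_pos)
  have "\<beta> * (\<alpha> * \<epsilon>)\<^sup>2 = 2 * consistency_const * \<epsilon> ^ 3 + 2 * \<epsilon> ^ 3"
    using assms(1) by (simp add: \<beta>_def power2_eq_square eval_nat_numeral field_simps)
  moreover have "2 * consistency_const * h \<le> 2 * consistency_const * \<epsilon> ^ 3"
    using h C by (intro mult_left_mono) auto
  moreover have "0 < \<epsilon> ^ 3" using \<epsilon>_pos by simp
  ultimately have gain: "2 * consistency_const * h < \<beta> * (\<alpha> * \<epsilon>)\<^sup>2" by linarith
  have "u x - v (\<pi> x) \<le> 0 + \<beta> * (2 * U\<^sub>m + 0)\<^sup>2 + boundary_const * \<epsilon>"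
  proof (rule estimate_from_slope[OF t \<beta> gain order_refl _ x])
    fix \<eta>' :: real assume \<eta>': "\<eta>' > 0"
    show "\<exists>U. (\<forall>x\<in>S. U x \<le> ball_sup u \<epsilon> x \<and> u x - 0 \<le> U x) \<and>
      (\<forall>x\<in>core. \<exists>w\<in>S. d x w \<le> \<epsilon> \<and> U x + \<alpha> * \<epsilon> - \<eta>' \<le> U w \<and>
        (\<forall>w'\<in>S. d x w' \<le> \<epsilon> \<longrightarrow> 2 * U x - \<eta>' \<le> U w + U w'))"
    proof (intro exI[of _ "ball_sup u \<epsilon>"] conjI ballI)
      fix y assume y: "y \<in> S"
      show "u y - 0 \<le> ball_sup u \<epsilon> y"
        using ball_sup_centre[OF u_attains y less_imp_le[OF \<epsilon>_pos]] by simp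
    next
      fix y assume y: "y \<in> core"
      obtain w where w: "w \<in> S" "d y w \<le> \<epsilon>" "ball_sup u \<epsilon> w = ball_sup u (2 * \<epsilon>) y"
        "\<And>w'. w' \<in> S \<Longrightarrow> d y w' \<le> \<epsilon> \<Longrightarrow> 2 * ball_sup u \<epsilon> y \<le> ball_sup u \<epsilon> w + ball_sup u \<epsilon> w'"
        using ball_sup_u_subharmonic[OF y] by blast
      have yS: "y \<in> S" and far: "\<And>z. z \<in> lab \<Longrightarrow> 2 * \<epsilon> \<le> d y z" using y by (auto simp: core_of_def)
      have "2 * ball_sup u \<epsilon> y \<le> u y + ball_sup u (2 * \<epsilon>) y"
        by (rule ball_sup_doubling[OF u_cc u_continuous yS \<epsilon>_pos far])
      then have "ball_sup u \<epsilon> y + \<alpha> * \<epsilon> - \<eta>' \<le> ball_sup u \<epsilon> w"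
        using slope[OF y] w(3) \<eta>' by simp
      moreover have "2 * ball_sup u \<epsilon> y - \<eta>' \<le> ball_sup u \<epsilon> w + ball_sup u \<epsilon> w'"
        if "w' \<in> S" "d y w' \<le> \<epsilon>" for w' using w(4)[OF that] \<eta>' by linarith
      ultimately show "\<exists>w\<in>S. d y w \<le> \<epsilon> \<and> ball_sup u \<epsilon> y + \<alpha> * \<epsilon> - \<eta>' \<le> ball_sup u \<epsilon> w \<and>
          (\<forall>w'\<in>S. d y w' \<le> \<epsilon> \<longrightarrow> 2 * ball_sup u \<epsilon> y - \<eta>' \<le> ball_sup u \<epsilon> w + ball_sup u \<epsilon> w')"
        using w(1,2) by blast
    qed simp
  qed
  then show ?thesis by (simp add: \<beta>_def algebra_simps)
qed

end

section \<open>Points of differentiability\<close>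

lemma norm_gradient_le:
  fixes u :: "'a::euclidean_space \<Rightarrow> real"
  assumes D: "GDERIV u y :> D" and "r > 0"
    and lip: "\<And>z. z \<in> ball y r \<Longrightarrow> u z - u y \<le> \<theta> * dist z y"
  shows "norm D \<le> max \<theta> 0"
proof (cases "D = 0")
  case False
  have "norm D \<le> \<theta> + e" if "e > 0" for e
  proof -
    obtain \<tau> where \<tau>: "\<tau> > 0" "\<And>z. norm (z - y) < \<tau> \<Longrightarrow> norm (u z - u y - (z - y) \<bullet> D) \<le> e * norm (z - y)"
      using D \<open>e > 0\<close> unfolding gderiv_def has_derivative_at_alt by blast
    define s where "s = min \<tau> r / 2"
    have s: "s > 0" "s < \<tau>" "s < r" using \<tau>(1) \<open>r > 0\<close> by (auto simp: s_def)
    define z where "z = y + (s / norm D) *\<^sub>R D"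
    have n: "norm (z - y) = s" using s False by (simp add: z_def)
    have i: "(z - y) \<bullet> D = s * norm D" using False by (simp add: z_def power2_norm_eq_inner[symmetric] power2_eq_square)
    have "u z - u y \<le> \<theta> * s" using lip[of z] s n by (simp add: dist_norm norm_minus_commute)
    moreover have "norm (u z - u y - s * norm D) \<le> e * s" using \<tau>(2)[of z] s n i by simp
    then have "s * norm D - e * s \<le> u z - u y" unfolding real_norm_def by linarith
    ultimately have "s * norm D \<le> s * (\<theta> + e)" by (simp add: algebra_simps)
    then show ?thesis using s(1) by simp
  qed
  then have "norm D \<le> \<theta>" by (rule field_le_epsilon)
  then show ?thesis by simp
qed simp

text \<open>For \<open>s\<close> much larger than \<open>norm w\<close> the distance from \<open>s e\<close> is nearly the linear function
  \<open>s - e \<bullet> w\<close> of \<open>w\<close>.\<close>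

lemma far_point_distance:
  fixes w e :: "'a::euclidean_space"
  assumes "norm e = 1" "norm w \<le> s" "s > 0"
  shows "norm (s *\<^sub>R e - w) \<le> s - e \<bullet> w + (norm w)\<^sup>2 / (2 * s)"
proof (rule power2_le_imp_le)
  define c where "c = (norm w)\<^sup>2 / (2 * s)"
  have "(norm (s *\<^sub>R e - w))\<^sup>2 = s\<^sup>2 * (e \<bullet> e) - 2 * s * (e \<bullet> w) + w \<bullet> w"
    by (simp add: power2_norm_eq_inner inner_diff_left inner_diff_right inner_commute)
      (simp add: power2_eq_square)
  then have "(norm (s *\<^sub>R e - w))\<^sup>2 = s\<^sup>2 - 2 * s * (e \<bullet> w) + (norm w)\<^sup>2"
    using assms(1) by (simp add: norm_eq_1 power2_norm_eq_inner[symmetric])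
  also have "\<dots> = s\<^sup>2 - 2 * s * (e \<bullet> w) + 2 * s * c" using assms(3) by (simp add: c_def)
  also have "\<dots> \<le> (s - e \<bullet> w + c)\<^sup>2"
  proof -
    have "(s - e \<bullet> w + c)\<^sup>2 = s\<^sup>2 - 2 * s * (e \<bullet> w) + 2 * s * c + (e \<bullet> w - c)\<^sup>2"
      by (simp add: power2_eq_square algebra_simps)
    then show ?thesis by simp
  qed
  finally show "(norm (s *\<^sub>R e - w))\<^sup>2 \<le> (s - e \<bullet> w + (norm w)\<^sup>2 / (2 * s))\<^sup>2" by (simp add: c_def)
  have "e \<bullet> w \<le> norm w" using norm_cauchy_schwarz[of e w] assms(1) by simp
  then show "0 \<le> s - e \<bullet> w + (norm w)\<^sup>2 / (2 * s)" using assms(2,3) by (simp add: add_nonneg_nonneg)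
qed

text \<open>Inside a ball contained in the domain the intrinsic distance is Euclidean, and comparison with
  cones takes this local form.\<close>

locale ball_with_cones =
  fixes u :: "'a::euclidean_space \<Rightarrow> real" and x0 :: 'a and R \<Lambda> :: real
  assumes R_pos: "R > 0" and \<Lambda>_nonneg: "\<Lambda> \<ge> 0"
    and lip: "\<And>a b. a \<in> ball x0 R \<Longrightarrow> b \<in> ball x0 R \<Longrightarrow> u a - u b \<le> \<Lambda> * dist a b"
    and cones: "\<And>y s \<theta> z. cball y s \<subseteq> ball x0 R \<Longrightarrow> s > 0 \<Longrightarrow> \<theta> \<ge> 0 \<Longrightarrow>
      (\<And>z. z \<in> cball y s \<Longrightarrow> u z \<le> u y + \<theta> * s) \<Longrightarrow> z \<in> cball y s \<Longrightarrow> u z \<le> u y + \<theta> * dist z y"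
begin

text \<open>The slope of \<open>u\<close> over a ball of fixed radius depends continuously on the centre and bounds the
  slope over smaller balls; so it bounds the Lipschitz constant near the centre.\<close>

lemma local_lipschitz:
  assumes y: "cball y (2 * s) \<subseteq> ball x0 R" "s > 0" "\<theta> \<ge> 0" "\<theta>' > \<theta>"
    and slope: "\<And>z. z \<in> cball y (2 * s) \<Longrightarrow> u z \<le> u y + \<theta> * (2 * s)"
  obtains r where "r > 0" "r \<le> s / 2" "\<And>a b. a \<in> ball y r \<Longrightarrow> b \<in> ball y r \<Longrightarrow> u a - u b \<le> \<theta>' * dist a b"
proof -
  define r where "r = min (s / 2) ((\<theta>' - \<theta>) * s / (\<Lambda> + \<theta> + 1))"
  have den: "\<Lambda> + \<theta> + 1 > 0" using \<Lambda>_nonneg y(3) by simp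
  have "r > 0" using y den by (simp add: r_def)
  moreover have "r \<le> s / 2" unfolding r_def by (rule min.cobounded1)
  ultimately have r: "r > 0" "r \<le> s / 2" by auto
  have "r \<le> (\<theta>' - \<theta>) * s / (\<Lambda> + \<theta> + 1)" by (simp add: r_def)
  then have "r * (\<Lambda> + \<theta> + 1) \<le> (\<theta>' - \<theta>) * s" using den by (simp add: le_divide_eq)
  then have r': "\<Lambda> * r + \<theta> * (s + r) \<le> \<theta>' * s" using r(1) by (simp add: algebra_simps)
  have "u a - u b \<le> \<theta>' * dist a b" if ab: "a \<in> ball y r" "b \<in> ball y r" for a b
  proof -
    have byr: "dist y b < r" using ab(2) by simp
    have sub: "cball b s \<subseteq> cball y (2 * s)"
    proof
      fix z assume "z \<in> cball b s"
      then show "z \<in> cball y (2 * s)" using dist_triangle[of y z b] byr r by simp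
    qed
    have yG: "y \<in> ball x0 R" using y(1,2) by force
    have bG: "b \<in> ball x0 R" using sub y(1,2) by force
    have "u z \<le> u b + \<theta>' * s" if z: "z \<in> cball b s" for z
    proof -
      have "u z \<le> u y + \<theta> * dist z y"
        using cones[OF y(1) _ y(3) slope, of z] y(2) sub z by auto
      also have "\<theta> * dist z y \<le> \<theta> * (s + r)"
        using z byr dist_triangle[of y z b] y(3) by (intro mult_left_mono) (auto simp: dist_commute)
      also have "u y \<le> u b + \<Lambda> * r"
      proof -
        have "\<Lambda> * dist y b \<le> \<Lambda> * r" using byr \<Lambda>_nonneg by (intro mult_left_mono) auto
        then show ?thesis using lip[OF yG bG] by linarith
      qed
      finally show ?thesis using r' by linarith
    qed
    moreover have "a \<in> cball b s" using dist_triangle[of b a y] ab r by (simp add: dist_commute)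
    ultimately have "u a \<le> u b + \<theta>' * dist a b"
      using cones[of b s \<theta>' a] sub y by auto
    then show ?thesis by simp
  qed
  then show thesis using that r by blast
qed

lemma small_ball: "y \<in> ball x0 R \<Longrightarrow> \<exists>s>0. \<forall>s'. s' \<le> s \<longrightarrow> cball y s' \<subseteq> ball x0 R"
proof -
  assume "y \<in> ball x0 R"
  then have "cball y ((R - dist x0 y) / 2) \<subseteq> ball x0 R" "(R - dist x0 y) / 2 > 0"
  proof -
    show "cball y ((R - dist x0 y) / 2) \<subseteq> ball x0 R"
    proof
      fix z assume "z \<in> cball y ((R - dist x0 y) / 2)"
      then show "z \<in> ball x0 R" using dist_triangle[of x0 z y] \<open>y \<in> ball x0 R\<close> by (simp add: field_simps)
    qed
  qed (use \<open>y \<in> ball x0 R\<close> in simp)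
  then show ?thesis by (meson order_trans subset_cball)
qed

text \<open>A paraboloid with slope \<open>p\<close> touches \<open>u\<close> from above at \<open>y\<close>.\<close>

context
  fixes y p :: 'a and A r0 :: real
  assumes y: "y \<in> ball x0 R" and A: "A > 0" and r0: "r0 > 0"
    and touch: "\<And>z. z \<in> ball y r0 \<Longrightarrow> u z \<le> u y + p \<bullet> (z - y) + A * (dist z y)\<^sup>2"
begin

lemma touching_upper_slope:
  assumes "\<theta>' > norm p"
  obtains r where "r > 0" "\<And>a b. a \<in> ball y r \<Longrightarrow> b \<in> ball y r \<Longrightarrow> u a - u b \<le> \<theta>' * dist a b"
proof -
  obtain s1 where s1: "s1 > 0" "\<And>s'. s' \<le> s1 \<Longrightarrow> cball y s' \<subseteq> ball x0 R" using small_ball[OF y] by blast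
  define \<theta> where "\<theta> = (norm p + \<theta>') / 2"
  have \<theta>: "norm p < \<theta>" "\<theta> < \<theta>'" "\<theta> \<ge> 0" using assms norm_ge_zero[of p] by (auto simp: \<theta>_def simp del: norm_ge_zero)
  define s where "s = min (s1 / 2) (min (r0 / 4) ((\<theta> - norm p) / A / 2))"
  have s: "s > 0" "2 * s \<le> s1" "2 * s < r0" "2 * s \<le> (\<theta> - norm p) / A"
  proof -
    have q: "(\<theta> - norm p) / A > 0" using A \<theta>(1) by simp
    then show "s > 0" using s1(1) r0 by (simp add: s_def)
    have "s \<le> s1 / 2" "s \<le> r0 / 4" unfolding s_def by linarith+
    then show "2 * s \<le> s1" "2 * s < r0" using r0 by linarith+
    have "s \<le> (\<theta> - norm p) / A / 2" by (simp add: s_def)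
    then show "2 * s \<le> (\<theta> - norm p) / A" by simp
  qed
  have As: "A * (2 * s) \<le> \<theta> - norm p" using s(4) A by (simp add: field_simps)
  have slope: "u z \<le> u y + \<theta> * (2 * s)" if z: "z \<in> cball y (2 * s)" for z
  proof -
    have dz: "dist z y \<le> 2 * s" using z by (simp add: dist_commute)
    have "u z \<le> u y + p \<bullet> (z - y) + A * (dist z y)\<^sup>2"
      using touch[of z] z s(3) by (simp add: dist_commute)
    also have "p \<bullet> (z - y) \<le> norm p * (2 * s)"
      using norm_cauchy_schwarz[of p "z - y"] mult_left_mono[OF dz norm_ge_zero[of p]] by (simp add: dist_norm)
    also have "A * (dist z y)\<^sup>2 \<le> A * (2 * s) * (2 * s)"
      using dz A s(1) power_mono[OF dz zero_le_dist, of 2] by (simp add: power2_eq_square mult.assoc mult_left_mono)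
    also have "A * (2 * s) * (2 * s) \<le> (\<theta> - norm p) * (2 * s)" using As s(1) by (intro mult_right_mono) auto
    finally show ?thesis by (simp add: algebra_simps)
  qed
  show thesis
    by (rule local_lipschitz[OF s1(2)[OF s(2)] s(1) \<theta>(3,2) slope]) (use that in auto)
qed

text \<open>If \<open>u\<close> grew more slowly than \<open>norm p\<close> over some ball around the contact point, its Lipschitz
  constant there would be too small for the descent that the paraboloid enforces.\<close>

lemma touching_lower_slope:
  assumes s: "s > 0" "cball y s \<subseteq> ball x0 R"
  obtains z where "z \<in> cball y s" "u y + norm p * s \<le> u z"
proof (rule ccontr)
  assume neg: "\<not> thesis"
  have "continuous_on (cball y s) u"
  proof (rule lipschitz_on_continuous_on)
    show "\<Lambda>-lipschitz_on (cball y s) u"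
    proof (rule lipschitz_onI)
      fix a b assume "a \<in> cball y s" "b \<in> cball y s"
      then have "a \<in> ball x0 R" "b \<in> ball x0 R" using s(2) by auto
      then show "dist (u a) (u b) \<le> \<Lambda> * dist a b"
        using lip[of a b] lip[of b a] by (simp add: dist_real_def abs_le_iff dist_commute)
    qed (rule \<Lambda>_nonneg)
  qed
  then obtain z where z: "z \<in> cball y s" "\<And>z'. z' \<in> cball y s \<Longrightarrow> u z' \<le> u z"
    using continuous_attains_sup[OF compact_cball, of y s u] s(1) by auto
  have "u z < u y + norm p * s" using neg that z(1) by (meson not_le)
  define \<theta> where "\<theta> = (u z - u y) / s"
  have "u y \<le> u z" using z(2)[of y] s(1) by simp
  then have \<theta>: "\<theta> \<ge> 0" "\<theta> < norm p" "u z = u y + \<theta> * s"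
    using \<open>u z < u y + norm p * s\<close> s(1) by (auto simp: \<theta>_def field_simps)
  define \<theta>' where "\<theta>' = (\<theta> + norm p) / 2"
  have \<theta>': "\<theta> < \<theta>'" "\<theta>' < norm p" using \<theta> by (auto simp: \<theta>'_def)
  have pn: "norm p > 0" using \<theta> by linarith
  obtain r where r: "r > 0" "\<And>a b. a \<in> ball y r \<Longrightarrow> b \<in> ball y r \<Longrightarrow> u a - u b \<le> \<theta>' * dist a b"
  proof (rule local_lipschitz[of y "s / 2" \<theta> \<theta>'])
    show "u z' \<le> u y + \<theta> * (2 * (s / 2))" if "z' \<in> cball y (2 * (s / 2))" for z'
      using z(2)[of z'] that \<theta>(3) by simp
  qed (use s \<theta> \<theta>' that in auto)
  define t where "t = min (r / 2) (min (r0 / 2) ((norm p - \<theta>') / A / 2))"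
  have t: "t > 0" "t < r" "t < r0" "t < (norm p - \<theta>') / A"
  proof -
    have q: "(norm p - \<theta>') / A > 0" using A \<theta>'(2) by simp
    then show "t > 0" using r(1) r0 by (simp add: t_def)
    have "t \<le> r / 2" "t \<le> r0 / 2" unfolding t_def by linarith+
    then show "t < r" "t < r0" using r(1) r0 by linarith+
    have "t \<le> (norm p - \<theta>') / A / 2" by (simp add: t_def)
    also have "\<dots> < (norm p - \<theta>') / A" using q by simp
    finally show "t < (norm p - \<theta>') / A" .
  qed
  have At: "A * t < norm p - \<theta>'" using t(4) A by (simp add: field_simps)
  define w where "w = y - (t / norm p) *\<^sub>R p"
  have w: "dist w y = t" "p \<bullet> (w - y) = - (t * norm p)"
    using pn t(1) by (auto simp: w_def dist_norm power2_norm_eq_inner[symmetric] power2_eq_square)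
  have "u w \<le> u y + p \<bullet> (w - y) + A * (dist w y)\<^sup>2"
    using touch[of w] w(1) t(3) by (simp add: dist_commute)
  then have "u w \<le> u y - t * norm p + A * t * t" using w by (simp add: power2_eq_square)
  moreover have "u y - u w \<le> \<theta>' * t" using r(2)[of y w] w(1) t(2) r(1) by (simp add: dist_commute)
  moreover have "A * t * t < (norm p - \<theta>') * t" using At t(1) by (intro mult_strict_right_mono) auto
  ultimately show False by (simp add: algebra_simps)
qed

text \<open>The paraboloid allows a growth by \<open>norm p * s\<close> within distance \<open>s\<close> only in the direction of \<open>p\<close>.\<close>

lemma ascent_direction:
  assumes p: "norm p > 0" and s: "s > 0" "s < r0" and v: "norm v \<le> s" "u y + norm p * s \<le> u (y + v)"
  shows "norm (v - (s / norm p) *\<^sub>R p) \<le> s * sqrt (2 * A * s / norm p)"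
proof -
  have "u (y + v) \<le> u y + p \<bullet> v + A * (norm v)\<^sup>2"
    using touch[of "y + v"] v(1) s(2) by (simp add: dist_norm)
  moreover have "A * (norm v)\<^sup>2 \<le> A * s\<^sup>2" using A v(1) by (intro mult_left_mono power_mono) auto
  ultimately have pv: "norm p * s - A * s\<^sup>2 \<le> p \<bullet> v" using v(2) by linarith
  have "(norm (v - (s / norm p) *\<^sub>R p))\<^sup>2 = (norm v)\<^sup>2 - 2 * (s / norm p) * (p \<bullet> v) + s\<^sup>2"
  proof -
    have "(norm (v - (s / norm p) *\<^sub>R p))\<^sup>2 = v \<bullet> v - 2 * ((s / norm p) * (p \<bullet> v)) + (s / norm p) * ((s / norm p) * (p \<bullet> p))"
      by (simp add: power2_norm_eq_inner inner_diff_left inner_diff_right inner_commute)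
    moreover have "(s / norm p) * ((s / norm p) * (p \<bullet> p)) = s\<^sup>2"
      using p by (simp add: power2_norm_eq_inner[symmetric] power2_eq_square)
    ultimately show ?thesis by (simp add: power2_norm_eq_inner)
  qed
  also have "\<dots> \<le> s\<^sup>2 - 2 * (s / norm p) * (norm p * s - A * s\<^sup>2) + s\<^sup>2"
  proof -
    have "(norm v)\<^sup>2 \<le> s\<^sup>2" using v(1) by (intro power_mono) auto
    moreover have "2 * (s / norm p) * (norm p * s - A * s\<^sup>2) \<le> 2 * (s / norm p) * (p \<bullet> v)"
      using pv s(1) by (intro mult_left_mono) auto
    ultimately show ?thesis by linarith
  qed
  also have "\<dots> = s\<^sup>2 * (2 * A * s / norm p)" using p by (simp add: power2_eq_square field_simps)
  finally have "norm (v - (s / norm p) *\<^sub>R p) \<le> sqrt (s\<^sup>2 * (2 * A * s / norm p))" by (rule real_le_rsqrt)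
  also have "sqrt (s\<^sup>2 * c) = s * sqrt c" for c using s(1) by (simp add: real_sqrt_mult)
  finally show ?thesis .
qed

text \<open>The paraboloid is the upper half of the expansion. For the lower half, look at \<open>z = y + w\<close> from
  a point at the much larger distance \<open>s = K t\<close>, where \<open>t = norm w\<close>: some point \<open>y + v\<close> there
  satisfies \<open>u (y + v) \<ge> u y + norm p * s\<close>, and \<open>v\<close> is nearly \<open>s e\<close> with \<open>e\<close> the direction of \<open>p\<close>.
  From there to \<open>z\<close> the function falls by little more than \<open>norm p\<close> times the distance, which is
  nearly \<open>s - e \<bullet> w\<close>. So \<open>u z\<close> is at least \<open>u y + p \<bullet> w\<close>, up to errors that are small compared
  with \<open>t\<close>.\<close>

lemma touching_differentiable: "GDERIV u y :> p"
  unfolding gderiv_def has_derivative_at_alt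
proof (intro conjI allI impI)
  show "bounded_linear (\<lambda>h. h \<bullet> p)" by (rule bounded_linear_inner_left)
  fix \<epsilon> :: real assume \<epsilon>: "\<epsilon> > 0"
  obtain s1 where s1: "s1 > 0" "\<And>s'. s' \<le> s1 \<Longrightarrow> cball y s' \<subseteq> ball x0 R" using small_ball[OF y] by blast
  define P where "P = norm p"
  define K where "K = max 1 (2 * P / \<epsilon>)"
  define \<nu> where "\<nu> = \<epsilon> / (4 * (2 * K + 2))"
  have K: "K \<ge> 1" "2 * P \<le> K * \<epsilon>" using \<epsilon> by (auto simp: K_def max_def field_simps)
  have \<nu>: "\<nu> > 0" "\<nu> * (2 * K + 2) = \<epsilon> / 4" using \<epsilon> K by (auto simp: \<nu>_def field_simps)
  obtain r where r: "r > 0" "\<And>a b. a \<in> ball y r \<Longrightarrow> b \<in> ball y r \<Longrightarrow> u a - u b \<le> (P + \<nu>) * dist a b"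
    using touching_upper_slope[of "P + \<nu>"] \<nu>(1) unfolding P_def by auto
  define \<mu> where "\<mu> = min 1 (\<epsilon> / (4 * P * K + 1))"
  have P0: "P \<ge> 0" by (simp add: P_def)
  have \<mu>: "\<mu> > 0" "\<mu> \<le> 1" "P * K * \<mu> \<le> \<epsilon> / 4"
  proof -
    have den: "4 * P * K + 1 > 0" using P0 K by (simp add: add_nonneg_pos)
    then show "\<mu> > 0" "\<mu> \<le> 1" using \<epsilon> by (auto simp: \<mu>_def)
    have "P * K * \<mu> \<le> P * K * (\<epsilon> / (4 * P * K + 1))"
      using P0 K by (intro mult_left_mono) (auto simp: \<mu>_def)
    also have "\<dots> \<le> \<epsilon> / 4" using den \<epsilon> by (simp add: field_simps)
    finally show "P * K * \<mu> \<le> \<epsilon> / 4" .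
  qed
  define \<tau> where "\<tau> = min (min (r / K) (s1 / K)) (min (min (r0 / K) (\<epsilon> / A)) (\<mu>\<^sup>2 * P / (2 * A * K) + (if P = 0 then 1 else 0)))"
  have \<tau>: "\<tau> > 0" using r(1) s1(1) r0 \<epsilon> A K \<mu> P0 by (auto simp: \<tau>_def)
  show "\<exists>\<tau>>0. \<forall>z. norm (z - y) < \<tau> \<longrightarrow> norm (u z - u y - (z - y) \<bullet> p) \<le> \<epsilon> * norm (z - y)"
  proof (intro exI[of _ \<tau>] conjI allI impI \<tau>)
    fix z assume z: "norm (z - y) < \<tau>"
    define w where "w = z - y"
    define t where "t = norm w"
    have zw: "z = y + w" by (simp add: w_def)
    have "t < \<tau>" using z by (simp add: t_def w_def)
    then have t: "K * t < r" "K * t < s1" "K * t < r0" "t < \<epsilon> / A" "P \<noteq> 0 \<Longrightarrow> t < \<mu>\<^sup>2 * P / (2 * A * K)"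
      using K(1) by (auto simp: \<tau>_def field_simps)
    have t0: "t \<ge> 0" by (simp add: t_def)
    have tK: "t \<le> K * t" using K(1) t0 by (simp add: mult_le_cancel_right1)
    have "u z \<le> u y + p \<bullet> w + A * t\<^sup>2"
      using touch[of z] t(3) tK by (simp add: zw dist_norm t_def)
    moreover have "A * t\<^sup>2 \<le> \<epsilon> * t"
    proof -
      have "A * t \<le> \<epsilon>" using t(4) A by (simp add: field_simps)
      then have "A * t * t \<le> \<epsilon> * t" using t0 by (rule mult_right_mono)
      then show ?thesis by (simp add: power2_eq_square mult.assoc)
    qed
    ultimately have upper: "u z - u y - p \<bullet> w \<le> \<epsilon> * t" by linarith
    have lower: "- (\<epsilon> * t) \<le> u z - u y - p \<bullet> w"
    proof (cases "t = 0 \<or> P = 0")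
      case True
      then show ?thesis
      proof
        assume "t = 0"
        then show ?thesis by (simp add: t_def zw)
      next
        assume "P = 0"
        then have "u y - u z \<le> \<nu> * t"
          using r(2)[of y z] r(1) t(1) tK by (simp add: zw t_def dist_norm)
        moreover have "\<nu> * 1 \<le> \<nu> * (2 * K + 2)" using \<nu>(1) K by (intro mult_left_mono) auto
        then have "\<nu> \<le> \<epsilon>" using \<nu>(2) \<epsilon> by linarith
        then have "\<nu> * t \<le> \<epsilon> * t" using t0 by (rule mult_right_mono)
        ultimately show ?thesis using \<open>P = 0\<close> by (simp add: P_def)
      qed
    next
      case False
      then have pos: "t > 0" "P > 0" using t0 P0 by auto
      define s where "s = K * t"
      have s: "s > 0" "s < r" "s < s1" "s < r0" using pos K t by (auto simp: s_def)
      obtain z1 where z1: "z1 \<in> cball y s" "u y + P * s \<le> u z1"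
        using touching_lower_slope[OF s(1) s1(2)] s(3) unfolding P_def by (metis less_imp_le)
      define v where "v = z1 - y"
      have v: "norm v \<le> s" "u y + P * s \<le> u (y + v)"
        using z1 by (auto simp: v_def dist_norm norm_minus_commute)
      define e where "e = (1 / P) *\<^sub>R p"
      have e: "norm e = 1" "P * (e \<bullet> w) = p \<bullet> w" using pos by (auto simp: e_def P_def)
      have "norm (v - s *\<^sub>R e) \<le> s * sqrt (2 * A * s / P)"
        using ascent_direction[of s v] s(1,4) v pos by (simp add: P_def e_def)
      also have "\<dots> \<le> s * \<mu>"
      proof -
        have "2 * A * s / P \<le> \<mu>\<^sup>2" using t(5) pos A K by (simp add: s_def field_simps)
        then have "sqrt (2 * A * s / P) \<le> \<mu>" using \<mu>(1) by (simp add: real_le_lsqrt)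
        then show ?thesis using s(1) by (intro mult_left_mono) auto
      qed
      finally have d1: "norm (v - s *\<^sub>R e) \<le> s * \<mu>" .
      have d2: "norm (s *\<^sub>R e - w) \<le> s - e \<bullet> w + t / (2 * K)"
      proof -
        have "norm w \<le> s" using tK by (simp add: s_def t_def)
        from far_point_distance[OF e(1) this s(1)]
        have "norm (s *\<^sub>R e - w) \<le> s - e \<bullet> w + t\<^sup>2 / (2 * s)" by (simp add: t_def)
        also have "t\<^sup>2 / (2 * s) = t / (2 * K)" using pos by (simp add: s_def power2_eq_square)
        finally show ?thesis .
      qed
      have "dist (y + v) z \<le> (s - e \<bullet> w + t / (2 * K)) + s * \<mu>"
      proof -
        have "dist (y + v) z = norm ((v - s *\<^sub>R e) + (s *\<^sub>R e - w))" by (simp add: zw dist_norm)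
        then show ?thesis using norm_triangle_ineq[of "v - s *\<^sub>R e" "s *\<^sub>R e - w"] d1 d2 by linarith
      qed
      then have "(P + \<nu>) * dist (y + v) z \<le> (P + \<nu>) * ((s - e \<bullet> w + t / (2 * K)) + s * \<mu>)"
        using pos \<nu> by (intro mult_left_mono) auto
      moreover have "u (y + v) - u z \<le> (P + \<nu>) * dist (y + v) z"
        using r(2)[of "y + v" z] v(1) s(2) t(1) tK by (simp add: zw t_def dist_norm)
      ultimately have main: "u y + P * s - u z \<le> (P + \<nu>) * ((s - e \<bullet> w + t / (2 * K)) + s * \<mu>)"
        using v(2) by linarith
      have "(P + \<nu>) * ((s - e \<bullet> w + t / (2 * K)) + s * \<mu>) =
          P * s - P * (e \<bullet> w) + P * (t / (2 * K)) + P * K * \<mu> * t + \<nu> * ((s - e \<bullet> w + t / (2 * K)) + s * \<mu>)"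
      proof -
        have "(P + \<nu>) * (a - b + c + d) = P * a - P * b + P * c + P * d + \<nu> * (a - b + c + d)" for a b c d
          by (simp add: algebra_simps)
        moreover have "P * (s * \<mu>) = P * K * \<mu> * t" by (simp add: s_def)
        ultimately show ?thesis by simp
      qed
      moreover have "P * (t / (2 * K)) \<le> \<epsilon> / 4 * t"
      proof -
        have "P / (2 * K) \<le> \<epsilon> / 4" using K by (simp add: field_simps)
        then have "P / (2 * K) * t \<le> \<epsilon> / 4 * t" using t0 by (rule mult_right_mono)
        then show ?thesis by simp
      qed
      moreover have "P * K * \<mu> * t \<le> \<epsilon> / 4 * t" using \<mu>(3) t0 by (rule mult_right_mono)
      moreover have "\<nu> * ((s - e \<bullet> w + t / (2 * K)) + s * \<mu>) \<le> \<epsilon> / 4 * t"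
      proof -
        have "- (e \<bullet> w) \<le> t" using norm_cauchy_schwarz[of "- e" w] e(1) by (simp add: t_def)
        moreover have "t / (2 * K) \<le> t / 1" using K t0 by (intro divide_left_mono) auto
        moreover have "s * \<mu> \<le> s" using \<mu>(1,2) s(1) by (simp add: mult_left_le)
        ultimately have "(s - e \<bullet> w + t / (2 * K)) + s * \<mu> \<le> (2 * K + 2) * t"
          by (simp add: s_def algebra_simps)
        then have "\<nu> * ((s - e \<bullet> w + t / (2 * K)) + s * \<mu>) \<le> \<nu> * ((2 * K + 2) * t)"
          using \<nu>(1) by (intro mult_left_mono) auto
        also have "\<dots> = \<epsilon> / 4 * t" by (simp only: mult.assoc[symmetric] \<nu>(2))
        finally show ?thesis .
      qed
      ultimately have "u y - u z \<le> - (p \<bullet> w) + 3 * (\<epsilon> / 4 * t)" using main e(2) by linarith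
      then show ?thesis using mult_nonneg_nonneg[of \<epsilon> t] \<epsilon> t0 by linarith
    qed
    have "\<bar>u z - u y - p \<bullet> w\<bar> \<le> \<epsilon> * t" using upper lower by (simp add: abs_le_iff)
    then show "norm (u z - u y - (z - y) \<bullet> p) \<le> \<epsilon> * norm (z - y)"
      by (simp add: w_def t_def inner_commute)
  qed
qed

end

text \<open>A steep paraboloid around \<open>x0\<close>, raised until it lies above \<open>u\<close>, touches \<open>u\<close> in the interior of
  the ball because \<open>u\<close> is Lipschitz continuous.\<close>

lemma differentiable_point: "\<exists>y\<in>ball x0 R. \<exists>D. GDERIV u y :> D"
proof -
  define r where "r = R / 2"
  have r: "r > 0" "r < R" using R_pos by (auto simp: r_def)
  define A where "A = (\<Lambda> + 1) / r"
  have A: "A > 0" "A * r = \<Lambda> + 1" using \<Lambda>_nonneg r by (auto simp: A_def)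
  have sub: "cball x0 r \<subseteq> ball x0 R" using r by (simp add: cball_subset_ball_iff)
  let ?f = "\<lambda>z. u z - A * (dist z x0)\<^sup>2"
  have "continuous_on (cball x0 r) u"
  proof (rule lipschitz_on_continuous_on)
    show "\<Lambda>-lipschitz_on (cball x0 r) u"
    proof (rule lipschitz_onI)
      fix a b assume "a \<in> cball x0 r" "b \<in> cball x0 r"
      then have "a \<in> ball x0 R" "b \<in> ball x0 R" using sub by auto
      then show "dist (u a) (u b) \<le> \<Lambda> * dist a b"
        using lip[of a b] lip[of b a] by (simp add: dist_real_def abs_le_iff dist_commute)
    qed (rule \<Lambda>_nonneg)
  qed
  then have "continuous_on (cball x0 r) ?f" by (intro continuous_intros)
  then obtain y where y: "y \<in> cball x0 r" "\<And>z. z \<in> cball x0 r \<Longrightarrow> ?f z \<le> ?f y"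
    using continuous_attains_sup[OF compact_cball, of x0 r ?f] r by auto
  have "dist x0 y \<noteq> r"
  proof
    assume eq: "dist x0 y = r"
    have "?f x0 \<le> ?f y" using y(2)[of x0] r by simp
    then have "u x0 \<le> u y - (\<Lambda> + 1) * r" using eq A(2) by (simp add: dist_commute power2_eq_square mult.assoc[symmetric])
    moreover have "u y - u x0 \<le> \<Lambda> * r" using lip[of y x0] y(1) sub R_pos eq by (auto simp: dist_commute)
    ultimately show False using r by (simp add: algebra_simps)
  qed
  then have yr: "dist x0 y < r" using y(1) by simp
  have touch: "u z \<le> u y + ((2 * A) *\<^sub>R (y - x0)) \<bullet> (z - y) + A * (dist z y)\<^sup>2"
    if z: "z \<in> ball y (r - dist x0 y)" for z
  proof -
    have "z \<in> cball x0 r" using z dist_triangle[of x0 z y] by simp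
    then have "u z \<le> u y + A * ((dist z x0)\<^sup>2 - (dist y x0)\<^sup>2)" using y(2)[of z] by (simp add: algebra_simps)
    also have "(dist z x0)\<^sup>2 - (dist y x0)\<^sup>2 = 2 * ((y - x0) \<bullet> (z - y)) + (dist z y)\<^sup>2"
    proof -
      define a where "a = z - y"
      define b where "b = y - x0"
      have "(norm (a + b))\<^sup>2 - (norm b)\<^sup>2 = 2 * (b \<bullet> a) + (norm a)\<^sup>2"
        by (simp add: power2_norm_eq_inner inner_add_left inner_add_right inner_commute)
      moreover have "a + b = z - x0" by (simp add: a_def b_def)
      ultimately show ?thesis by (simp add: dist_norm a_def b_def)
    qed
    finally show ?thesis by (simp add: algebra_simps)
  qed
  have "y \<in> ball x0 R" using y(1) sub by blast
  then have "GDERIV u y :> (2 * A) *\<^sub>R (y - x0)"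
    using yr by (intro touching_differentiable[where ?r0.0 = "r - dist x0 y", OF _ A(1) _ touch]) auto
  then show ?thesis using \<open>y \<in> ball x0 R\<close> by blast
qed

end

context intrinsic_domain
begin

text \<open>Were the slope over some ball smaller than \<open>\<alpha>\<close>, it would be so for a centre \<open>x1\<close> in \<open>\<Omega>\<close> close by
  and, by comparison with cones, over all smaller balls around \<open>x1\<close>. Then the Lipschitz constant
  of \<open>u\<close> near \<open>x1\<close> would be smaller than \<open>\<alpha>\<close>, contrary to the size of the gradient at a point of
  differentiability there.\<close>

lemma slope_ge_of_gradient_ge:
  assumes cc: "cone_comparison lab u" and "\<Lambda> \<ge> 0"
    and lip: "\<And>x y. x \<in> S \<Longrightarrow> y \<in> S \<Longrightarrow> u x - u y \<le> \<Lambda> * d x y"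
    and \<Omega>: "open \<Omega>" "closure \<Omega> = S"
    and segment: "\<And>x y. closed_segment x y \<subseteq> S \<Longrightarrow> d x y \<le> dist x y"
    and grad: "\<And>x D. x \<in> \<Omega> \<Longrightarrow> GDERIV u x :> D \<Longrightarrow> \<alpha> \<le> norm D" and "\<alpha> > 0"
    and x: "x \<in> S" "\<rho> > 0" "\<And>z. z \<in> lab \<Longrightarrow> \<rho> \<le> d x z" and "lab \<subseteq> S"
  shows "u x + \<alpha> * \<rho> \<le> ball_sup u \<rho> x"
proof (rule ccontr)
  assume neg: "\<not> u x + \<alpha> * \<rho> \<le> ball_sup u \<rho> x"
  have u_cont: "continuous_on S u" by (rule continuous_on_if_lipschitz[OF lip \<open>\<Lambda> \<ge> 0\<close>])
  note as = attains_sup_continuous[OF u_cont]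
  define gap where "gap = u x + \<alpha> * \<rho> - ball_sup u \<rho> x"
  have "gap > 0" using neg by (simp add: gap_def)
  define \<tau> where "\<tau> = min (\<rho> / 2) (gap / (2 * (\<Lambda> + \<alpha> + 1)))"
  have den: "\<Lambda> + \<alpha> + 1 > 0" using \<open>\<Lambda> \<ge> 0\<close> \<open>\<alpha> > 0\<close> by simp
  have \<tau>: "\<tau> > 0" "\<tau> < \<rho>" using x(2) \<open>gap > 0\<close> den by (auto simp: \<tau>_def)
  have "\<tau> \<le> gap / (2 * (\<Lambda> + \<alpha> + 1))" by (simp add: \<tau>_def)
  then have "\<tau> * (2 * (\<Lambda> + \<alpha> + 1)) \<le> gap" using den by (simp add: le_divide_eq)
  then have gap_\<tau>: "(\<Lambda> + \<alpha>) * \<tau> < gap" using \<tau>(1) \<open>gap > 0\<close> by (simp add: algebra_simps)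
  obtain x1 where x1: "x1 \<in> \<Omega>" "dist x1 x < \<tau> / \<kappa>"
    using x(1) \<tau>(1) \<kappa>_ge_1 unfolding \<Omega>(2)[symmetric] closure_approachable by (meson divide_pos_pos less_le_trans zero_less_one)
  have x1S: "x1 \<in> S" using x1(1) \<Omega>(2) closure_subset by blast
  have dx: "d x x1 \<le> \<tau>"
  proof -
    have "d x x1 \<le> \<kappa> * dist x x1" by (rule d_le_\<kappa>[OF x(1) x1S])
    also have "\<dots> \<le> \<tau>" using x1(2) \<kappa>_ge_1 by (simp add: field_simps dist_commute)
    finally show ?thesis .
  qed
  define \<rho>1 where "\<rho>1 = \<rho> - \<tau>"
  have \<rho>1: "\<rho>1 > 0" using \<tau> by (simp add: \<rho>1_def)
  have far1: "\<rho>1 \<le> d x1 z" if "z \<in> lab" for z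
  proof -
    have "z \<in> S" using that \<open>lab \<subseteq> S\<close> by blast
    then show ?thesis using x(3)[OF that] triangle[OF x(1) x1S \<open>z \<in> S\<close>] dx by (simp add: \<rho>1_def)
  qed
  have "ball_sup u \<rho>1 x1 \<le> ball_sup u \<rho> x"
  proof (rule ball_sup_le[OF as x1S less_imp_le[OF \<rho>1]])
    fix y assume y: "y \<in> S" "d x1 y \<le> \<rho>1"
    show "u y \<le> ball_sup u \<rho> x"
      by (rule ball_sup_upper[OF as x(1) less_imp_le[OF x(2)] y(1)])
        (use triangle[OF x(1) x1S y(1)] dx y(2) in \<open>simp add: \<rho>1_def\<close>)
  qed
  moreover have "u x - \<Lambda> * \<tau> \<le> u x1"
    using lip[OF x(1) x1S] mult_left_mono[OF dx \<open>\<Lambda> \<ge> 0\<close>] by linarith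
  ultimately have low: "ball_sup u \<rho>1 x1 < u x1 + \<alpha> * \<rho>1"
    using gap_\<tau> by (simp add: gap_def \<rho>1_def algebra_simps)
  define \<alpha>1 where "\<alpha>1 = (ball_sup u \<rho>1 x1 - u x1) / \<rho>1"
  have "u x1 \<le> ball_sup u \<rho>1 x1" by (rule ball_sup_centre[OF as x1S less_imp_le[OF \<rho>1]])
  then have \<alpha>1: "0 \<le> \<alpha>1" "\<alpha>1 < \<alpha>" using low \<rho>1 by (auto simp: \<alpha>1_def field_simps)
  obtain e where e: "e > 0" "ball x1 e \<subseteq> \<Omega>" using \<Omega>(1) x1(1) by (meson openE)
  define R where "R = min e (\<rho>1 / 2)"
  have R: "R > 0" "ball x1 R \<subseteq> \<Omega>" "2 * R \<le> \<rho>1" using e \<rho>1 by (auto simp: R_def)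
  have RS: "ball x1 R \<subseteq> S" using R(2) \<Omega>(2) closure_subset by blast
  have flat: "d a b = dist a b" if "a \<in> ball x1 R" "b \<in> ball x1 R" for a b
  proof -
    have "closed_segment a b \<subseteq> ball x1 R" using that by (intro closed_segment_subset) auto
    then have "d a b \<le> dist a b" using RS by (intro segment) auto
    moreover have "dist a b \<le> d a b" using that RS by (intro dist_le_d) auto
    ultimately show ?thesis by simp
  qed
  have notlab: "d y z \<ge> R" if "y \<in> ball x1 R" "z \<in> lab" for y z
  proof -
    have S: "y \<in> S" "z \<in> S" "x1 \<in> ball x1 R" using that RS \<open>lab \<subseteq> S\<close> R(1) by auto
    then have "d x1 y < R" using flat[of x1 y] that(1) by simp
    then show ?thesis using far1[OF that(2)] triangle[OF x1S S(1,2)] R(3) by linarith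
  qed
  have inside: "z \<in> cball y s" if ys: "cball y s \<subseteq> ball x1 R" "s > 0" and z: "z \<in> S" "d y z \<le> s" for y s z
    using dist_le_d[of y z] z ys RS by force
  interpret B: ball_with_cones u x1 R \<Lambda>
  proof
    show "u a - u b \<le> \<Lambda> * dist a b" if "a \<in> ball x1 R" "b \<in> ball x1 R" for a b
    proof -
      have "a \<in> S" "b \<in> S" using that RS by blast+
      then show ?thesis using lip[of a b] flat[OF that] by simp
    qed
    fix y s \<theta> z
    assume ys: "cball y s \<subseteq> ball x1 R" "s > 0" "\<theta> \<ge> 0" "\<And>z. z \<in> cball y s \<Longrightarrow> u z \<le> u y + \<theta> * s"
      and z: "z \<in> cball y s"
    have yB: "y \<in> ball x1 R" "y \<in> S" using ys RS by force+
    have zB: "z \<in> ball x1 R" "z \<in> S" using ys(1) z RS by auto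
    have dyz: "d y z = dist y z" "dist y z \<le> s" using flat[OF yB(1) zB(1)] z by auto
    have sR: "s \<le> R"
      using ys(1,2) zero_le_dist[of y x1] unfolding cball_subset_ball_iff by linarith
    have "u z \<le> u y + (ball_sup u s y - u y) / s * d y z"
    proof (rule cone_in_ball[OF cc u_cont yB(2) ys(2) _ zB(2)])
      show "s \<le> d y l" if "l \<in> lab" for l using notlab[OF yB(1) that] sR by simp
    qed (use dyz in simp)
    also have "(ball_sup u s y - u y) / s * d y z \<le> \<theta> * d y z"
    proof (rule mult_right_mono)
      have "ball_sup u s y \<le> u y + \<theta> * s"
        by (rule ball_sup_le[OF as yB(2) less_imp_le[OF ys(2)]]) (rule ys(4)[OF inside[OF ys(1,2)]])
      then show "(ball_sup u s y - u y) / s \<le> \<theta>" using ys(2) by (simp add: field_simps)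
    qed simp
    finally show "u z \<le> u y + \<theta> * dist z y" using dyz by (simp add: dist_commute)
  qed (use R(1) \<open>\<Lambda> \<ge> 0\<close> in auto)
  define s where "s = R / 4"
  have s: "s > 0" "cball x1 (2 * s) \<subseteq> ball x1 R" using R(1) by (auto simp: s_def cball_subset_ball_iff)
  define \<alpha>2 where "\<alpha>2 = (\<alpha>1 + \<alpha>) / 2"
  have \<alpha>2: "\<alpha>1 < \<alpha>2" "\<alpha>2 < \<alpha>" using \<alpha>1 by (auto simp: \<alpha>2_def)
  have sl: "u z \<le> u x1 + \<alpha>1 * (2 * s)" if z: "z \<in> cball x1 (2 * s)" for z
  proof -
    have zB: "z \<in> ball x1 R" "z \<in> S" using z s(2) RS by auto
    have dz: "d x1 z \<le> 2 * s" using flat[of x1 z] zB(1) R(1) z by simp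
    have "u z \<le> u x1 + \<alpha>1 * d x1 z"
      unfolding \<alpha>1_def
      by (rule cone_in_ball[OF cc u_cont x1S \<rho>1 far1 zB(2)]) (use dz R(1,3) in \<open>simp_all add: s_def\<close>)
    also have "\<alpha>1 * d x1 z \<le> \<alpha>1 * (2 * s)" using dz \<alpha>1(1) by (rule mult_left_mono)
    finally show ?thesis by simp
  qed
  obtain r where r: "r > 0" "r \<le> s / 2" "\<And>a b. a \<in> ball x1 r \<Longrightarrow> b \<in> ball x1 r \<Longrightarrow> u a - u b \<le> \<alpha>2 * dist a b"
    using B.local_lipschitz[OF s(2,1) \<alpha>1(1) \<alpha>2(1) sl] by blast
  have rR: "r \<le> R" using r(2) s_def R(1) by simp
  interpret B': ball_with_cones u x1 r \<Lambda>
  proof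
    show "u a - u b \<le> \<Lambda> * dist a b" if "a \<in> ball x1 r" "b \<in> ball x1 r" for a b
      using B.lip[of a b] that rR by auto
    fix y s \<theta> z
    assume ys: "cball y s \<subseteq> ball x1 r" "s > 0" "\<theta> \<ge> 0" "\<And>z. z \<in> cball y s \<Longrightarrow> u z \<le> u y + \<theta> * s"
      and z: "z \<in> cball y s"
    have "ball x1 r \<subseteq> ball x1 R" using rR by (rule subset_ball)
    then have "cball y s \<subseteq> ball x1 R" using ys(1) by (rule order_trans[rotated])
    then show "u z \<le> u y + \<theta> * dist z y" by (rule B.cones[OF _ ys(2,3) ys(4) z])
  qed (use r(1) \<open>\<Lambda> \<ge> 0\<close> in auto)
  obtain y D where y: "y \<in> ball x1 r" "GDERIV u y :> D" using B'.differentiable_point by blast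
  obtain r' where r': "r' > 0" "ball y r' \<subseteq> ball x1 r" using y(1) open_ball by (meson openE)
  have "norm D \<le> max \<alpha>2 0"
  proof (rule norm_gradient_le[OF y(2) r'(1)])
    show "u z - u y \<le> \<alpha>2 * dist z y" if "z \<in> ball y r'" for z using r(3)[of z y] that r'(2) y(1) by blast
  qed
  moreover have "y \<in> \<Omega>" using y(1) rR R(2) by (meson subset_ball subset_iff)
  then have "\<alpha> \<le> norm D" using grad y(2) by blast
  ultimately show False using \<alpha>2 \<alpha>1 by linarith
qed

end

section \<open>From the assumptions to the estimates\<close>

lemma lip_const_le:
  assumes d: "\<And>x y. x \<in> A \<Longrightarrow> y \<in> A \<Longrightarrow> x \<noteq> y \<Longrightarrow> d x y > 0" and "K \<ge> 0"
    and b: "\<And>x y. x \<in> A \<Longrightarrow> y \<in> A \<Longrightarrow> \<bar>v x - v y\<bar> \<le> K * d x y"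
  shows "lip_const (\<lambda>x y. ennreal (d x y)) v A \<le> ennreal K"
  unfolding lip_const_def
proof (rule SUP_least, clarsimp)
  fix x y assume xy: "x \<in> A" "y \<in> A" "x \<noteq> y"
  have "ennreal \<bar>v x - v y\<bar> / ennreal (d x y) = ennreal (\<bar>v x - v y\<bar> / d x y)"
    using d[OF xy] by (simp add: divide_ennreal)
  also have "\<dots> \<le> ennreal K"
    using b[OF xy(1,2)] d[OF xy] by (intro ennreal_leI) (simp add: divide_le_eq)
  finally show "ennreal \<bar>v x - v y\<bar> / ennreal (d x y) \<le> ennreal K" .
qed

lemma lip_const_D:
  assumes "lip_const d v A \<le> ennreal K" "K \<ge> 0" and xy: "x \<in> A" "y \<in> A" "x \<noteq> y"
    and d: "d x y = ennreal e" "e > 0"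
  shows "\<bar>v x - v y\<bar> \<le> K * e"
proof -
  have "ennreal \<bar>v x - v y\<bar> / d x y \<le> lip_const d v A"
    unfolding lip_const_def by (rule SUP_upper2[of "(x, y)"]) (use xy in auto)
  then have "ennreal (\<bar>v x - v y\<bar> / e) \<le> ennreal K"
    using assms(1) d by (simp add: divide_ennreal)
  then show ?thesis using d(2) \<open>K \<ge> 0\<close> by (simp add: ennreal_le_iff divide_le_eq)
qed

lemma lip_const_minus: "lip_const d (\<lambda>x. - v x) A = lip_const d v A"
  unfolding lip_const_def by (simp add: abs_minus_commute)

lemma is_AMLE_minus:
  assumes "is_AMLE \<Omega> \<O> g u" shows "is_AMLE \<Omega> \<O> (\<lambda>x. - g x) (\<lambda>x. - u x)"
  using assms unfolding is_AMLE_def lip_const_minus by (auto intro: continuous_intros)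

lemma geo_dist_segment:
  assumes "closed_segment x y \<subseteq> closure \<Omega>" and "Metric_space (closure \<Omega>) (geo_dist \<Omega>)"
  shows "geo_dist \<Omega> x y \<le> dist x y"
proof (cases "x = y")
  case True
  interpret Metric_space "closure \<Omega>" "geo_dist \<Omega>" by fact
  have "x \<in> closure \<Omega>" using assms(1) by auto
  then show ?thesis using True zero by simp
next
  case False
  then have "timed_arc (closure \<Omega>) x y (norm (y - x))" by (intro timed_arc_segment[OF assms(1)]) auto
  then show ?thesis using geo_dist_le_timed_arc by (fastforce simp: dist_norm norm_minus_commute)
qed

lemma intrinsic_domain_geo_dist:
  assumes dom: "open \<Omega>" "connected \<Omega>" "domain_assumption \<Omega> \<phi> r" and "bounded \<Omega>" "\<Omega> \<noteq> {}"
    and B: "\<And>s. s \<in> {0<..r} \<Longrightarrow> \<phi> s \<le> B * s powr (9/5)"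
  obtains B' where "intrinsic_domain (closure \<Omega>) (geo_dist \<Omega>) B'"
proof -
  obtain B' where B': "B' \<ge> 0" "\<And>x y. x \<in> closure \<Omega> \<Longrightarrow> y \<in> closure \<Omega> \<Longrightarrow>
      geo_dist \<Omega> x y \<le> dist x y + B' * dist x y powr (9/5)"
    by (rule geo_dist_le_global[OF dom assms(4,5) B]) (assumption | rule that)+
  have "intrinsic_domain (closure \<Omega>) (geo_dist \<Omega>) B'"
  proof (intro intrinsic_domain.intro intrinsic_domain_axioms.intro)
    show "Metric_space (closure \<Omega>) (geo_dist \<Omega>)" by (rule Metric_space_geo_dist[OF dom])
    show "compact (closure \<Omega>)" using assms(4) by (simp add: compact_closure)
    fix x y assume xy: "x \<in> closure \<Omega>" "y \<in> closure \<Omega>"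
    obtain l where "timed_arc (closure \<Omega>) x y l" using timed_arc_exists[OF dom xy] by blast
    then show "dist x y \<le> geo_dist \<Omega> x y" by (rule dist_le_geo_dist)
    show "geo_dist \<Omega> x y \<le> dist x y + B' * dist x y powr (9/5)" by (rule B'(2)[OF xy])
    fix e :: real assume "e > 0"
    obtain p where p: "continuous_on {0..1::real} p" "p ` {0..1} \<subseteq> closure \<Omega>" "p 0 = x" "p 1 = y"
      "\<And>t. t \<in> {0..1} \<Longrightarrow> geo_dist \<Omega> x (p t) + geo_dist \<Omega> (p t) y \<le> geo_dist \<Omega> x y + e"
      by (rule near_geodesic_geo_dist[OF dom xy \<open>e > 0\<close>]) (rule that)
    show "\<exists>p. continuous_on {0..1::real} p \<and> p ` {0..1} \<subseteq> closure \<Omega> \<and> p 0 = x \<and> p 1 = y \<and>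
        (\<forall>t\<in>{0..1}. geo_dist \<Omega> x (p t) + geo_dist \<Omega> (p t) y \<le> geo_dist \<Omega> x y + e)"
      using p by (intro exI[of _ p]) auto
  qed (rule B'(1))
  then show thesis by (rule that)
qed

text \<open>The topology of the intrinsic distance is the Euclidean subspace topology, so the minimization
  property can be used for sets that are open and connected in the Euclidean sense.\<close>

lemma AMLE_cone_comparison:
  assumes "intrinsic_domain (closure \<Omega>) (geo_dist \<Omega>) B" and u: "is_AMLE \<Omega> \<O> g u"
  shows "intrinsic_domain.cone_comparison (closure \<Omega>) (geo_dist \<Omega>) \<O> u"
proof -
  interpret intrinsic_domain "closure \<Omega>" "geo_dist \<Omega>" B by fact
  have pos: "geo_dist \<Omega> x y > 0" if "x \<in> closure \<Omega>" "y \<in> closure \<Omega>" "x \<noteq> y" for x y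
    using zero[OF that(1,2)] that(3) nonneg[of x y] by linarith
  show ?thesis
  proof (rule cone_comparison_if_minimizing)
    show "continuous_on (closure \<Omega>) u" using u by (simp add: is_AMLE_def)
    fix V K x y
    assume V: "V \<subseteq> closure \<Omega> - \<O>" "openin (top_of_set (closure \<Omega>)) V" "connected V" "K \<ge> 0"
      and fr: "\<And>x y. x \<in> closure V - V \<Longrightarrow> y \<in> closure V - V \<Longrightarrow> \<bar>u x - u y\<bar> \<le> K * geo_dist \<Omega> x y"
      and xy: "x \<in> closure V" "y \<in> closure V"
    have VS: "V \<subseteq> closure \<Omega>" using V(1) by blast
    have clS: "closure V \<subseteq> closure \<Omega>" by (rule closure_subset_S[OF VS])
    have "Lip_domain \<Omega> u (geo_topology \<Omega> closure_of V) = Lip_domain \<Omega> u (geo_topology \<Omega> frontier_of V)"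
      using u V VS unfolding is_AMLE_def by (simp add: mtopology_eq connectedin_subtopology)
    then have "Lip_domain \<Omega> u (closure V) = Lip_domain \<Omega> u (closure V - V)"
      by (simp add: mtopology_eq relative_closure[OF VS] relative_frontier[OF V(2)])
    also have "\<dots> \<le> ennreal K"
    proof (rule lip_const_le[OF _ V(4) fr])
      fix x y assume "x \<in> closure V - V" "y \<in> closure V - V" "x \<noteq> y"
      then show "geo_dist \<Omega> x y > 0" using clS by (intro pos) auto
    qed
    finally have lip: "Lip_domain \<Omega> u (closure V) \<le> ennreal K" .
    show "\<bar>u x - u y\<bar> \<le> K * geo_dist \<Omega> x y"
    proof (cases "x = y")
      case False
      have "x \<in> closure \<Omega>" "y \<in> closure \<Omega>" using xy clS by auto
      then show ?thesis using lip_const_D[OF lip V(4) xy False refl] pos False by blast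
    qed (simp add: V(4))
  qed
qed

lemma AMLE_lipschitz:
  assumes dom: "intrinsic_domain (closure \<Omega>) (geo_dist \<Omega>) B" and u: "is_AMLE \<Omega> \<O> g u"
    and \<O>: "closed \<O>" "\<O> \<subseteq> closure \<Omega>" and g: "Lip_domain \<Omega> g \<O> < \<infinity>"
  obtains \<Lambda> where "\<Lambda> \<ge> 0" "\<And>x y. x \<in> closure \<Omega> \<Longrightarrow> y \<in> closure \<Omega> \<Longrightarrow> \<bar>u x - u y\<bar> \<le> \<Lambda> * geo_dist \<Omega> x y"
proof -
  interpret intrinsic_domain "closure \<Omega>" "geo_dist \<Omega>" B by fact
  define \<Lambda> where "\<Lambda> = enn2real (Lip_domain \<Omega> g \<O>)"
  have \<Lambda>: "\<Lambda> \<ge> 0" "Lip_domain \<Omega> g \<O> \<le> ennreal \<Lambda>" using g by (auto simp: \<Lambda>_def)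
  have lab: "\<bar>u x - u y\<bar> \<le> \<Lambda> * geo_dist \<Omega> x y" if xy: "x \<in> \<O>" "y \<in> \<O>" for x y
  proof (cases "x = y")
    case False
    have S: "x \<in> closure \<Omega>" "y \<in> closure \<Omega>" using xy \<O>(2) by auto
    have "geo_dist \<Omega> x y > 0" using zero[OF S] False nonneg[of x y] by linarith
    then have "\<bar>g x - g y\<bar> \<le> \<Lambda> * geo_dist \<Omega> x y" by (rule lip_const_D[OF \<Lambda>(2,1) xy False refl])
    then show ?thesis using u xy by (simp add: is_AMLE_def)
  qed (simp add: \<Lambda>(1))
  have "\<bar>u x - u y\<bar> \<le> \<Lambda> * geo_dist \<Omega> x y" if "x \<in> closure \<Omega>" "y \<in> closure \<Omega>" for x y
    by (rule lipschitz_if_cone_comparison[OF AMLE_cone_comparison[OF dom u]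
          AMLE_cone_comparison[OF dom is_AMLE_minus[OF u]] \<O> \<Lambda>(1) lab that])
  from that[OF \<Lambda>(1) this] show thesis .
qed

text \<open>Boundedness makes the real suprema and infima in the Hausdorff distance meaningful.\<close>

lemma hausdorff_dist_infdist:
  assumes "bounded A" "bounded B" "A \<noteq> {}" "B \<noteq> {}"
  shows "x \<in> A \<Longrightarrow> infdist x B \<le> hausdorff_dist A B" "x \<in> B \<Longrightarrow> infdist x A \<le> hausdorff_dist A B"
proof -
  have half: "infdist x Q \<le> (SUP x\<in>P. INF y\<in>Q. dist x y)"
    if P: "bounded P" "Q \<noteq> {}" "x \<in> P" for P Q :: "'a set" and x
  proof -
    obtain q where q: "q \<in> Q" using P(2) by blast
    obtain e where e: "\<And>y. y \<in> P \<Longrightarrow> dist q y \<le> e" using P(1) unfolding bounded_any_center[of P q] by blast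
    have "bdd_above ((\<lambda>x. infdist x Q) ` P)"
      using infdist_le[OF q] e by (intro bdd_aboveI2[of _ _ e]) (metis dist_commute order_trans)
    then have "infdist x Q \<le> (SUP x\<in>P. infdist x Q)" by (rule cSUP_upper[OF P(3)])
    then show ?thesis using P(2) by (simp add: infdist_def)
  qed
  show "infdist x B \<le> hausdorff_dist A B" if "x \<in> A"
    using half[OF assms(1,4) that] by (simp add: hausdorff_dist_def)
  show "infdist x A \<le> hausdorff_dist A B" if "x \<in> B"
    using half[OF assms(2,3) that] by (simp add: hausdorff_dist_def)
qed

lemma dist_projection_le_infdist:
  assumes "is_arg_min (dist x) (\<lambda>y. y \<in> A) p"
  shows "p \<in> A" "dist x p \<le> infdist x A"
proof -
  show p: "p \<in> A" using assms by (simp add: is_arg_min_def)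
  have "\<And>y. y \<in> A \<Longrightarrow> dist x p \<le> dist x y" using assms by (force simp: is_arg_min_def not_less)
  then show "dist x p \<le> infdist x A" using p by (auto simp: infdist_def intro!: cINF_greatest)
qed

lemma cloud_resolution:
  assumes cloud: "labelled_cloud \<Omega> \<O> X L \<pi>X \<pi>L" and \<O>: "closed \<O>" "\<O> \<subseteq> closure \<Omega>" "\<O> \<noteq> {}"
    and "bounded \<Omega>"
  defines "\<delta> \<equiv> resolution \<Omega> \<O> X L"
  shows "x \<in> closure \<Omega> \<Longrightarrow> \<pi>X x \<in> X" "x \<in> closure \<Omega> \<Longrightarrow> dist x (\<pi>X x) \<le> \<delta>" "x \<in> X \<Longrightarrow> \<pi>X x = x"
    "z \<in> \<O> \<Longrightarrow> \<pi>L z \<in> L" "z \<in> \<O> \<Longrightarrow> dist z (\<pi>L z) \<le> \<delta>" "l \<in> L \<Longrightarrow> \<exists>z\<in>\<O>. dist l z \<le> \<delta>"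
proof -
  have c: "finite X" "X \<subseteq> closure \<Omega>" "L \<subseteq> X" "L \<noteq> {}"
    "\<And>x. x \<in> closure \<Omega> \<Longrightarrow> is_arg_min (dist x) (\<lambda>y. y \<in> X) (\<pi>X x)"
    "\<And>z. z \<in> \<O> \<Longrightarrow> is_arg_min (dist z) (\<lambda>y. y \<in> L) (\<pi>L z)"
    using cloud by (auto simp: labelled_cloud_def)
  have bd: "bounded (closure \<Omega>)" by (rule bounded_closure[OF assms(5)])
  have bd\<O>: "bounded \<O>" using bd \<O>(2) by (rule bounded_subset)
  have finL: "finite L" using c(1,3) finite_subset by blast
  have ne: "X \<noteq> {}" "closure \<Omega> \<noteq> {}" using c(3,4) \<O>(2,3) by auto
  have \<delta>: "hausdorff_dist X (closure \<Omega>) \<le> \<delta>" "hausdorff_dist L \<O> \<le> \<delta>" by (auto simp: \<delta>_def resolution_def)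
  note H = hausdorff_dist_infdist[OF finite_imp_bounded[OF c(1)] bd ne]
  note HL = hausdorff_dist_infdist[OF finite_imp_bounded[OF finL] bd\<O> c(4) \<O>(3)]
  show "\<pi>X x \<in> X" if "x \<in> closure \<Omega>" by (rule dist_projection_le_infdist(1)[OF c(5)[OF that]])
  show "dist x (\<pi>X x) \<le> \<delta>" if "x \<in> closure \<Omega>"
    using dist_projection_le_infdist(2)[OF c(5)[OF that]] H(2)[OF that] \<delta>(1) by linarith
  show "\<pi>X x = x" if "x \<in> X"
  proof -
    have "dist x (\<pi>X x) \<le> infdist x X" using dist_projection_le_infdist(2)[OF c(5)] c(2) that by blast
    also have "\<dots> = 0" using that by simp
    finally show ?thesis by simp
  qed
  show "\<pi>L z \<in> L" if "z \<in> \<O>" by (rule dist_projection_le_infdist(1)[OF c(6)[OF that]])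
  show "dist z (\<pi>L z) \<le> \<delta>" if "z \<in> \<O>"
    using dist_projection_le_infdist(2)[OF c(6)[OF that]] HL(2)[OF that] \<delta>(2) by linarith
  show "\<exists>z\<in>\<O>. dist l z \<le> \<delta>" if "l \<in> L"
  proof -
    obtain z where "z \<in> \<O>" "infdist l \<O> = dist l z" using infdist_attains_inf[OF \<O>(1,3)] by blast
    then show ?thesis using HL(1)[OF that] \<delta>(2) by (intro bexI[of _ z]) auto
  qed
qed

text \<open>The domain assumption by itself only controls \<open>\<phi>\<close> near 0; the power bound makes \<open>\<sigma>_phi \<phi> h\<close> the
  supremum of a bounded set, hence nonnegative.\<close>

lemma scaling_facts:
  assumes dom: "domain_assumption \<Omega> \<phi> r" and B: "\<And>s. s \<in> {0<..r} \<Longrightarrow> \<phi> s \<le> B * s powr (9/5)"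
    and sc: "scaling_assumption \<phi> r t0 \<delta> h \<epsilon>" and pos: "h > 0" "\<epsilon> > 0" "t0 > 0"
  shows "2 * h \<le> \<epsilon>" "4 * \<delta> \<le> t0 * h"
proof -
  have s: "h \<le> r" "h / \<epsilon> < 1 / 2" "\<sigma>_phi \<phi> h + \<delta> / h \<le> t0 / (4 + 2 * \<sigma>_phi \<phi> h) * (1 - 2 * (h / \<epsilon>))"
    using sc by (auto simp: scaling_assumption_def)
  show "2 * h \<le> \<epsilon>" using s(2) pos by (simp add: field_simps)
  have \<phi>0: "\<And>s. s \<ge> 0 \<Longrightarrow> \<phi> s \<ge> 0" using dom by (simp add: domain_assumption_def)
  have "\<phi> s / s \<le> max B 0 * h powr (4/5)" if sh: "s \<in> {0<..h}" for s
  proof -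
    have "\<phi> s \<le> B * s powr (9/5)" using B[of s] sh s(1) by simp
    also have "\<dots> = B * s powr (4/5) * s" using sh powr_add[of s "4/5" 1] by simp
    finally have "\<phi> s / s \<le> B * s powr (4/5)" using sh by (simp add: divide_le_eq)
    also have "\<dots> \<le> max B 0 * h powr (4/5)" using sh by (intro mult_mono powr_mono2) auto
    finally show ?thesis .
  qed
  then have bdd: "bdd_above ((\<lambda>s. \<phi> s / s) ` {0<..h})" by (rule bdd_aboveI2)
  have "0 \<le> \<phi> h / h" using \<phi>0[of h] pos by simp
  also have "\<dots> \<le> \<sigma>_phi \<phi> h" unfolding \<sigma>_phi_def using pos by (intro cSUP_upper[OF _ bdd]) auto
  finally have \<sigma>: "\<sigma>_phi \<phi> h \<ge> 0" .
  have "0 \<le> h / \<epsilon>" using pos by simp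
  then have "t0 / (4 + 2 * \<sigma>_phi \<phi> h) * (1 - 2 * (h / \<epsilon>)) \<le> t0 / 4 * 1"
    using \<sigma> pos s(2) by (intro mult_mono divide_left_mono) auto
  then have "\<delta> / h \<le> t0 / 4" using s(3) \<sigma> by linarith
  then show "4 * \<delta> \<le> t0 * h" using pos by (simp add: field_simps)
qed

lemma resolution_rate:
  fixes c h \<delta> a :: real
  assumes "c > 0" "h > 0" "\<delta> \<ge> 0" "a > 0" "c * \<delta> powr a \<le> h"
  shows "\<delta> \<le> (1 / c) powr (1 / a) * h powr (1 / a)"
proof -
  have "\<delta> = (\<delta> powr a) powr (1 / a)" using assms by (simp add: powr_powr)
  also have "\<dots> \<le> (h / c) powr (1 / a)"
    using assms by (intro powr_mono2) (auto simp: field_simps)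
  also have "\<dots> = (1 / c) powr (1 / a) * h powr (1 / a)"
    using assms powr_mult[of "1 / c" h "1 / a"] by simp
  finally show ?thesis .
qed

text \<open>All hypotheses of the comparison are symmetric under the reflection of \<open>u\<close> and \<open>v\<close> except the
  balance of \<open>v\<close> and the cone comparison of \<open>u\<close>, of which both signs are available.\<close>

lemma comparison_setting_both_signs:
  assumes dom: "open \<Omega>" "connected \<Omega>" "bounded \<Omega>" "domain_assumption \<Omega> \<phi> r"
    and \<phi>: "\<And>s. s \<in> {0<..r} \<Longrightarrow> \<phi> s \<le> B0 * s powr (9/5)"
    and intr: "intrinsic_domain (closure \<Omega>) (geo_dist \<Omega>) B"
    and \<O>: "closed \<O>" "\<O> \<subseteq> closure \<Omega>" "\<O> \<noteq> {}" and kernel: "kernel_assumption \<eta> t0"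
    and u: "is_AMLE \<Omega> \<O> g u" and \<Lambda>: "\<Lambda> \<ge> 0"
      "\<And>x y. x \<in> closure \<Omega> \<Longrightarrow> y \<in> closure \<Omega> \<Longrightarrow> \<bar>u x - u y\<bar> \<le> \<Lambda> * geo_dist \<Omega> x y"
    and Um: "\<And>x. x \<in> closure \<Omega> \<Longrightarrow> \<bar>u x\<bar> \<le> U\<^sub>m"
    and cloud: "labelled_cloud \<Omega> \<O> X L \<pi>X \<pi>L" and h: "h > 0" "\<epsilon> > 0" "\<epsilon> \<le> 1"
    and lipL: "lip_const (graph_dist \<eta> h X) \<gamma> L \<le> ennreal M"
    and data: "\<And>z. z \<in> \<O> \<Longrightarrow> \<bar>\<gamma> (\<pi>L z) - g z\<bar> \<le> K * resolution \<Omega> \<O> X L"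
    and sc: "scaling_assumption \<phi> r t0 (resolution \<Omega> \<O> X L) h \<epsilon>"
    and v: "solves_graph_infinity_laplace \<eta> h X L \<gamma> v"
    and scale: "\<epsilon> * resolution \<Omega> \<O> X L \<le> C1 * h * h" "\<epsilon> * h powr (4/5) \<le> h"
  shows "comparison_setting (closure \<Omega>) (geo_dist \<Omega>) B X L \<eta> t0 h (resolution \<Omega> \<O> X L) \<pi>X
      \<O> u v \<Lambda> (max M 0) (max K 0) \<epsilon> C1 U\<^sub>m" (is "?setting u v")
    and "comparison_setting (closure \<Omega>) (geo_dist \<Omega>) B X L \<eta> t0 h (resolution \<Omega> \<O> X L) \<pi>X
      \<O> (\<lambda>x. - u x) (\<lambda>x. - v x) \<Lambda> (max M 0) (max K 0) \<epsilon> C1 U\<^sub>m"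
proof -
  define \<delta> where "\<delta> = resolution \<Omega> \<O> X L"
  interpret intrinsic_domain "closure \<Omega>" "geo_dist \<Omega>" B by fact
  note res = cloud_resolution[OF cloud \<O> dom(3), folded \<delta>_def]
  have sf: "2 * h \<le> \<epsilon>" "4 * \<delta> \<le> t0 * h"
    using scaling_facts[OF dom(4) \<phi> sc h(1,2)] kernel_pos[OF kernel] by (auto simp: \<delta>_def)
  have c: "finite X" "X \<subseteq> closure \<Omega>" "L \<subseteq> X" "L \<noteq> {}" using cloud by (auto simp: labelled_cloud_def)
  interpret G: graph_on_domain "closure \<Omega>" "geo_dist \<Omega>" B X L \<eta> t0 h \<delta> \<pi>X
    by unfold_locales (use c kernel h res sf in auto)
  have v\<gamma>: "v l = \<gamma> l" if "l \<in> L" for l using v that by (simp add: solves_graph_infinity_laplace_def)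
  have lab: "\<bar>v x - v y\<bar> \<le> max M 0 * G.\<rho> x y" if xy: "x \<in> L" "y \<in> L" for x y
  proof (cases "x = y")
    case False
    have X: "x \<in> X" "y \<in> X" "x \<in> closure \<Omega>" "y \<in> closure \<Omega>" using xy c by auto
    have "0 < geo_dist \<Omega> x y" using zero[OF X(3,4)] False nonneg[of x y] by linarith
    then have "0 < (1 + G.distortion) * G.\<rho> x y" using G.d_le_\<rho>[OF X(1,2)] by linarith
    then have "G.\<rho> x y > 0" using G.distortion_nonneg by (simp add: zero_less_mult_iff)
    moreover have "lip_const (graph_dist \<eta> h X) \<gamma> L \<le> ennreal (max M 0)"
      using lipL by (rule order_trans) (simp add: ennreal_leI)
    ultimately have "\<bar>\<gamma> x - \<gamma> y\<bar> \<le> max M 0 * G.\<rho> x y"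
      using xy False G.ennreal_\<rho>[OF X(1,2)] by (intro lip_const_D) auto
    then show ?thesis using v\<gamma> xy by simp
  qed (simp add: G.\<rho>_nonneg)
  note bal = G.balanced_if_solves[OF v]
  have v_lip: "\<bar>v x - v y\<bar> \<le> max M 0 * G.\<rho> x y" if "x \<in> X" "y \<in> X" for x y
    by (rule G.graph_lipschitz[OF bal _ lab that]) auto
  have lab_err: "\<exists>l\<in>L. dist z l \<le> \<delta> \<and> \<bar>v l - u z\<bar> \<le> max K 0 * \<delta>" if z: "z \<in> \<O>" for z
  proof (intro bexI[of _ "\<pi>L z"] conjI)
    have "\<bar>\<gamma> (\<pi>L z) - g z\<bar> \<le> K * \<delta>" using data[OF z] by (simp add: \<delta>_def)
    also have "\<dots> \<le> max K 0 * \<delta>" using G.\<delta>_nonneg by (intro mult_right_mono) auto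
    finally show "\<bar>v (\<pi>L z) - u z\<bar> \<le> max K 0 * \<delta>"
      using v\<gamma> res(4)[OF z] u z by (simp add: is_AMLE_def)
  qed (use res z in auto)
  have both: "?setting f w"
    if f: "is_AMLE \<Omega> \<O> g' f" "\<And>x y. \<bar>f x - f y\<bar> = \<bar>u x - u y\<bar>" "\<And>x. \<bar>f x\<bar> = \<bar>u x\<bar>"
      and w: "G.balanced (\<lambda>x. - w x)" "\<And>x y. \<bar>w x - w y\<bar> = \<bar>v x - v y\<bar>"
        "\<And>x y. \<bar>w x - f y\<bar> = \<bar>v x - u y\<bar>" for f w g'
    unfolding \<delta>_def[symmetric]
  proof (intro comparison_setting.intro comparison_setting_axioms.intro G.graph_on_domain_axioms)
    show "f x - f y \<le> \<Lambda> * geo_dist \<Omega> x y" if "x \<in> closure \<Omega>" "y \<in> closure \<Omega>" for x y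
    proof -
      have "\<bar>f x - f y\<bar> \<le> \<Lambda> * geo_dist \<Omega> x y" using \<Lambda>(2)[OF that] f(2)[of x y] by simp
      then show ?thesis by linarith
    qed
    show "\<exists>l\<in>L. dist z l \<le> \<delta> \<and> f z \<le> w l + max K 0 * \<delta>" if z: "z \<in> \<O>" for z
    proof -
      obtain l where l: "l \<in> L" "dist z l \<le> \<delta>" "\<bar>v l - u z\<bar> \<le> max K 0 * \<delta>" using lab_err[OF z] by blast
      have "\<bar>w l - f z\<bar> \<le> max K 0 * \<delta>" using l(3) w(3) by simp
      then have "f z \<le> w l + max K 0 * \<delta>" unfolding abs_le_iff by linarith
      then show ?thesis using l by blast
    qed
    show "cone_comparison \<O> f" by (rule AMLE_cone_comparison[OF intr f(1)])
    show "\<bar>w x - w y\<bar> \<le> max M 0 * G.\<rho> x y" if "x \<in> X" "y \<in> X" for x y using v_lip[OF that] w(2) by simp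
    show "\<bar>f x\<bar> \<le> U\<^sub>m" if "x \<in> closure \<Omega>" for x using Um[OF that] f(3) by simp
  qed (use \<O> \<Lambda>(1) res(6) w(1) sf h scale in \<open>auto simp: \<delta>_def\<close>)
  show "?setting u v" by (rule both[OF u]) (use bal in auto)
  show "?setting (\<lambda>x. - u x) (\<lambda>x. - v x)"
  proof (rule both[OF is_AMLE_minus[OF u]])
    show "G.balanced (\<lambda>x. - (- v x))" using bal(1) by simp
    show "\<bar>- u x - - u y\<bar> = \<bar>u x - u y\<bar>" "\<bar>- v x - - v y\<bar> = \<bar>v x - v y\<bar>" "\<bar>- v x - - u y\<bar> = \<bar>v x - u y\<bar>" for x y
      by linarith+
  qed simp
qed

lemma sup_comparisons:
  fixes u v :: "'a::euclidean_space \<Rightarrow> real"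
  assumes X: "X \<subseteq> S" "X \<noteq> {}" and \<pi>: "\<And>x. x \<in> S \<Longrightarrow> \<pi> x \<in> X" "\<And>x. x \<in> X \<Longrightarrow> \<pi> x = x"
    and E: "\<And>x. x \<in> S \<Longrightarrow> \<bar>u x - v (\<pi> x)\<bar> \<le> E" and osc: "\<And>x. x \<in> S \<Longrightarrow> \<bar>u x - u (\<pi> x)\<bar> \<le> D"
  shows "(SUP x\<in>X. \<bar>u x - v x\<bar>) \<le> (SUP x\<in>S. \<bar>u x - v (\<pi> x)\<bar>)"
    "(SUP x\<in>S. \<bar>u x - v (\<pi> x)\<bar>) \<le> (SUP x\<in>X. \<bar>u x - v x\<bar>) + D"
    "(SUP x\<in>S. \<bar>u x - v (\<pi> x)\<bar>) \<le> E"
proof -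
  have S: "S \<noteq> {}" using X by auto
  have bdd: "bdd_above ((\<lambda>x. \<bar>u x - v (\<pi> x)\<bar>) ` S)" using E by (rule bdd_aboveI2)
  have "\<bar>u x - v x\<bar> \<le> E" if "x \<in> X" for x using E[of x] \<pi>(2)[OF that] X(1) that by auto
  then have bddX: "bdd_above ((\<lambda>x. \<bar>u x - v x\<bar>) ` X)" by (rule bdd_aboveI2)
  show "(SUP x\<in>X. \<bar>u x - v x\<bar>) \<le> (SUP x\<in>S. \<bar>u x - v (\<pi> x)\<bar>)"
  proof (rule cSUP_least[OF X(2)])
    fix x assume x: "x \<in> X"
    then have "\<bar>u x - v (\<pi> x)\<bar> \<le> (SUP x\<in>S. \<bar>u x - v (\<pi> x)\<bar>)" using X(1) by (intro cSUP_upper[OF _ bdd]) auto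
    then show "\<bar>u x - v x\<bar> \<le> (SUP x\<in>S. \<bar>u x - v (\<pi> x)\<bar>)" using \<pi>(2)[OF x] by simp
  qed
  show "(SUP x\<in>S. \<bar>u x - v (\<pi> x)\<bar>) \<le> (SUP x\<in>X. \<bar>u x - v x\<bar>) + D"
  proof (rule cSUP_least[OF S])
    fix x assume x: "x \<in> S"
    have "\<bar>u (\<pi> x) - v (\<pi> x)\<bar> \<le> (SUP x\<in>X. \<bar>u x - v x\<bar>)" by (rule cSUP_upper[OF \<pi>(1)[OF x] bddX])
    then show "\<bar>u x - v (\<pi> x)\<bar> \<le> (SUP x\<in>X. \<bar>u x - v x\<bar>) + D" using osc[OF x] by linarith
  qed
  show "(SUP x\<in>S. \<bar>u x - v (\<pi> x)\<bar>) \<le> E" by (rule cSUP_least[OF S E])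
qed

lemma small_scale:
  fixes h a :: real
  assumes "h > 0" "0 < a" "a < 1" "h / h powr a < 1 / 2"
  shows "h \<le> 1" "h powr a \<le> 1"
proof -
  have "h powr (1 - a) < 1" using assms(1,4) by (simp add: powr_diff)
  then show "h \<le> 1" using ge_one_powr_ge_zero[of h "1 - a"] assms(3) by (cases "h \<le> 1") auto
  then show "h powr a \<le> 1" using assms powr_mono2[of a h 1] by simp
qed

theorem corollary2p5:
  fixes \<Omega> \<O> :: "'a::euclidean_space set"
    and g u :: "'a \<Rightarrow> real"
    and \<phi> \<eta> :: "real \<Rightarrow> real"
    and r t0 M K c :: real
  assumes "open \<Omega>" "bounded \<Omega>" "connected \<Omega>" "\<Omega> \<noteq> {}"
    and "domain_assumption \<Omega> \<phi> r"
    and "\<exists>B. \<forall>s\<in>{0<..r}. \<phi> s \<le> B * s powr (9/5)"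
    and "closed \<O>" "\<O> \<subseteq> closure \<Omega>" "\<O> \<noteq> {}"
    and "kernel_assumption \<eta> t0"
    and "is_AMLE \<Omega> \<O> g u"
    and "c > 0"
  shows
    "(\<exists>C>0. \<forall>X L \<gamma> \<pi>X \<pi>L h.
        (\<forall>n::nat. labelled_cloud \<Omega> \<O> (X n) (L n) (\<pi>X n) (\<pi>L n)) \<and> h > 0 \<and>
        data_assumption \<Omega> \<O> g \<eta> h X L \<gamma> \<pi>L M K \<longrightarrow>
        (\<forall>n v.
           scaling_assumption \<phi> r t0 (resolution \<Omega> \<O> (X n) (L n)) h (h powr (1/5)) \<and>
           h \<ge> c * resolution \<Omega> \<O> (X n) (L n) powr (5/9) \<and>
           solves_graph_infinity_laplace \<eta> h (X n) (L n) (\<gamma> n) v \<longrightarrow>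
           (SUP x\<in>X n. \<bar>u x - v x\<bar>) \<le> (SUP x\<in>closure \<Omega>. \<bar>u x - v (\<pi>X n x)\<bar>) \<and>
           (SUP x\<in>closure \<Omega>. \<bar>u x - v (\<pi>X n x)\<bar>) \<le>
             (SUP x\<in>X n. \<bar>u x - v x\<bar>) + C * resolution \<Omega> \<O> (X n) (L n) \<and>
           (SUP x\<in>closure \<Omega>. \<bar>u x - v (\<pi>X n x)\<bar>) \<le> C * h powr (1/5))) \<and>
     (gradient_bounded_below \<Omega> u \<longrightarrow>
      (\<exists>C>0. \<forall>X L \<gamma> \<pi>X \<pi>L h.
        (\<forall>n::nat. labelled_cloud \<Omega> \<O> (X n) (L n) (\<pi>X n) (\<pi>L n)) \<and> h > 0 \<and>
        data_assumption \<Omega> \<O> g \<eta> h X L \<gamma> \<pi>L M K \<longrightarrow>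
        (\<forall>n v.
           scaling_assumption \<phi> r t0 (resolution \<Omega> \<O> (X n) (L n)) h (h powr (1/3)) \<and>
           h \<ge> c * resolution \<Omega> \<O> (X n) (L n) powr (3/5) \<and>
           solves_graph_infinity_laplace \<eta> h (X n) (L n) (\<gamma> n) v \<longrightarrow>
           (SUP x\<in>X n. \<bar>u x - v x\<bar>) \<le> (SUP x\<in>closure \<Omega>. \<bar>u x - v (\<pi>X n x)\<bar>) \<and>
           (SUP x\<in>closure \<Omega>. \<bar>u x - v (\<pi>X n x)\<bar>) \<le>
             (SUP x\<in>X n. \<bar>u x - v x\<bar>) + C * resolution \<Omega> \<O> (X n) (L n) \<and>
           (SUP x\<in>closure \<Omega>. \<bar>u x - v (\<pi>X n x)\<bar>) \<le> C * h powr (1/3))))"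
proof -
  obtain B0 where \<phi>: "\<And>s. s \<in> {0<..r} \<Longrightarrow> \<phi> s \<le> B0 * s powr (9/5)" using assms(6) by blast
  note dom = assms(1,3,5)
  obtain B where intr: "intrinsic_domain (closure \<Omega>) (geo_dist \<Omega>) B"
    by (rule intrinsic_domain_geo_dist[OF dom assms(2,4) \<phi>])
  interpret intrinsic_domain "closure \<Omega>" "geo_dist \<Omega>" B by fact
  note \<O> = assms(7-9)
  note kernel = assms(10)
  note u = assms(11)
  have cl_ne: "closure \<Omega> \<noteq> {}" using assms(4) by simp
  show ?thesis
  proof (cases "Lip_domain \<Omega> g \<O> < \<infinity>")
    case False
    then have no: "\<not> data_assumption \<Omega> \<O> g \<eta> h X L \<gamma> \<pi>L M K" for X L \<gamma> \<pi>L h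
      by (simp add: data_assumption_def)
    \<comment> \<open>no labelled cloud satisfies the data assumption, so that any constant will do\<close>
    show ?thesis by (intro conjI impI exI[of _ 1]) (simp_all add: no)
  next
    case True
    obtain \<Lambda> where \<Lambda>: "\<Lambda> \<ge> 0"
        "\<And>x y. x \<in> closure \<Omega> \<Longrightarrow> y \<in> closure \<Omega> \<Longrightarrow> \<bar>u x - u y\<bar> \<le> \<Lambda> * geo_dist \<Omega> x y"
      by (rule AMLE_lipschitz[OF intr u \<O>(1,2) True]) (rule that)
    have "continuous_on (closure \<Omega>) u" using u by (simp add: is_AMLE_def)
    then have "bounded (u ` closure \<Omega>)" by (intro compact_imp_bounded compact_continuous_image compact_S)
    then obtain U\<^sub>m where Um: "\<And>x. x \<in> closure \<Omega> \<Longrightarrow> \<bar>u x\<bar> \<le> U\<^sub>m" by (auto simp: bounded_iff)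
    have t0: "t0 > 0" using kernel_pos[OF kernel] by simp
    define D where "D = \<kappa> * diameter (closure \<Omega>)"
    have D0: "D \<ge> 0"
      using \<kappa>_ge_1 diameter_ge_0[OF compact_imp_bounded[OF compact_S]] by (simp add: D_def)
    define bc where "bc = boundary_error \<Lambda> (max M 0) (max K 0)"
    define cc where "cc C1 = consistency_error (max M 0) C1 t0" for C1
    have bc0: "bc \<ge> 0" using \<Lambda>(1) \<kappa>_ge_1 by (simp add: bc_def boundary_error_def)
    have cc0: "cc C1 \<ge> 0" if "C1 \<ge> 0" for C1
      using that \<kappa>_ge_1 B_nonneg t0 unfolding cc_def consistency_error_def by (intro mult_nonneg_nonneg add_nonneg_nonneg) auto
    have \<delta>0: "resolution \<Omega> \<O> X L \<ge> 0" if "labelled_cloud \<Omega> \<O> X L \<pi>X \<pi>L" for X L \<pi>X \<pi>L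
    proof -
      from cl_ne obtain x where "x \<in> closure \<Omega>" unfolding ex_in_conv[symmetric] by (rule exE)
      from cloud_resolution(2)[OF that \<O> assms(2) this] show ?thesis by (rule order_trans[OF zero_le_dist])
    qed
    \<comment> \<open>both parts share the passage from pointwise one-sided bounds to the suprema\<close>
    have final: "(SUP x\<in>X. \<bar>u x - v x\<bar>) \<le> (SUP x\<in>closure \<Omega>. \<bar>u x - v (\<pi>X x)\<bar>) \<and>
        (SUP x\<in>closure \<Omega>. \<bar>u x - v (\<pi>X x)\<bar>) \<le> (SUP x\<in>X. \<bar>u x - v x\<bar>) + C * resolution \<Omega> \<O> X L \<and>
        (SUP x\<in>closure \<Omega>. \<bar>u x - v (\<pi>X x)\<bar>) \<le> C * \<epsilon>"
      if cloud: "labelled_cloud \<Omega> \<O> X L \<pi>X \<pi>L" and \<epsilon>: "\<epsilon> > 0" and C: "C = E + \<Lambda> * \<kappa> + 1"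
        and E: "E \<ge> 0" "\<And>x. x \<in> closure \<Omega> \<Longrightarrow> u x - v (\<pi>X x) \<le> \<epsilon> * E"
          "\<And>x. x \<in> closure \<Omega> \<Longrightarrow> - u x - - v (\<pi>X x) \<le> \<epsilon> * E"
      for X L \<pi>X \<pi>L v \<epsilon> C E
    proof -
      note res = cloud_resolution[OF cloud \<O> assms(2)]
      have X: "X \<subseteq> closure \<Omega>" "X \<noteq> {}" using cloud by (auto simp: labelled_cloud_def)
      have err: "\<bar>u x - v (\<pi>X x)\<bar> \<le> \<epsilon> * E" if "x \<in> closure \<Omega>" for x
        using E(2,3)[OF that] by (simp add: abs_le_iff)
      have osc: "\<bar>u x - u (\<pi>X x)\<bar> \<le> \<Lambda> * (\<kappa> * resolution \<Omega> \<O> X L)" if x: "x \<in> closure \<Omega>" for x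
      proof -
        have p: "\<pi>X x \<in> closure \<Omega>" using res(1)[OF x] X(1) by blast
        have "geo_dist \<Omega> x (\<pi>X x) \<le> \<kappa> * resolution \<Omega> \<O> X L"
          using d_le_\<kappa>[OF x p] mult_left_mono[OF res(2)[OF x], of \<kappa>] \<kappa>_ge_1 by linarith
        then show ?thesis by (rule order_trans[OF \<Lambda>(2)[OF x p] mult_left_mono[OF _ \<Lambda>(1)]])
      qed
      note sc = sup_comparisons[where S = "closure \<Omega>" and X = X and \<pi> = \<pi>X and u = u and v = v
          and E = "\<epsilon> * E" and D = "\<Lambda> * (\<kappa> * resolution \<Omega> \<O> X L)", OF X res(1,3) err osc]
      have "\<Lambda> * (\<kappa> * resolution \<Omega> \<O> X L) \<le> C * resolution \<Omega> \<O> X L"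
        unfolding C mult.assoc[symmetric] using \<delta>0[OF cloud] E(1) by (intro mult_right_mono) auto
      moreover have "\<epsilon> * E \<le> C * \<epsilon>"
      proof -
        have "E \<le> C" unfolding C using mult_nonneg_nonneg[OF \<Lambda>(1), of \<kappa>] \<kappa>_ge_1 by linarith
        then have "E * \<epsilon> \<le> C * \<epsilon>" using \<epsilon> by (intro mult_right_mono) auto
        then show ?thesis by (simp only: mult.commute)
      qed
      ultimately show ?thesis using sc by linarith
    qed
    \<comment> \<open>\<open>u\<close> and its reflection \<open>-u\<close> satisfy the same hypotheses\<close>
    have setting: "comparison_setting (closure \<Omega>) (geo_dist \<Omega>) B X L \<eta> t0 h (resolution \<Omega> \<O> X L) \<pi>X
          \<O> u v \<Lambda> (max M 0) (max K 0) (h powr b) ((1/c) powr (1/a)) U\<^sub>m"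
        "comparison_setting (closure \<Omega>) (geo_dist \<Omega>) B X L \<eta> t0 h (resolution \<Omega> \<O> X L) \<pi>X
          \<O> (\<lambda>x. - u x) (\<lambda>x. - v x) \<Lambda> (max M 0) (max K 0) (h powr b) ((1/c) powr (1/a)) U\<^sub>m"
      if cloud: "labelled_cloud \<Omega> \<O> X L \<pi>X \<pi>L" and h: "h > 0"
        and lipL: "Lip_graph \<eta> h X \<gamma> L \<le> ennreal M"
        and dat: "\<And>z. z \<in> \<O> \<Longrightarrow> \<bar>\<gamma> (\<pi>L z) - g z\<bar> \<le> K * resolution \<Omega> \<O> X L"
        and sc: "scaling_assumption \<phi> r t0 (resolution \<Omega> \<O> X L) h (h powr b)"
        and hc: "h \<ge> c * resolution \<Omega> \<O> X L powr a"
        and v: "solves_graph_infinity_laplace \<eta> h X L \<gamma> v"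
        and ab: "a > 0" "1 / a = 2 - b" "1/5 \<le> b" "b < 1"
      for X L \<gamma> \<pi>X \<pi>L h v a b
    proof -
      define \<delta> where "\<delta> = resolution \<Omega> \<O> X L"
      have \<epsilon>: "h powr b > 0" using h by simp
      have "h / h powr b < 1 / 2" using sc by (simp add: scaling_assumption_def)
      then have h1: "h \<le> 1" "h powr b \<le> 1" using small_scale[of h b] h ab by auto
      have rate: "\<delta> \<le> (1/c) powr (1/a) * h powr (1/a)"
        by (rule resolution_rate) (use assms(12) h \<delta>0[OF cloud] ab hc in \<open>auto simp: \<delta>_def\<close>)
      have "h powr b * \<delta> \<le> h powr b * ((1/c) powr (1/a) * h powr (1/a))"
        using rate by (intro mult_left_mono) auto
      also have "\<dots> = (1/c) powr (1/a) * (h powr (b + (2 - b)))"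
        unfolding ab(2) powr_add by simp
      also have "h powr (b + (2 - b)) = h * h" using h by (simp add: powr_numeral power2_eq_square)
      finally have s1: "h powr b * \<delta> \<le> (1/c) powr (1/a) * h * h" by simp
      have "h powr b * h powr (4/5) = h powr (b + 4/5)" by (simp add: powr_add)
      also have "\<dots> \<le> h powr 1" using h1(1) h ab by (intro powr_mono') auto
      finally have s2: "h powr b * h powr (4/5) \<le> h" using h by simp
      note both = comparison_setting_both_signs[OF assms(1,3,2,5) \<phi> intr \<O> kernel u \<Lambda> Um cloud h \<epsilon> h1(2) lipL dat sc v
            s1[unfolded \<delta>_def] s2]
      show "comparison_setting (closure \<Omega>) (geo_dist \<Omega>) B X L \<eta> t0 h (resolution \<Omega> \<O> X L) \<pi>X
          \<O> u v \<Lambda> (max M 0) (max K 0) (h powr b) ((1/c) powr (1/a)) U\<^sub>m" by (rule both(1))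
      show "comparison_setting (closure \<Omega>) (geo_dist \<Omega>) B X L \<eta> t0 h (resolution \<Omega> \<O> X L) \<pi>X
          \<O> (\<lambda>x. - u x) (\<lambda>x. - v x) \<Lambda> (max M 0) (max K 0) (h powr b) ((1/c) powr (1/a)) U\<^sub>m" by (rule both(2))
    qed
    have pow: "(h powr (1 / real k)) ^ k = h" if "h > 0" "k > 0" for h and k :: nat
      using that by (simp add: powr_realpow[symmetric] powr_powr)
    let ?rate = "\<lambda>C b a. \<forall>X L \<gamma> \<pi>X \<pi>L h.
        (\<forall>n::nat. labelled_cloud \<Omega> \<O> (X n) (L n) (\<pi>X n) (\<pi>L n)) \<and> h > 0 \<and>
        data_assumption \<Omega> \<O> g \<eta> h X L \<gamma> \<pi>L M K \<longrightarrow>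
        (\<forall>n v.
           scaling_assumption \<phi> r t0 (resolution \<Omega> \<O> (X n) (L n)) h (h powr b) \<and>
           h \<ge> c * resolution \<Omega> \<O> (X n) (L n) powr a \<and>
           solves_graph_infinity_laplace \<eta> h (X n) (L n) (\<gamma> n) v \<longrightarrow>
           (SUP x\<in>X n. \<bar>u x - v x\<bar>) \<le> (SUP x\<in>closure \<Omega>. \<bar>u x - v (\<pi>X n x)\<bar>) \<and>
           (SUP x\<in>closure \<Omega>. \<bar>u x - v (\<pi>X n x)\<bar>) \<le>
             (SUP x\<in>X n. \<bar>u x - v x\<bar>) + C * resolution \<Omega> \<O> (X n) (L n) \<and>
           (SUP x\<in>closure \<Omega>. \<bar>u x - v (\<pi>X n x)\<bar>) \<le> C * h powr b)"
    have part1: "\<exists>C>0. ?rate C (1/5) (5/9)"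
    proof -
      define k where "k = cc ((1/c) powr (1/(5/9)))"
      have k: "k \<ge> 0" unfolding k_def by (rule cc0) simp
      define E where "E = (2 * D + 2) + (2 * k + 2) * (2 * U\<^sub>m + (2 * D + 2))\<^sup>2 + bc"
      have E: "E \<ge> 0" using D0 k bc0 by (simp add: E_def)
      show ?thesis
      proof (rule exI[of _ "E + \<Lambda> * \<kappa> + 1"], rule conjI)
        show "E + \<Lambda> * \<kappa> + 1 > 0" using E mult_nonneg_nonneg[OF \<Lambda>(1), of \<kappa>] \<kappa>_ge_1 by linarith
        show "?rate (E + \<Lambda> * \<kappa> + 1) (1/5) (5/9)"
        proof (intro allI impI, goal_cases)
        case (1 X L \<gamma> \<pi>X \<pi>L h n v)
        then have cloud: "labelled_cloud \<Omega> \<O> (X n) (L n) (\<pi>X n) (\<pi>L n)" and h: "h > 0" by auto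
        have lipL: "Lip_graph \<eta> h (X n) (\<gamma> n) (L n) \<le> ennreal M"
          and dat: "\<And>z. z \<in> \<O> \<Longrightarrow> \<bar>\<gamma> n (\<pi>L n z) - g z\<bar> \<le> K * resolution \<Omega> \<O> (X n) (L n)"
          using 1 by (auto simp: data_assumption_def SUP_le_iff)
        have rest: "scaling_assumption \<phi> r t0 (resolution \<Omega> \<O> (X n) (L n)) h (h powr (1/5))"
          "h \<ge> c * resolution \<Omega> \<O> (X n) (L n) powr (5/9)"
          "solves_graph_infinity_laplace \<eta> h (X n) (L n) (\<gamma> n) v"
          using 1 by auto
        have ab: "(5/9 :: real) > 0" "1 / (5/9) = 2 - (1/5 :: real)" "1/5 \<le> (1/5 :: real)" "(1/5 :: real) < 1" by auto
        note P = setting(1)[OF cloud h lipL dat rest ab] and N = setting(2)[OF cloud h lipL dat rest ab]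
        have h5: "h \<le> (h powr (1/5)) ^ 5" using pow[OF h, of 5] by simp
        show ?case
        proof (rule final[OF cloud _ refl E])
          fix x assume x: "x \<in> closure \<Omega>"
          show "u x - v (\<pi>X n x) \<le> h powr (1/5) * E"
            using comparison_setting.general_estimate[OF P \<O>(3) _ h5 x] k
            unfolding E_def D_def k_def cc_def bc_def by simp
          show "- u x - - v (\<pi>X n x) \<le> h powr (1/5) * E"
            using comparison_setting.general_estimate[OF N \<O>(3) _ h5 x] k
            unfolding E_def D_def k_def cc_def bc_def by simp
        qed (use h in simp)
        qed
      qed
    qed
    have part2: "\<exists>C>0. ?rate C (1/3) (3/5)"
      if grad: "gradient_bounded_below \<Omega> u"
    proof -
      obtain \<alpha> where \<alpha>: "\<alpha> > 0" "\<And>x D. x \<in> \<Omega> \<Longrightarrow> GDERIV u x :> D \<Longrightarrow> \<alpha> \<le> norm D"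
        using grad unfolding gradient_bounded_below_def by blast
      have \<alpha>': "\<alpha> \<le> norm D" if "x \<in> \<Omega>" "GDERIV (\<lambda>x. - u x) x :> D" for x D
        using \<alpha>(2)[OF that(1), of "- D"] GDERIV_minus[OF that(2)] by simp
      define k where "k = cc ((1/c) powr (1/(3/5)))"
      have k: "k \<ge> 0" unfolding k_def by (rule cc0) simp
      define E where "E = (2 * k + 2) / \<alpha>\<^sup>2 * (2 * U\<^sub>m)\<^sup>2 + bc"
      have E: "E \<ge> 0" using k bc0 by (simp add: E_def)
      have metric: "Metric_space (closure \<Omega>) (geo_dist \<Omega>)" by (rule Metric_space_geo_dist[OF dom])
      have slope: "f x + \<alpha> * (2 * \<epsilon>) \<le> ball_sup f (2 * \<epsilon>) x"
        if "is_AMLE \<Omega> \<O> g' f" "\<And>x y. x \<in> closure \<Omega> \<Longrightarrow> y \<in> closure \<Omega> \<Longrightarrow> f x - f y \<le> \<Lambda> * geo_dist \<Omega> x y"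
          "\<And>x D. x \<in> \<Omega> \<Longrightarrow> GDERIV f x :> D \<Longrightarrow> \<alpha> \<le> norm D" "\<epsilon> > 0" "x \<in> closure \<Omega>"
          "\<And>z. z \<in> \<O> \<Longrightarrow> 2 * \<epsilon> \<le> geo_dist \<Omega> x z" for f g' \<epsilon> x
        by (rule slope_ge_of_gradient_ge[OF AMLE_cone_comparison[OF intr that(1)] \<Lambda>(1) that(2) assms(1) refl
              geo_dist_segment[OF _ metric] that(3) \<alpha>(1) that(5) _ that(6) \<O>(2)]) (use that(4) in auto)
      show ?thesis
      proof (rule exI[of _ "E + \<Lambda> * \<kappa> + 1"], rule conjI)
        show "E + \<Lambda> * \<kappa> + 1 > 0" using E mult_nonneg_nonneg[OF \<Lambda>(1), of \<kappa>] \<kappa>_ge_1 by linarith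
        show "?rate (E + \<Lambda> * \<kappa> + 1) (1/3) (3/5)"
        proof (intro allI impI, goal_cases)
        case (1 X L \<gamma> \<pi>X \<pi>L h n v)
        then have cloud: "labelled_cloud \<Omega> \<O> (X n) (L n) (\<pi>X n) (\<pi>L n)" and h: "h > 0" by auto
        have lipL: "Lip_graph \<eta> h (X n) (\<gamma> n) (L n) \<le> ennreal M"
          and dat: "\<And>z. z \<in> \<O> \<Longrightarrow> \<bar>\<gamma> n (\<pi>L n z) - g z\<bar> \<le> K * resolution \<Omega> \<O> (X n) (L n)"
          using 1 by (auto simp: data_assumption_def SUP_le_iff)
        have rest: "scaling_assumption \<phi> r t0 (resolution \<Omega> \<O> (X n) (L n)) h (h powr (1/3))"
          "h \<ge> c * resolution \<Omega> \<O> (X n) (L n) powr (3/5)"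
          "solves_graph_infinity_laplace \<eta> h (X n) (L n) (\<gamma> n) v"
          using 1 by auto
        have ab: "(3/5 :: real) > 0" "1 / (3/5) = 2 - (1/3 :: real)" "1/5 \<le> (1/3 :: real)" "(1/3 :: real) < 1" by auto
        note P = setting(1)[OF cloud h lipL dat rest ab] and N = setting(2)[OF cloud h lipL dat rest ab]
        have h3: "h \<le> (h powr (1/3)) ^ 3" using pow[OF h, of 3] by simp
        have P_slope: "u x + \<alpha> * (2 * h powr (1/3)) \<le> ball_sup u (2 * h powr (1/3)) x"
          if "x \<in> core_of \<O> (h powr (1/3))" for x
        proof (rule slope[OF u _ \<alpha>(2)])
          show "u x - u y \<le> \<Lambda> * geo_dist \<Omega> x y" if "x \<in> closure \<Omega>" "y \<in> closure \<Omega>" for x y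
            using \<Lambda>(2)[OF that] by linarith
        qed (use that h in \<open>auto simp: core_of_def\<close>)
        have N_slope: "- u x + \<alpha> * (2 * h powr (1/3)) \<le> ball_sup (\<lambda>x. - u x) (2 * h powr (1/3)) x"
          if "x \<in> core_of \<O> (h powr (1/3))" for x
        proof (rule slope[OF is_AMLE_minus[OF u] _ \<alpha>'])
          show "- u x - - u y \<le> \<Lambda> * geo_dist \<Omega> x y" if "x \<in> closure \<Omega>" "y \<in> closure \<Omega>" for x y
            using \<Lambda>(2)[OF that] by linarith
        qed (use that h in \<open>auto simp: core_of_def\<close>)
        show ?case
        proof (rule final[OF cloud _ refl E])
          fix x assume x: "x \<in> closure \<Omega>"
          show "u x - v (\<pi>X n x) \<le> h powr (1/3) * E"
            using comparison_setting.estimate_with_gradient_bound[OF P \<alpha>(1) _ h3 P_slope x] k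
            unfolding E_def k_def cc_def bc_def by simp
          show "- u x - - v (\<pi>X n x) \<le> h powr (1/3) * E"
            using comparison_setting.estimate_with_gradient_bound[OF N \<alpha>(1) _ h3 N_slope x] k
            unfolding E_def k_def cc_def bc_def by simp
        qed (use h in simp)
        qed
      qed
    qed
    show ?thesis by (intro conjI impI part1 part2)
  qed
qed

end
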